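(* Let $R$ be an indecomposable, non finite dimensional, noetherian FCR-algebra over a field $k$. Let $I_0\subseteq R$ be a two-sided ideal of finite codimension. Then there are uncountably many pairwise non-isomorphic countably generated projective right $R$-modules that are not fair sized and whose trace ideal is contained in $I_0$.
   Context: A $k$-algebra $R$ (associative with $1$) is an FCR-algebra if every finite dimensional representation of $R$ is completely reducible and the intersection of the kernels of all finite dimensional representations of $R$ is zero. Indecomposable means indecomposable as a ring. Noetherian means left and right noetherian. The trace ideal of a right $R$-module $P$ is $\mathrm{Tr}(P)=\sum_{f\in \mathrm{Hom}_R(P,R)}f(P)$. For a right $R$-module $M$, let $\mathcal{I}(M)$ be the set of two-sided ideals $I$ of $R$ such that $M/MI$ is finitely generated. A countably generated projective right $R$-module $P$ is fair sized if $\mathcal{I}(P)$ has a minimal element with respect to inclusion. *)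

theory Defs
  imports
    "HOL-Algebra.AbelCoset"
    "HOL-Library.Countable_Set"
    "Jordan_Normal_Form.Matrix"
begin

section \<open>Algebras over a field\<close>

text \<open>The ring is a type of class \<^class>\<open>ring_1\<close>, so it is associative and unital with
  \<open>0 \<noteq> 1\<close>; it need not be commutative.\<close>

locale k_algebra = vector_space scale
  for scale :: "'k::field \<Rightarrow> 'a::ring_1 \<Rightarrow> 'a" +
  assumes scale_mult_left: "scale c (x * y) = scale c x * y"
    and scale_mult_right: "scale c (x * y) = x * scale c y"

definition right_ideal :: "'a::ring_1 set \<Rightarrow> bool" where
  "right_ideal I \<longleftrightarrow> 0 \<in> I \<and> (\<forall>x\<in>I. \<forall>y\<in>I. x + y \<in> I) \<and> (\<forall>x\<in>I. \<forall>r. x * r \<in> I)"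

definition left_ideal :: "'a::ring_1 set \<Rightarrow> bool" where
  "left_ideal I \<longleftrightarrow> 0 \<in> I \<and> (\<forall>x\<in>I. \<forall>y\<in>I. x + y \<in> I) \<and> (\<forall>x\<in>I. \<forall>r. r * x \<in> I)"

definition two_sided_ideal :: "'a::ring_1 set \<Rightarrow> bool" where
  "two_sided_ideal I \<longleftrightarrow> left_ideal I \<and> right_ideal I"

definition noetherian_ring_type :: "'a::ring_1 itself \<Rightarrow> bool" where
  "noetherian_ring_type _ \<longleftrightarrow>
     (\<forall>C :: nat \<Rightarrow> 'a set.
        (\<forall>n. right_ideal (C n) \<and> C n \<subseteq> C (Suc n)) \<longrightarrow> (\<exists>N. \<forall>n\<ge>N. C n = C N)) \<and>
     (\<forall>C :: nat \<Rightarrow> 'a set.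
        (\<forall>n. left_ideal (C n) \<and> C n \<subseteq> C (Suc n)) \<longrightarrow> (\<exists>N. \<forall>n\<ge>N. C n = C N))"

text \<open>A decomposition as a product of two rings is the same as an internal direct sum
  decomposition \<open>R = I \<oplus> J\<close> into two-sided ideals.\<close>

definition indecomposable_ring_type :: "'a::ring_1 itself \<Rightarrow> bool" where
  "indecomposable_ring_type _ \<longleftrightarrow>
     (\<forall>I J :: 'a set. two_sided_ideal I \<and> two_sided_ideal J \<and>
        I \<inter> J = {0} \<and> {x + y | x y. x \<in> I \<and> y \<in> J} = UNIV \<longrightarrow> I = {0} \<or> J = {0})"

definition finite_codim :: "('k::field \<Rightarrow> 'a::ring_1 \<Rightarrow> 'a) \<Rightarrow> 'a set \<Rightarrow> bool" where
  "finite_codim scale I \<longleftrightarrow> (\<exists>B. finite B \<and> Modules.module.span scale (I \<union> B) = UNIV)"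

definition finite_dim :: "('k::field \<Rightarrow> 'a::ring_1 \<Rightarrow> 'a) \<Rightarrow> bool" where
  "finite_dim scale \<longleftrightarrow> (\<exists>B. finite B \<and> Modules.module.span scale B = UNIV)"


section \<open>Finite dimensional representations and FCR-algebras\<close>

text \<open>Finite dimensional representations are taken in coordinates, i.e. as unital
  \<open>k\<close>-algebra homomorphisms into the algebra of \<open>n \<times> n\<close> matrices acting on column vectors.
  The case \<open>n = 0\<close> is allowed.\<close>

definition representation ::
  "('k::field \<Rightarrow> 'a::ring_1 \<Rightarrow> 'a) \<Rightarrow> nat \<Rightarrow> ('a \<Rightarrow> 'k mat) \<Rightarrow> bool" where
  "representation scale n \<rho> \<longleftrightarrow>
     (\<forall>r. \<rho> r \<in> carrier_mat n n) \<and>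
     \<rho> 1 = 1\<^sub>m n \<and>
     (\<forall>r s. \<rho> (r + s) = \<rho> r + \<rho> s) \<and>
     (\<forall>r s. \<rho> (r * s) = \<rho> r * \<rho> s) \<and>
     (\<forall>c r. \<rho> (scale c r) = c \<cdot>\<^sub>m \<rho> r)"

definition subrepresentation :: "nat \<Rightarrow> ('a::ring_1 \<Rightarrow> 'k::field mat) \<Rightarrow> 'k vec set \<Rightarrow> bool" where
  "subrepresentation n \<rho> W \<longleftrightarrow>
     W \<subseteq> carrier_vec n \<and> 0\<^sub>v n \<in> W \<and>
     (\<forall>v\<in>W. \<forall>w\<in>W. v + w \<in> W) \<and>
     (\<forall>c. \<forall>w\<in>W. c \<cdot>\<^sub>v w \<in> W) \<and>
     (\<forall>r. \<forall>w\<in>W. \<rho> r *\<^sub>v w \<in> W)"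

definition irreducible_subrepresentation ::
  "nat \<Rightarrow> ('a::ring_1 \<Rightarrow> 'k::field mat) \<Rightarrow> 'k vec set \<Rightarrow> bool" where
  "irreducible_subrepresentation n \<rho> W \<longleftrightarrow>
     subrepresentation n \<rho> W \<and> W \<noteq> {0\<^sub>v n} \<and>
     (\<forall>U. subrepresentation n \<rho> U \<and> U \<subseteq> W \<longrightarrow> U = {0\<^sub>v n} \<or> U = W)"

text \<open>The representation space is an internal direct sum \<open>W 0 \<oplus> \<dots> \<oplus> W (m - 1)\<close> of
  irreducible subrepresentations.\<close>

definition completely_reducible :: "nat \<Rightarrow> ('a::ring_1 \<Rightarrow> 'k::field mat) \<Rightarrow> bool" where
  "completely_reducible n \<rho> \<longleftrightarrow>
     (\<exists>(m::nat) W. (\<forall>j<m. irreducible_subrepresentation n \<rho> (W j)) \<and>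
        (\<forall>v\<in>carrier_vec n. \<exists>!w. w \<in> (\<Pi>\<^sub>E j\<in>{..<m}. W j) \<and>
           v = finsum_vec TYPE('k) n w {..<m}))"

definition rep_kernel :: "nat \<Rightarrow> ('a::ring_1 \<Rightarrow> 'k::field mat) \<Rightarrow> 'a set" where
  "rep_kernel n \<rho> = {r. \<rho> r = 0\<^sub>m n n}"

definition fcr_algebra :: "('k::field \<Rightarrow> 'a::ring_1 \<Rightarrow> 'a) \<Rightarrow> bool" where
  "fcr_algebra scale \<longleftrightarrow>
     k_algebra scale \<and>
     (\<forall>n \<rho>. representation scale n \<rho> \<longrightarrow> completely_reducible n \<rho>) \<and>
     \<Inter> {rep_kernel n \<rho> | n \<rho>. representation scale n \<rho>} = {0}"


section \<open>Right modules\<close>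

text \<open>Modules are records of type \<^typ>\<open>('a, 'm) module\<close>, of which only the additive structure
  and the action are relevant; the fields \<open>mult\<close> and \<open>one\<close> are junk.  The record writes the
  scalar first, so \<open>r \<odot>\<^bsub>M\<^esub> x\<close> stands for the right action \<open>x r\<close>; note the order of
  the factors in \<open>smult_assoc\<close>.\<close>

locale right_module = abelian_group M
  for M :: "('a::ring_1, 'm, 'z) module_scheme" (structure) +
  assumes smult_closed: "x \<in> carrier M \<Longrightarrow> r \<odot> x \<in> carrier M"
    and smult_add_scalar: "x \<in> carrier M \<Longrightarrow> (r + s) \<odot> x = r \<odot> x \<oplus> s \<odot> x"
    and smult_add_vec:
      "x \<in> carrier M \<Longrightarrow> y \<in> carrier M \<Longrightarrow> r \<odot> (x \<oplus> y) = r \<odot> x \<oplus> r \<odot> y"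
    and smult_assoc: "x \<in> carrier M \<Longrightarrow> s \<odot> (r \<odot> x) = (r * s) \<odot> x"
    and smult_one: "x \<in> carrier M \<Longrightarrow> 1 \<odot> x = x"

definition right_submodule :: "('a::ring_1, 'm, 'z) module_scheme \<Rightarrow> 'm set \<Rightarrow> bool" where
  "right_submodule M N \<longleftrightarrow>
     N \<subseteq> carrier M \<and> \<zero>\<^bsub>M\<^esub> \<in> N \<and>
     (\<forall>x\<in>N. \<forall>y\<in>N. x \<oplus>\<^bsub>M\<^esub> y \<in> N) \<and> (\<forall>r. \<forall>x\<in>N. r \<odot>\<^bsub>M\<^esub> x \<in> N)"

definition finitely_generated :: "('a::ring_1, 'm, 'z) module_scheme \<Rightarrow> bool" where
  "finitely_generated M \<longleftrightarrow>
     (\<exists>B. finite B \<and> B \<subseteq> carrier M \<and> right_submodule M hull B = carrier M)"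

definition countably_generated :: "('a::ring_1, 'm, 'z) module_scheme \<Rightarrow> bool" where
  "countably_generated M \<longleftrightarrow>
     (\<exists>B. countable B \<and> B \<subseteq> carrier M \<and> right_submodule M hull B = carrier M)"

definition module_hom ::
  "('a::ring_1, 'm, 'y) module_scheme \<Rightarrow> ('a, 'n, 'z) module_scheme \<Rightarrow> ('m \<Rightarrow> 'n) set" where
  "module_hom M N = {f. f \<in> carrier M \<rightarrow> carrier N \<and>
     (\<forall>x\<in>carrier M. \<forall>y\<in>carrier M. f (x \<oplus>\<^bsub>M\<^esub> y) = f x \<oplus>\<^bsub>N\<^esub> f y) \<and>
     (\<forall>r. \<forall>x\<in>carrier M. f (r \<odot>\<^bsub>M\<^esub> x) = r \<odot>\<^bsub>N\<^esub> f x)}"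

definition module_isomorphic ::
  "('a::ring_1, 'm, 'y) module_scheme \<Rightarrow> ('a, 'n, 'z) module_scheme \<Rightarrow> bool" where
  "module_isomorphic M N \<longleftrightarrow> (\<exists>f \<in> module_hom M N. bij_betw f (carrier M) (carrier N))"

definition regular_module :: "('a::ring_1, 'a) module" where
  "regular_module = \<lparr>carrier = UNIV, monoid.mult = undefined, one = undefined,
     zero = 0, add = (+), smult = (\<lambda>r x. x * r)\<rparr>"

definition free_module :: "'i set \<Rightarrow> ('a::ring_1, 'i \<Rightarrow> 'a) module" where
  "free_module X = \<lparr>carrier = {f. finite {i. f i \<noteq> 0} \<and> {i. f i \<noteq> 0} \<subseteq> X},
     monoid.mult = undefined, one = undefined,
     zero = (\<lambda>_. 0), add = (\<lambda>f g i. f i + g i), smult = (\<lambda>r f i. f i * r)\<rparr>"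

definition direct_summand :: "('a::ring_1, 'm, 'z) module_scheme \<Rightarrow> 'm set \<Rightarrow> bool" where
  "direct_summand M A \<longleftrightarrow> right_submodule M A \<and>
     (\<exists>B. right_submodule M B \<and> A \<inter> B = {\<zero>\<^bsub>M\<^esub>} \<and> A <+>\<^bsub>M\<^esub> B = carrier M)"

text \<open>Projective means isomorphic to a direct summand of a free module.  It is no restriction
  that the basis is indexed by elements of the type of \<open>P\<close>: a projective \<open>P\<close> is a direct
  summand of the free module on any generating set, e.g. on its own carrier.\<close>

definition projective_module :: "('a::ring_1, 'm, 'z) module_scheme \<Rightarrow> bool" where
  "projective_module P \<longleftrightarrow> right_module P \<and>
     (\<exists>(X :: 'm set) A. direct_summand (free_module X :: ('a, 'm \<Rightarrow> 'a) module) A \<and>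
        module_isomorphic P ((free_module X :: ('a, 'm \<Rightarrow> 'a) module)\<lparr>carrier := A\<rparr>))"

definition trace_ideal :: "('a::ring_1, 'm, 'z) module_scheme \<Rightarrow> 'a set" where
  "trace_ideal P = {\<Sum>i<n. f i (x i) | (n::nat) f x.
     \<forall>i<n. f i \<in> module_hom P regular_module \<and> x i \<in> carrier P}"

text \<open>The action on \<open>M / N\<close> sends a coset \<open>C\<close> and \<open>r\<close> to the coset \<open>N + C r\<close>.\<close>

definition quotient_module ::
  "('a::ring_1, 'm, 'z) module_scheme \<Rightarrow> 'm set \<Rightarrow> ('a, 'm set) module" where
  "quotient_module M N = \<lparr>carrier = a_rcosets\<^bsub>M\<^esub> N, monoid.mult = undefined, one = undefined,
     zero = N, add = set_add M, smult = (\<lambda>r C. N <+>\<^bsub>M\<^esub> ((\<lambda>x. r \<odot>\<^bsub>M\<^esub> x) ` C))\<rparr>"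

definition module_times_ideal :: "('a::ring_1, 'm, 'z) module_scheme \<Rightarrow> 'a set \<Rightarrow> 'm set" where
  "module_times_ideal M I = right_submodule M hull {r \<odot>\<^bsub>M\<^esub> x | r x. r \<in> I \<and> x \<in> carrier M}"

definition fg_quotient_ideals :: "('a::ring_1, 'm, 'z) module_scheme \<Rightarrow> 'a set set" where
  "fg_quotient_ideals M =
     {I. two_sided_ideal I \<and> finitely_generated (quotient_module M (module_times_ideal M I))}"

text \<open>Only meant for countably generated projective modules.\<close>

definition fair_sized :: "('a::ring_1, 'm, 'z) module_scheme \<Rightarrow> bool" where
  "fair_sized P \<longleftrightarrow>
     (\<exists>I\<in>fg_quotient_ideals P. \<forall>J\<in>fg_quotient_ideals P. J \<subseteq> I \<longrightarrow> J = I)"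

end

theory Submission
  imports Defs "Jordan_Normal_Form.Determinant" "HOL-Library.Nat_Bijection"
begin

text \<open>Since \<open>R / N\<^sup>2\<close> is finite dimensional and semisimple, every ideal \<open>N\<close> of finite codimension
  is idempotent, and for ideals \<open>K \<subseteq> N\<close> of finite codimension there is \<open>e \<in> N\<close> with
  \<open>N (1 - e) \<subseteq> K\<close>.  Residual finiteness yields a strictly decreasing chain \<open>I\<^sub>0 = N\<^sub>0 \<supset> N\<^sub>1 \<supset> \<dots>\<close>
  of such ideals; put \<open>M\<^sub>i = {r. N\<^sub>i r \<subseteq> N\<^sub>i\<^sub>+\<^sub>1}\<close>, a proper ideal of finite codimension.
  A direct limit of maps \<open>R\<^bsup>s m\<^esup> \<rightarrow> R\<^bsup>s (m + 1)\<^esup>\<close>, built from the elements \<open>e\<close> and from generators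
  of the \<open>N\<^sub>m\<close>, is projective because of the idempotence, satisfies \<open>P N\<^sub>0 = P\<close>, and \<open>P / P M\<^sub>i\<close>
  is free of rank \<open>s i\<close> over \<open>R / M\<^sub>i\<close>.  Here \<open>s\<close> can be any sequence growing fast enough, and it is
  an isomorphism invariant.  A minimal \<open>I\<close> with \<open>P / P I\<close> finitely generated would lie in every
  \<open>M\<^sub>i\<close>, since \<open>P / P (M\<^sub>i \<inter> I)\<close> is finitely generated too, and then \<open>s\<close> would be bounded.\<close>

section \<open>Ideals and coordinates modulo an ideal of finite codimension\<close>

text \<open>The element \<open>e n m\<close> acts as a right identity on \<open>N n\<close> modulo
  \<open>N m\<close>, and \<open>M i\<close> is the annihilator of the right module
  \<open>N i / N (i + 1)\<close>. Hence \<open>e n m\<close> is \<open>1\<close> modulo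
  \<open>M i\<close> for \<open>n \<le> i < m\<close>, whereas \<open>N n \<subseteq> M i\<close>
  for \<open>n > i\<close>. A coordinate whose entries come from \<open>N n\<close> is therefore
  invisible modulo \<open>M i\<close> for \<open>i < n\<close> and preserved for
  \<open>i \<ge> n\<close>, so that ranks can be prescribed by counting coordinates. The obstacle is
  projectivity, which asks that the transition \<open>A m\<close> be recovered from
  \<open>A (m + 1) \<circ> A m\<close>. An entry \<open>e\<close> is recovered only up to
  \<open>e - e * e\<close>, an element of \<open>N (m + 1)\<close>. To absorb this remainder, every
  old coordinate is also sent to new ones by generators of the left ideal \<open>N (m + 1)\<close>,
  and idempotence does the rest. This is the origin of the growth condition on \<open>s\<close>:
  with \<open>t\<close> generators at least \<open>s m * t\<close> new coordinates are required.
  Both chain conditions enter: the left one bounds the codimension of \<open>N N\<close> and the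
  number of new coordinates, the right one makes the ideal \<open>I\<close> finitely generated when
  it is intersected with \<open>M i\<close>.\<close>

lemma left_idealD:
  assumes "left_ideal I"
  shows "0 \<in> I" "x \<in> I \<Longrightarrow> y \<in> I \<Longrightarrow> x + y \<in> I" "x \<in> I \<Longrightarrow> r * x \<in> I"
    "x \<in> I \<Longrightarrow> - x \<in> I" "x \<in> I \<Longrightarrow> y \<in> I \<Longrightarrow> x - y \<in> I"
proof -
  show *: "0 \<in> I" "x \<in> I \<Longrightarrow> y \<in> I \<Longrightarrow> x + y \<in> I" "x \<in> I \<Longrightarrow> r * x \<in> I" for x y r
    using assms by (auto simp: left_ideal_def)
  show neg: "x \<in> I \<Longrightarrow> - x \<in> I" for x
    using *(3)[of x "- 1"] by simp
  show "x \<in> I \<Longrightarrow> y \<in> I \<Longrightarrow> x - y \<in> I"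
    using *(2)[of x "- y"] neg[of y] by simp
qed

lemma right_idealD:
  assumes "right_ideal I"
  shows "0 \<in> I" "x \<in> I \<Longrightarrow> y \<in> I \<Longrightarrow> x + y \<in> I" "x \<in> I \<Longrightarrow> x * r \<in> I"
    "x \<in> I \<Longrightarrow> - x \<in> I" "x \<in> I \<Longrightarrow> y \<in> I \<Longrightarrow> x - y \<in> I"
proof -
  show *: "0 \<in> I" "x \<in> I \<Longrightarrow> y \<in> I \<Longrightarrow> x + y \<in> I" "x \<in> I \<Longrightarrow> x * r \<in> I" for x y r
    using assms by (auto simp: right_ideal_def)
  show neg: "x \<in> I \<Longrightarrow> - x \<in> I" for x
    using *(3)[of x "- 1"] by simp
  show "x \<in> I \<Longrightarrow> y \<in> I \<Longrightarrow> x - y \<in> I"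
    using *(2)[of x "- y"] neg[of y] by simp
qed

lemma left_ideal_sum:
  assumes "left_ideal I" "\<And>i. i \<in> A \<Longrightarrow> f i \<in> I"
  shows "sum f A \<in> I"
  using assms(2) by (induction A rule: infinite_finite_induct) (auto intro: left_idealD[OF assms(1)])

lemma two_sided_idealD:
  assumes "two_sided_ideal I"
  shows "left_ideal I" "right_ideal I"
  using assms by (auto simp: two_sided_ideal_def)

lemma left_ideal_Inter: "(\<And>I. I \<in> T \<Longrightarrow> left_ideal I) \<Longrightarrow> left_ideal (\<Inter>T)"
  by (auto simp: left_ideal_def)

lemma right_ideal_Inter: "(\<And>I. I \<in> T \<Longrightarrow> right_ideal I) \<Longrightarrow> right_ideal (\<Inter>T)"
  by (auto simp: right_ideal_def)

lemma left_ideal_Int: "left_ideal I \<Longrightarrow> left_ideal J \<Longrightarrow> left_ideal (I \<inter> J)"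
  by (auto simp: left_ideal_def)

lemma right_ideal_Int: "right_ideal I \<Longrightarrow> right_ideal J \<Longrightarrow> right_ideal (I \<inter> J)"
  by (auto simp: right_ideal_def)

lemma left_ideal_plus:
  assumes I: "left_ideal I" and J: "left_ideal J"
  shows "left_ideal {x + y | x y. x \<in> I \<and> y \<in> J}"
  unfolding left_ideal_def
proof (intro conjI ballI allI)
  show "0 \<in> {x + y |x y. x \<in> I \<and> y \<in> J}"
    using left_idealD(1)[OF I] left_idealD(1)[OF J] by force
next
  fix u v assume "u \<in> {x + y |x y. x \<in> I \<and> y \<in> J}" "v \<in> {x + y |x y. x \<in> I \<and> y \<in> J}"
  then obtain x y x' y' where "u = x + y" "v = x' + y'" and *: "x \<in> I" "y \<in> J" "x' \<in> I" "y' \<in> J"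
    by blast
  then have "u + v = (x + x') + (y + y')" by simp
  with * show "u + v \<in> {x + y |x y. x \<in> I \<and> y \<in> J}"
    using left_idealD(2)[OF I, of x x'] left_idealD(2)[OF J, of y y'] by blast
next
  fix u r assume "u \<in> {x + y |x y. x \<in> I \<and> y \<in> J}"
  then obtain x y where "u = x + y" and *: "x \<in> I" "y \<in> J"
    by blast
  then have "r * u = r * x + r * y" by (simp add: distrib_left)
  with * show "r * u \<in> {x + y |x y. x \<in> I \<and> y \<in> J}"
    using left_idealD(3)[OF I, of x r] left_idealD(3)[OF J, of y r] by blast
qed

text \<open>If no finite subset generated \<open>I\<close>, adjoining an element outside the current
  hull again and again would give a chain of hulls that never stabilises. The predicate
  \<open>Q\<close> stands for left or right ideals.\<close>

lemma acc_finitely_generated: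
  fixes Q :: "'a set \<Rightarrow> bool"
  assumes acc: "\<And>C :: nat \<Rightarrow> 'a set. (\<And>n. Q (C n) \<and> C n \<subseteq> C (Suc n)) \<Longrightarrow> \<exists>N. \<forall>n\<ge>N. C n = C N"
    and Inter: "\<And>T. (\<And>I. I \<in> T \<Longrightarrow> Q I) \<Longrightarrow> Q (\<Inter>T)"
    and I: "Q I"
  shows "\<exists>A. finite A \<and> A \<subseteq> I \<and> Q hull A = I"
proof (rule ccontr)
  assume neg: "\<not> ?thesis"
  have "\<exists>x. x \<in> I - Q hull A" if "finite A" "A \<subseteq> I" for A
  proof -
    have "Q hull A \<noteq> I" using neg that by simp
    moreover have "Q hull A \<subseteq> I" using hull_minimal[of A I Q] that(2) I by simp
    ultimately show ?thesis by auto
  qed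
  then have "\<forall>A. \<exists>x. finite A \<longrightarrow> A \<subseteq> I \<longrightarrow> x \<in> I - Q hull A"
    by simp
  from choice[OF this] obtain pick
    where pick: "\<And>A. finite A \<Longrightarrow> A \<subseteq> I \<Longrightarrow> pick A \<in> I - Q hull A"
    by auto
  define A where "A = rec_nat {} (\<lambda>_ A. insert (pick A) A)"
  have A_Suc: "A (Suc n) = insert (pick (A n)) (A n)" for n
    by (simp add: A_def)
  have A: "finite (A n) \<and> A n \<subseteq> I" for n
  proof (induction n)
    case 0 show ?case by (simp add: A_def)
  next
    case (Suc n) then show ?case using pick[of "A n"] by (simp add: A_Suc)
  qed
  have "\<exists>N. \<forall>n\<ge>N. Q hull A n = Q hull A N"
  proof (rule acc)
    fix n
    have "Q hull A n \<subseteq> Q hull A (Suc n)"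
      by (rule hull_mono) (auto simp: A_Suc)
    moreover have "Q (Q hull A n)"
      by (rule hull_in, rule Inter, simp)
    ultimately show "Q (Q hull A n) \<and> Q hull A n \<subseteq> Q hull A (Suc n)" by simp
  qed
  then obtain N where N: "\<forall>n\<ge>N. Q hull A n = Q hull A N" ..
  have "Q hull A (Suc N) = Q hull A N" by (rule N[rule_format]) simp
  then have "pick (A N) \<in> Q hull A N"
    using hull_inc[of "pick (A N)" "A (Suc N)" Q] by (simp add: A_Suc)
  with pick[of "A N"] A[of N] show False by simp
qed

lemma noetherian_finitely_generated:
  assumes "noetherian_ring_type TYPE('a::ring_1)"
  shows "left_ideal (I :: 'a set) \<Longrightarrow> \<exists>A. finite A \<and> A \<subseteq> I \<and> left_ideal hull A = I"
    and "right_ideal (I :: 'a set) \<Longrightarrow> \<exists>A. finite A \<and> A \<subseteq> I \<and> right_ideal hull A = I"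
proof -
  have acc: "(\<forall>C :: nat \<Rightarrow> 'a set.
        (\<forall>n. left_ideal (C n) \<and> C n \<subseteq> C (Suc n)) \<longrightarrow> (\<exists>N. \<forall>n\<ge>N. C n = C N))"
    "(\<forall>C :: nat \<Rightarrow> 'a set.
        (\<forall>n. right_ideal (C n) \<and> C n \<subseteq> C (Suc n)) \<longrightarrow> (\<exists>N. \<forall>n\<ge>N. C n = C N))"
    using assms unfolding noetherian_ring_type_def by auto
  show "left_ideal I \<Longrightarrow> \<exists>A. finite A \<and> A \<subseteq> I \<and> left_ideal hull A = I"
    by (rule acc_finitely_generated[where Q = left_ideal, OF acc(1)[rule_format] left_ideal_Inter])
  show "right_ideal I \<Longrightarrow> \<exists>A. finite A \<and> A \<subseteq> I \<and> right_ideal hull A = I"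
    by (rule acc_finitely_generated[where Q = right_ideal, OF acc(2)[rule_format] right_ideal_Inter])
qed

section \<open>Coordinates on a quotient of finite dimension, without a quotient type\<close>

context vector_space
begin

text \<open>A basis \<open>BK\<close> of \<open>K\<close> is extended to a basis \<open>D\<close> of
  the whole space using vectors of \<open>B\<close> only, so \<open>D - BK\<close> is finite. Its
  members are the \<open>b i\<close>, and the \<open>c i\<close> are the corresponding coordinate
  functionals.\<close>

lemma finite_codim_coordinates:
  assumes K: "subspace K" and B: "finite B" "span (K \<union> B) = UNIV"
  shows "\<exists>n (b :: nat \<Rightarrow> 'b) (c :: nat \<Rightarrow> 'b \<Rightarrow> 'a).
    (\<forall>i x y. c i (x + y) = c i x + c i y) \<and> (\<forall>i a x. c i (scale a x) = a * c i x) \<and>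
    (\<forall>i<n. \<forall>j<n. c i (b j) = (if i = j then 1 else 0)) \<and>
    (\<forall>x. (\<forall>i<n. c i x = 0) \<longleftrightarrow> x \<in> K)"
proof -
  obtain BK where BK: "BK \<subseteq> K" "independent BK" "K \<subseteq> span BK"
    using maximal_independent_subset by blast
  have spanBK: "span BK = K"
    using BK K by (metis span_minimal subset_antisym)
  obtain D where D: "BK \<subseteq> D" "D \<subseteq> BK \<union> B" "independent D" "BK \<union> B \<subseteq> span D"
    using maximal_independent_subset_extend[OF _ BK(2), of "BK \<union> B"] by (metis Un_upper1)
  have "K \<union> B \<subseteq> span D"
    using D(4) span_mono[OF D(1)] unfolding spanBK by simp
  then have spanD: "span D = UNIV"
    using B(2) span_minimal[OF _ subspace_span, of "K \<union> B" D] by (simp add: top.extremum_unique)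
  have "finite (D - BK)"
    by (rule finite_subset[OF _ B(1)]) (use D(2) in auto)
  from finite_imp_nat_seg_image_inj_on[OF this]
  obtain b :: "nat \<Rightarrow> 'b" and n where b: "D - BK = b ` {i. i < n}" "inj_on b {i. i < n}"
    by (elim exE conjE)
  have bD: "b i \<in> D" "b i \<notin> BK" if "i < n" for i
  proof -
    have "b i \<in> b ` {i. i < n}" using that by simp
    then show "b i \<in> D" "b i \<notin> BK" unfolding b(1)[symmetric] by simp_all
  qed
  define c where "c i x = representation D x (b i)" for i x
  have inspan: "x \<in> span D" for x by (simp add: spanD)
  show ?thesis
  proof (intro exI conjI allI impI)
    show "c i (x + y) = c i x + c i y" for i x y
      by (simp add: c_def representation_add[OF D(3) inspan inspan])
    show "c i (scale a x) = a * c i x" for i a x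
      by (simp add: c_def representation_scale[OF D(3) inspan])
    show "c i (b j) = (if i = j then 1 else 0)" if "i < n" "j < n" for i j
    proof -
      have "b j \<in> D" using bD that by simp
      moreover have "b i = b j \<longleftrightarrow> i = j" using inj_on_eq_iff[OF b(2), of i j] that by simp
      ultimately show ?thesis unfolding c_def by (auto simp: representation_basis[OF D(3)])
    qed
    show "(\<forall>i<n. c i x = 0) \<longleftrightarrow> x \<in> K" for x
    proof
      assume 0: "\<forall>i<n. c i x = 0"
      have "representation D x v = 0" if "v \<in> D - BK" for v
      proof -
        have "v \<in> b ` {i. i < n}" unfolding b(1)[symmetric] by (rule that)
        then obtain i where "i < n" "v = b i" by auto
        then show ?thesis using 0 by (simp add: c_def)
      qed
      then have "{v. representation D x v \<noteq> 0} \<subseteq> BK"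
        using representation_ne_zero[of D x] by auto
      then have "(\<Sum>v | representation D x v \<noteq> 0. scale (representation D x v) v) \<in> span BK"
        by (intro span_sum span_scale span_base) auto
      then show "x \<in> K"
        by (simp add: sum_nonzero_representation_eq[OF D(3) inspan] spanBK)
    next
      assume "x \<in> K"
      then have "representation D x = representation BK x"
        using representation_extend[OF D(3) _ D(1)] spanBK by simp
      then show "\<forall>i<n. c i x = 0"
        using representation_ne_zero[of BK x] bD(2) unfolding c_def by metis
    qed
  qed
qed

end

lemma mat_eq_on_vecI:
  fixes A B :: "'k::field mat"
  assumes A: "A \<in> carrier_mat n m" and B: "B \<in> carrier_mat n m"
    and eq: "\<And>v. v \<in> carrier_vec m \<Longrightarrow> A *\<^sub>v v = B *\<^sub>v v"
  shows "A = B"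
proof (rule eq_matI)
  fix i j assume ij: "i < dim_row B" "j < dim_col B"
  have "(A *\<^sub>v unit_vec m j) $ i = (B *\<^sub>v unit_vec m j) $ i"
    using eq[of "unit_vec m j"] by simp
  then show "A $$ (i, j) = B $$ (i, j)"
    using ij A B by simp
qed (use A B in auto)

lemma (in k_algebra) scale_conv_mult: "scale c x = scale c 1 * x"
  using scale_mult_left[of c 1 x] by simp

lemma (in k_algebra) left_ideal_subspace: "left_ideal I \<Longrightarrow> subspace I"
  unfolding subspace_def left_ideal_def by (metis scale_conv_mult)

text \<open>Here \<open>\<phi>\<close> is the projection onto \<open>R / K\<close> in coordinates
  and \<open>\<rho>\<close> is left multiplication. Keeping \<open>\<phi>\<close> in the statement
  allows vectors to be lifted back to ring elements.\<close>

lemma (in k_algebra) quotient_representation: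
  assumes K: "two_sided_ideal K" and fc: "finite_codim scale K"
  shows "\<exists>n \<phi> \<rho>. Defs.representation scale n \<rho> \<and> (\<forall>x. \<phi> x \<in> carrier_vec n) \<and>
    (\<forall>x y. \<phi> (x + y) = \<phi> x + \<phi> y) \<and> (\<forall>c x. \<phi> (scale c x) = c \<cdot>\<^sub>v \<phi> x) \<and>
    (\<forall>r x. \<phi> (r * x) = \<rho> r *\<^sub>v \<phi> x) \<and> (\<forall>v\<in>carrier_vec n. \<exists>x. \<phi> x = v) \<and>
    (\<forall>x. \<phi> x = 0\<^sub>v n \<longleftrightarrow> x \<in> K)"
proof -
  obtain B where B: "finite B" "span (K \<union> B) = UNIV"
    using fc by (auto simp: finite_codim_def)
  from finite_codim_coordinates[OF left_ideal_subspace[OF two_sided_idealD(1)[OF K]] B]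
  obtain n :: nat and b :: "nat \<Rightarrow> 'a" and c :: "nat \<Rightarrow> 'a \<Rightarrow> 'k" where nbc:
    "(\<forall>i x y. c i (x + y) = c i x + c i y) \<and> (\<forall>i a x. c i (scale a x) = a * c i x) \<and>
    (\<forall>i<n. \<forall>j<n. c i (b j) = (if i = j then 1 else 0)) \<and>
    (\<forall>x. (\<forall>i<n. c i x = 0) \<longleftrightarrow> x \<in> K)"
    by (elim exE)
  then have c: "\<And>i x y. c i (x + y) = c i x + c i y"
    "\<And>i a x. c i (scale a x) = a * c i x"
    "\<And>i j. i < n \<Longrightarrow> j < n \<Longrightarrow> c i (b j) = (if i = j then 1 else 0)"
    "\<And>x. (\<forall>i<n. c i x = 0) \<longleftrightarrow> x \<in> K"
    by blast+
  have c0: "c i 0 = 0" for i using c(2)[of i 0 0] by simp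
  have csum: "c i (sum f A) = (\<Sum>j\<in>A. c i (f j))" for i A and f :: "nat \<Rightarrow> 'a"
    by (induction A rule: infinite_finite_induct) (auto simp: c c0)
  have cdiff: "c i (x - y) = c i x - c i y" for i x y
    using c(1)[of i "x - y" y] by simp
  define \<phi> where "\<phi> x = vec n (\<lambda>i. c i x)" for x
  define \<rho> where "\<rho> r = mat n n (\<lambda>(i, j). c i (r * b j))" for r
  have ker: "\<phi> x = 0\<^sub>v n \<longleftrightarrow> x \<in> K" for x
    unfolding c(4)[of x, symmetric] by (auto simp: \<phi>_def vec_eq_iff)
  have carr: "\<phi> x \<in> carrier_vec n" for x by (simp add: \<phi>_def)
  have \<rho>carr: "\<rho> r \<in> carrier_mat n n" for r by (simp add: \<rho>_def)
  have add: "\<phi> (x + y) = \<phi> x + \<phi> y" for x y by (auto simp: \<phi>_def vec_eq_iff c)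
  have scl: "\<phi> (scale a x) = a \<cdot>\<^sub>v \<phi> x" for a x by (auto simp: \<phi>_def vec_eq_iff c)
  have act: "\<phi> (r * x) = \<rho> r *\<^sub>v \<phi> x" for r x
  proof (rule eq_vecI)
    fix i assume "i < dim_vec (\<rho> r *\<^sub>v \<phi> x)"
    then have i: "i < n" by (simp add: \<rho>_def)
    \<comment> \<open>All coordinates of \<open>y\<close> vanish, so \<open>y\<close> lies in
      \<open>K\<close>; since \<open>K\<close> is a left ideal, \<open>r * y\<close> does not
      contribute either.\<close>
    define y where "y = x - (\<Sum>j<n. scale (c j x) (b j))"
    have "c k y = 0" if "k < n" for k
      using that by (simp add: y_def cdiff csum c(2,3) if_distrib[of "\<lambda>z. _ * z"] cong: if_cong)
    then have "y \<in> K" using c(4) by blast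
    then have "r * y \<in> K" using left_idealD[OF two_sided_idealD(1)[OF K]] by blast
    then have 0: "c i (r * y) = 0" using c(4) i by blast
    have "r * x = r * y + (\<Sum>j<n. scale (c j x) (r * b j))"
      by (simp add: y_def right_diff_distrib sum_distrib_left scale_mult_right)
    then have "c i (r * x) = (\<Sum>j<n. c i (r * b j) * c j x)"
      by (simp add: c 0 csum mult.commute)
    also have "\<dots> = (\<rho> r *\<^sub>v \<phi> x) $ i"
      using i by (simp add: \<rho>_def \<phi>_def scalar_prod_def lessThan_atLeast0)
    finally show "\<phi> (r * x) $ i = (\<rho> r *\<^sub>v \<phi> x) $ i" using i by (simp add: \<phi>_def)
  qed (simp add: \<phi>_def \<rho>_def)
  have surj: "\<exists>x. \<phi> x = v" if v: "v \<in> carrier_vec n" for v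
  proof
    show "\<phi> (\<Sum>j<n. scale (v $ j) (b j)) = v"
      using v by (auto simp: \<phi>_def vec_eq_iff csum c(2,3) if_distrib[of "\<lambda>z. _ * z"] cong: if_cong)
  qed
  have rep: "Defs.representation scale n \<rho>"
    unfolding Defs.representation_def
  proof (intro conjI allI)
    show "\<rho> r \<in> carrier_mat n n" for r by fact
    show "\<rho> 1 = 1\<^sub>m n"
      by (rule eq_matI) (auto simp: \<rho>_def c)
    show "\<rho> (r + s) = \<rho> r + \<rho> s" for r s
      by (rule eq_matI) (auto simp: \<rho>_def c distrib_right)
    show "\<rho> (scale a r) = a \<cdot>\<^sub>m \<rho> r" for a r
      by (rule eq_matI) (auto simp: \<rho>_def c scale_mult_left[symmetric])
    \<comment> \<open>Every vector is some \<open>\<phi> x\<close>, so multiplicativity reduces to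
      associativity in the ring.\<close>
    show "\<rho> (r * s) = \<rho> r * \<rho> s" for r s
    proof (rule mat_eq_on_vecI[where n = n and m = n])
      fix v :: "'k vec" assume "v \<in> carrier_vec n"
      then obtain x where v: "v = \<phi> x" using surj by blast
      have "\<rho> (r * s) *\<^sub>v v = \<rho> r *\<^sub>v (\<rho> s *\<^sub>v v)"
        unfolding v act[symmetric] by (simp add: mult.assoc)
      also have "\<dots> = (\<rho> r * \<rho> s) *\<^sub>v v"
        using assoc_mult_mat_vec[OF \<rho>carr \<rho>carr carr] v by simp
      finally show "\<rho> (r * s) *\<^sub>v v = (\<rho> r * \<rho> s) *\<^sub>v v" .
    qed (use \<rho>carr mult_carrier_mat in blast)+
  qed
  show ?thesis
    by (rule exI[of _ n], rule exI[of _ \<phi>], rule exI[of _ \<rho>], intro conjI allI ballI)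
      (rule rep carr add scl act surj ker | assumption)+
qed

section \<open>Complements in finite dimensional quotients\<close>

definition simple_over :: "'a::ring_1 set \<Rightarrow> 'a set \<Rightarrow> bool" where
  "simple_over K V \<longleftrightarrow> left_ideal V \<and> K \<subseteq> V \<and>
     (\<forall>X. left_ideal X \<longrightarrow> K \<subseteq> X \<longrightarrow> X \<subseteq> V \<longrightarrow> X = K \<or> X = V)"

text \<open>Subrepresentations of \<open>R / K\<close> correspond under \<open>\<phi>\<close> to
  left ideals containing \<open>K\<close>, so the irreducible summands pull back to the
  \<open>V j\<close>. A decomposition of \<open>\<phi> r\<close> lifts to \<open>r\<close> up to an
  element of \<open>K\<close>.\<close>

lemma fcr_quotient_semisimple:
  fixes scale :: "'k::field \<Rightarrow> 'a::ring_1 \<Rightarrow> 'a"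
  assumes fcr: "fcr_algebra scale" and K: "two_sided_ideal K" "finite_codim scale K"
  shows "\<exists>(m::nat) V. (\<forall>j<m. simple_over K (V j)) \<and>
    (\<forall>r. \<exists>v. (\<forall>j<m. v j \<in> V j) \<and> r - (\<Sum>j<m. v j) \<in> K)"
proof -
  have "k_algebra scale" using fcr by (simp add: fcr_algebra_def)
  then interpret k_algebra scale .
  from quotient_representation[OF K]
  obtain n :: nat and \<phi> :: "'a \<Rightarrow> 'k vec" and \<rho> :: "'a \<Rightarrow> 'k mat" where
    *: "Defs.representation scale n \<rho> \<and> (\<forall>x. \<phi> x \<in> carrier_vec n) \<and>
    (\<forall>x y. \<phi> (x + y) = \<phi> x + \<phi> y) \<and> (\<forall>c x. \<phi> (scale c x) = c \<cdot>\<^sub>v \<phi> x) \<and>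
    (\<forall>r x. \<phi> (r * x) = \<rho> r *\<^sub>v \<phi> x) \<and> (\<forall>v\<in>carrier_vec n. \<exists>x. \<phi> x = v) \<and>
    (\<forall>x. \<phi> x = 0\<^sub>v n \<longleftrightarrow> x \<in> K)"
    by (elim exE)
  then have rep: "Defs.representation scale n \<rho>" and carr: "\<And>x. \<phi> x \<in> carrier_vec n"
    and add: "\<And>x y. \<phi> (x + y) = \<phi> x + \<phi> y" and scl: "\<And>c x. \<phi> (scale c x) = c \<cdot>\<^sub>v \<phi> x"
    and act: "\<And>r x. \<phi> (r * x) = \<rho> r *\<^sub>v \<phi> x"
    and surj: "\<And>v. v \<in> carrier_vec n \<Longrightarrow> \<exists>x. \<phi> x = v"
    and ker: "\<And>x. \<phi> x = 0\<^sub>v n \<longleftrightarrow> x \<in> K"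
    by blast+
  note Kl = left_idealD[OF two_sided_idealD(1)[OF K(1)]]
  have zero: "\<phi> 0 = 0\<^sub>v n" using ker Kl(1) by blast
  have dim: "dim_vec (\<phi> x) = n" for x using carr by (rule carrier_vecD)
  have eq_imp: "x - y \<in> K" if "\<phi> x = \<phi> y" for x y
  proof -
    have "\<phi> (x - y) = \<phi> x + \<rho> (- 1) *\<^sub>v \<phi> y"
      unfolding act[symmetric] add[symmetric] by simp
    also have "\<dots> = \<phi> (x - x)"
      unfolding that[symmetric] act[symmetric] add[symmetric] by simp
    finally show ?thesis using zero ker by simp
  qed
  have "completely_reducible n \<rho>"
    using fcr rep unfolding fcr_algebra_def by simp
  then obtain m :: nat and W where W: "\<forall>j<m. irreducible_subrepresentation n \<rho> (W j)"
    and Wsum: "\<forall>v\<in>carrier_vec n. \<exists>!w. w \<in> (\<Pi>\<^sub>E j\<in>{..<m}. W j) \<and>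
           v = finsum_vec TYPE('k) n w {..<m}"
    unfolding completely_reducible_def by blast
  define V where "V j = {x. \<phi> x \<in> W j}" for j
  have simple: "simple_over K (V j)" if j: "j < m" for j
    unfolding simple_over_def
  proof (intro conjI allI impI)
    have irr: "irreducible_subrepresentation n \<rho> (W j)" using W j by blast
    then have sub: "subrepresentation n \<rho> (W j)"
      by (simp add: irreducible_subrepresentation_def)
    show "left_ideal (V j)"
      using sub zero unfolding subrepresentation_def left_ideal_def V_def by (simp add: act add)
    show KV: "K \<subseteq> V j"
    proof
      fix x assume "x \<in> K"
      then have "\<phi> x = 0\<^sub>v n" using ker by simp
      then show "x \<in> V j" using sub by (simp add: subrepresentation_def V_def)
    qed
    fix X assume X: "left_ideal X" "K \<subseteq> X" "X \<subseteq> V j"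
    note Xl = left_idealD[OF X(1)]
    have "subrepresentation n \<rho> (\<phi> ` X)"
      unfolding subrepresentation_def
    proof (intro conjI ballI allI)
      show "\<phi> ` X \<subseteq> carrier_vec n" using carr by auto
      show "0\<^sub>v n \<in> \<phi> ` X" using zero Xl(1) by force
      show "v + w \<in> \<phi> ` X" if "v \<in> \<phi> ` X" "w \<in> \<phi> ` X" for v w
        using that Xl(2) by (auto simp: add[symmetric])
      show "c \<cdot>\<^sub>v w \<in> \<phi> ` X" if "w \<in> \<phi> ` X" for c w
      proof -
        obtain x where "w = \<phi> x" "x \<in> X" using \<open>w \<in> \<phi> ` X\<close> by blast
        moreover have "scale c x \<in> X"
          unfolding scale_conv_mult[of c x] using \<open>x \<in> X\<close> by (rule Xl(3))
        ultimately show ?thesis by (auto simp: scl[symmetric])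
      qed
      show "\<rho> r *\<^sub>v w \<in> \<phi> ` X" if "w \<in> \<phi> ` X" for r w
        using that Xl(3) by (auto simp: act[symmetric])
    qed
    moreover have "\<phi> ` X \<subseteq> W j" using X(3) by (auto simp: V_def)
    ultimately consider "\<phi> ` X = {0\<^sub>v n}" | "\<phi> ` X = W j"
      using irr unfolding irreducible_subrepresentation_def by blast
    then show "X = K \<or> X = V j"
    proof cases
      case 1
      then have "X \<subseteq> K" using ker by blast
      with X(2) show ?thesis by blast
    next
      case 2
      have "x \<in> X" if "x \<in> V j" for x
      proof -
        have "\<phi> x \<in> \<phi> ` X" using that 2 by (simp add: V_def)
        then obtain y where "y \<in> X" "\<phi> x = \<phi> y" by blast
        then show ?thesis using eq_imp[of x y] X(2) Xl(2)[of "x - y" y] by auto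
      qed
      with X(3) show ?thesis by blast
    qed
  qed
  have "\<exists>v. (\<forall>j<m. v j \<in> V j) \<and> r - (\<Sum>j<m. v j) \<in> K" for r
  proof -
    obtain w where w: "w \<in> (\<Pi>\<^sub>E j\<in>{..<m}. W j)" "\<phi> r = finsum_vec TYPE('k) n w {..<m}"
      using Wsum carr[of r] by blast
    have Wc: "w j \<in> W j" "w j \<in> carrier_vec n" if "j < m" for j
    proof -
      show *: "w j \<in> W j" using PiE_mem[OF w(1)] that by simp
      have "W j \<subseteq> carrier_vec n"
        using W that by (simp add: irreducible_subrepresentation_def subrepresentation_def)
      with * show "w j \<in> carrier_vec n" by blast
    qed
    then have "\<forall>j. \<exists>x. j < m \<longrightarrow> \<phi> x = w j" using surj by blast
    from choice[OF this] obtain v where v: "\<And>j. j < m \<Longrightarrow> \<phi> (v j) = w j" by blast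
    have "\<phi> (\<Sum>j\<in>J. v j) $ i = (\<Sum>j\<in>J. \<phi> (v j) $ i)" if "finite J" "i < n" for J i
      using that
    proof (induction J)
      case empty
      then show ?case by (simp add: zero)
    next
      case (insert j J)
      then show ?case by (simp add: add dim)
    qed
    then have "\<phi> (\<Sum>j<m. v j) $ i = \<phi> r $ i" if "i < n" for i
      using that v Wc unfolding w(2) by (subst index_finsum_vec) auto
    then have "\<phi> r = \<phi> (\<Sum>j<m. v j)"
      by (intro eq_vecI) (simp_all add: dim)
    then show ?thesis using eq_imp v Wc by (intro exI[of _ v]) (auto simp: V_def)
  qed
  with simple show ?thesis by blast
qed

text \<open>The complement is built greedily. Each \<open>V i\<close> either lies in
  \<open>N + L\<close> already or meets it only in \<open>K\<close>, and in the second case it is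
  added to \<open>L\<close>. The equation \<open>N \<inter> L = K\<close> survives: if
  \<open>x + y \<in> N\<close> with \<open>x \<in> L\<close> and \<open>y \<in> V i\<close>, then
  \<open>y\<close> lies in both \<open>N + L\<close> and \<open>V i\<close>, hence in
  \<open>K\<close>.\<close>

lemma fcr_complement:
  fixes scale :: "'k::field \<Rightarrow> 'a::ring_1 \<Rightarrow> 'a"
  assumes fcr: "fcr_algebra scale" and K: "two_sided_ideal K" "finite_codim scale K"
    and N: "left_ideal N" "K \<subseteq> N"
  shows "\<exists>L. left_ideal L \<and> N \<inter> L = K \<and> (\<forall>r. \<exists>x\<in>N. \<exists>y\<in>L. r = x + y)"
proof -
  obtain m :: nat and V where V: "\<forall>j<m. simple_over K (V j)"
    and sumV: "\<forall>r. \<exists>v. (\<forall>j<m. v j \<in> V j) \<and> r - (\<Sum>j<m. v j) \<in> K"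
    using fcr_quotient_semisimple[OF fcr K] by blast
  define S where "S L = {x + y | x y. x \<in> N \<and> y \<in> L}" for L
  have "\<exists>L. left_ideal L \<and> N \<inter> L = K \<and> (\<forall>j<i. V j \<subseteq> S L)" if "i \<le> m" for i
    using that
  proof (induction i)
    case 0
    show ?case using two_sided_idealD(1)[OF K(1)] N(2) by (intro exI[of _ K]) auto
  next
    case (Suc i)
    then obtain L where L: "left_ideal L" "N \<inter> L = K" "\<forall>j<i. V j \<subseteq> S L" by auto
    have Vi: "simple_over K (V i)" using V Suc.prems by simp
    then have Vl: "left_ideal (V i)" by (simp add: simple_over_def)
    have SL: "left_ideal (S L)" unfolding S_def by (rule left_ideal_plus[OF N(1) L(1)])
    have NS: "N \<subseteq> S L" unfolding S_def using left_idealD(1)[OF L(1)] by force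
    consider "S L \<inter> V i = V i" | "S L \<inter> V i = K"
      using Vi left_ideal_Int[OF SL Vl] NS N(2) unfolding simple_over_def by blast
    then show ?case
    proof cases
      case 1
      then have "\<forall>j<Suc i. V j \<subseteq> S L" using L(3) by (auto simp: less_Suc_eq)
      then show ?thesis using L by blast
    next
      case 2
      define L' where "L' = {x + y | x y. x \<in> L \<and> y \<in> V i}"
      have L': "left_ideal L'" unfolding L'_def by (rule left_ideal_plus[OF L(1) Vl])
      have LL': "L \<subseteq> L'" "V i \<subseteq> L'"
        unfolding L'_def using left_idealD(1)[OF Vl] left_idealD(1)[OF L(1)] by force+
      have "N \<inter> L' = K"
      proof
        show "K \<subseteq> N \<inter> L'" using L(2) LL' by blast
        show "N \<inter> L' \<subseteq> K"
        proof
          fix z assume z: "z \<in> N \<inter> L'"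
          then obtain x y where xy: "z = x + y" "x \<in> L" "y \<in> V i" unfolding L'_def by blast
          then have "y = z + - x" by simp
          then have "y \<in> S L"
            unfolding S_def using z left_idealD(4)[OF L(1) xy(2)] by blast
          then have "y \<in> L" using 2 xy(3) L(2) by blast
          then have "z \<in> L" using xy left_idealD(2)[OF L(1)] by simp
          then show "z \<in> K" using z L(2) by blast
        qed
      qed
      moreover have "S L \<subseteq> S L'" unfolding S_def using LL' by blast
      moreover have "L' \<subseteq> S L'" unfolding S_def using left_idealD(1)[OF N(1)] by force
      ultimately show ?thesis
        using L' L(3) LL' by (intro exI[of _ L']) (auto simp: less_Suc_eq)
    qed
  qed
  then obtain L where L: "left_ideal L" "N \<inter> L = K" "\<forall>j<m. V j \<subseteq> S L" by blast
  have SL: "left_ideal (S L)" unfolding S_def by (rule left_ideal_plus[OF N(1) L(1)])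
  have "r \<in> S L" for r
  proof -
    obtain v where v: "\<forall>j<m. v j \<in> V j" "r - (\<Sum>j<m. v j) \<in> K" using sumV by blast
    have "(\<Sum>j<m. v j) \<in> S L" using v(1) L(3) by (intro left_ideal_sum[OF SL]) auto
    moreover have "K \<subseteq> S L" unfolding S_def using N(2) left_idealD(1)[OF L(1)] by force
    ultimately show ?thesis
      using left_idealD(2)[OF SL, of "r - (\<Sum>j<m. v j)" "\<Sum>j<m. v j"] v(2) by auto
  qed
  then show ?thesis using L unfolding S_def by blast
qed

section \<open>Ideals of finite codimension are idempotent\<close>

locale noetherian_fcr = k_algebra scale
  for scale :: "'k::field \<Rightarrow> 'a::ring_1 \<Rightarrow> 'a" +
  assumes fcr: "fcr_algebra scale"
    and noetherian: "noetherian_ring_type TYPE('a)"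
begin

definition cofinite_ideal :: "'a set \<Rightarrow> bool" where
  "cofinite_ideal I \<longleftrightarrow> two_sided_ideal I \<and> finite_codim scale I"

lemma cofinite_idealD:
  assumes "cofinite_ideal I"
  shows "two_sided_ideal I" "finite_codim scale I" "left_ideal I" "right_ideal I" "subspace I"
  using assms two_sided_idealD left_ideal_subspace by (auto simp: cofinite_ideal_def)

lemma finite_codim_mono: "finite_codim scale I \<Longrightarrow> I \<subseteq> J \<Longrightarrow> finite_codim scale J"
  unfolding finite_codim_def by (metis Un_mono span_mono subset_refl top.extremum_unique)

lemma left_ideal_hull: "left_ideal (left_ideal hull A)"
  by (rule hull_in) (auto intro: left_ideal_Inter)

text \<open>By left noetherianity \<open>N\<close> is a finite sum of the \<open>R a\<close> with
  \<open>a \<in> A\<close>, and \<open>R = N + span B\<close> with \<open>B\<close> finite. Hence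
  \<open>N \<subseteq> N N + span (B A)\<close>: the finitely many \<open>b * a\<close> span the gap
  from \<open>N N\<close> to \<open>N\<close>, and \<open>B\<close> spans the gap from
  \<open>N\<close> to \<open>R\<close>.\<close>

lemma product_ideal_cofinite:
  assumes N: "cofinite_ideal N"
  shows "cofinite_ideal (left_ideal hull {x * y | x y. x \<in> N \<and> y \<in> N})"
    (is "cofinite_ideal ?H")
proof -
  note Nl = left_idealD[OF cofinite_idealD(3)[OF N]]
  note Nr = right_idealD[OF cofinite_idealD(4)[OF N]]
  have H: "left_ideal ?H" by (rule left_ideal_hull)
  note Hl = left_idealD[OF H]
  have prod_in: "x * y \<in> ?H" if "x \<in> N" "y \<in> N" for x y
    using that by (intro hull_inc) blast
  \<comment> \<open>The hull is taken among left ideals; stability under right multiplication is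
    inherited from the second factor of a product \<open>x * y\<close>.\<close>
  have "?H \<subseteq> {z. \<forall>r. z * r \<in> ?H}"
  proof (rule hull_minimal)
    show "{x * y |x y. x \<in> N \<and> y \<in> N} \<subseteq> {z. \<forall>r. z * r \<in> ?H}"
      using prod_in Nr(3) by (auto simp: mult.assoc)
    show "left_ideal {z. \<forall>r. z * r \<in> ?H}"
      by (subst left_ideal_def) (use Hl(1-3) in \<open>auto simp: distrib_right mult.assoc\<close>)
  qed
  then have "right_ideal ?H"
    by (subst right_ideal_def) (use Hl(1,2) in blast)
  with H have ideal: "two_sided_ideal ?H" by (simp add: two_sided_ideal_def)
  have Hsub: "subspace ?H" by (rule left_ideal_subspace[OF H])
  obtain A where A: "finite A" "A \<subseteq> N" "left_ideal hull A = N"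
    using noetherian_finitely_generated(1)[OF noetherian cofinite_idealD(3)[OF N]] by blast
  obtain B where B: "finite B" "span (N \<union> B) = UNIV"
    using cofinite_idealD(2)[OF N] by (auto simp: finite_codim_def)
  define BA where "BA = (\<lambda>(b, a). b * a) ` (B \<times> A)"
  define T where "T = span (?H \<union> BA)"
  have sT: "subspace T" unfolding T_def by (rule subspace_span)
  have HT: "?H \<subseteq> T" "BA \<subseteq> T" unfolding T_def using span_superset by blast+
  have zaT: "z * a \<in> T" if "a \<in> A" for z a
  proof -
    have "span (N \<union> B) \<subseteq> {z. z * a \<in> T}"
    proof (rule span_minimal)
      have "b * a \<in> BA" if "b \<in> B" for b
        using that \<open>a \<in> A\<close> by (auto simp: BA_def)
      then show "N \<union> B \<subseteq> {z. z * a \<in> T}"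
        using HT prod_in A(2) \<open>a \<in> A\<close> by blast
      show "subspace {z. z * a \<in> T}"
        using sT by (auto simp: subspace_def distrib_right scale_mult_left[symmetric])
    qed
    then show ?thesis using B(2) by blast
  qed
  have "T \<subseteq> {t. \<forall>r. r * t \<in> T}"
    unfolding T_def
  proof (rule span_minimal, unfold T_def[symmetric])
    show "?H \<union> BA \<subseteq> {t. \<forall>r. r * t \<in> T}"
    proof
      fix t assume "t \<in> ?H \<union> BA"
      then consider "t \<in> ?H" | b a where "t = b * a" "a \<in> A" unfolding BA_def by auto
      then show "t \<in> {t. \<forall>r. r * t \<in> T}"
      proof cases
        case 1 then show ?thesis using Hl(3) HT(1) by blast
      next
        case 2 then show ?thesis using zaT by (simp add: mult.assoc[symmetric])
      qed
    qed
    show "subspace {t. \<forall>r. r * t \<in> T}"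
      using sT by (auto simp: subspace_def distrib_left scale_mult_right[symmetric])
  qed
  then have lT: "left_ideal T"
    unfolding left_ideal_def using subspace_0[OF sT] subspace_add[OF sT] by blast
  have "A \<subseteq> T" using zaT[of _ 1] by auto
  then have NT: "N \<subseteq> T" using hull_minimal[of A T left_ideal] lT A(3) by simp
  have "span (?H \<union> (BA \<union> B)) = UNIV"
  proof -
    have "T \<subseteq> span (?H \<union> (BA \<union> B))" unfolding T_def by (rule span_mono) blast
    then have "N \<union> B \<subseteq> span (?H \<union> (BA \<union> B))"
      using NT span_superset[of "?H \<union> (BA \<union> B)"] by blast
    then have "span (N \<union> B) \<subseteq> span (?H \<union> (BA \<union> B))"
      by (rule span_minimal[OF _ subspace_span])
    then show ?thesis using B(2) by (simp add: top.extremum_unique)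
  qed
  moreover have "finite (BA \<union> B)" using A(1) B(1) by (simp add: BA_def)
  ultimately have "finite_codim scale ?H" unfolding finite_codim_def by blast
  with ideal show ?thesis by (simp add: cofinite_ideal_def)
qed

text \<open>Take a complement \<open>L\<close> of \<open>N\<close> modulo \<open>K\<close> and split
  \<open>1 = e + y\<close>. Then \<open>x * y\<close> lies in \<open>N\<close> because
  \<open>N\<close> is a right ideal, and in \<open>L\<close> because \<open>L\<close> is a left
  ideal, hence in \<open>K\<close>.\<close>

lemma cofinite_ideal_unit:
  assumes N: "cofinite_ideal N" and K: "cofinite_ideal K" "K \<subseteq> N"
  shows "\<exists>e\<in>N. \<forall>x\<in>N. x * (1 - e) \<in> K"
proof -
  obtain L where L: "left_ideal L" "N \<inter> L = K" "\<forall>r. \<exists>x\<in>N. \<exists>y\<in>L. r = x + y"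
    using fcr_complement[OF fcr cofinite_idealD(1,2)[OF K(1)] cofinite_idealD(3)[OF N] K(2)] by blast
  obtain e y where e: "e \<in> N" "y \<in> L" "1 = e + y" using L(3) by blast
  have "x * (1 - e) \<in> K" if "x \<in> N" for x
  proof -
    have "x * y \<in> N \<inter> L"
      using right_idealD(3)[OF cofinite_idealD(4)[OF N] that] left_idealD(3)[OF L(1) e(2)] by blast
    moreover have "1 - e = y" using e(3) by (simp add: algebra_simps)
    ultimately show ?thesis using L(2) by simp
  qed
  with e(1) show ?thesis by blast
qed

text \<open>The previous lemma applies with \<open>K = N N\<close>, and both terms of
  \<open>x = x * e + x * (1 - e)\<close> lie in \<open>N N\<close>.\<close>

lemma cofinite_ideal_idempotent:
  assumes N: "cofinite_ideal N"
  shows "N \<subseteq> left_ideal hull {x * y | x y. x \<in> N \<and> y \<in> N}" (is "N \<subseteq> ?H")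
proof
  fix x assume x: "x \<in> N"
  have H: "cofinite_ideal ?H" by (rule product_ideal_cofinite[OF N])
  have "?H \<subseteq> N"
    by (rule hull_minimal)
      (use cofinite_idealD(3)[OF N] left_idealD(3)[OF cofinite_idealD(3)[OF N]] in auto)
  then obtain e where e: "e \<in> N" "\<forall>x\<in>N. x * (1 - e) \<in> ?H"
    using cofinite_ideal_unit[OF N H] by blast
  have "x * e \<in> ?H" by (rule hull_inc) (use x e in blast)
  moreover have "x * (1 - e) \<in> ?H" using e(2) x by blast
  ultimately have "x * e + x * (1 - e) \<in> ?H"
    by (rule left_idealD(2)[OF cofinite_idealD(3)[OF H]])
  then show "x \<in> ?H" by (simp add: right_diff_distrib)
qed

section \<open>Infinite descending chains of ideals of finite codimension\<close>

lemma finite_codim_kernels: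
  assumes V: "subspace V" "finite_codim scale V" and F: "finite F"
    and add: "\<And>f x y. f \<in> F \<Longrightarrow> f (x + y) = f x + f y"
    and scl: "\<And>f c x. f \<in> F \<Longrightarrow> f (scale c x) = c * f x"
  shows "finite_codim scale {x \<in> V. \<forall>f\<in>F. f x = 0}"
  using F add scl
proof (induction F)
  case empty
  then show ?case using V by simp
next
  case (insert f F)
  define U where "U = {x \<in> V. \<forall>f\<in>F. f x = 0}"
  define U' where "U' = {x \<in> V. \<forall>f\<in>insert f F. f x = 0}"
  have U: "finite_codim scale U" unfolding U_def by (rule insert.IH) (use insert.prems in auto)
  then obtain B where B: "finite B" "span (U \<union> B) = UNIV" by (auto simp: finite_codim_def)
  have U'_eq: "U' = {x \<in> U. f x = 0}" unfolding U_def U'_def by auto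
  have "finite_codim scale U'"
  proof (cases "\<exists>v\<in>U. f v \<noteq> 0")
    case False
    then have "U' = U" unfolding U'_eq by blast
    with U show ?thesis by simp
  next
    case True
    then obtain v where v: "v \<in> U" "f v \<noteq> 0" by blast
    have "U \<subseteq> span (U' \<union> insert v B)"
    proof
      fix x assume x: "x \<in> U"
      \<comment> \<open>With this constant \<open>x + scale c v\<close> is killed by
        \<open>f\<close>, so one extra vector \<open>v\<close> makes up for one extra
        functional.\<close>
      define c where "c = - (f x / f v)"
      have "x + scale c v \<in> U'"
      proof -
        have "g (x + scale c v) = 0" if g: "g \<in> insert f F" for g
        proof -
          have "g (x + scale c v) = g x + c * g v" using insert.prems[OF g] by simp
          also have "\<dots> = 0" using g x v by (auto simp: U_def c_def)
          finally show ?thesis .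
        qed
        moreover have "x + scale c v \<in> V"
          using x v(1) by (intro subspace_add subspace_scale V(1)) (simp_all add: U_def)
        ultimately show ?thesis
          unfolding U'_def by blast
      qed
      then have "(x + scale c v) - scale c v \<in> span (U' \<union> insert v B)"
        by (intro span_diff span_scale) (auto intro: span_base)
      then show "x \<in> span (U' \<union> insert v B)" by simp
    qed
    then have "U \<union> B \<subseteq> span (U' \<union> insert v B)"
      using span_superset[of "U' \<union> insert v B"] by blast
    then have "span (U \<union> B) \<subseteq> span (U' \<union> insert v B)"
      by (rule span_minimal[OF _ subspace_span])
    then have "span (U' \<union> insert v B) = UNIV" using B(2) by (simp add: top.extremum_unique)
    then show ?thesis unfolding finite_codim_def using B(1) by blast
  qed
  then show ?case unfolding U'_def .
qed

text \<open>Infinite dimension forces \<open>N\<close> to contain some \<open>x \<noteq> 0\<close>,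
  and some finite dimensional representation does not kill \<open>x\<close>. Intersecting
  \<open>N\<close> with its kernel removes \<open>x\<close>.\<close>

lemma smaller_cofinite_ideal:
  assumes N: "cofinite_ideal N" and inf: "\<not> finite_dim scale"
  shows "\<exists>K. cofinite_ideal K \<and> K \<subset> N"
proof -
  obtain x where x: "x \<in> N" "x \<noteq> 0"
  proof (rule ccontr)
    assume "\<not> thesis"
    then have "N \<subseteq> {0}" using that by blast
    moreover obtain B where B: "finite B" "span (N \<union> B) = UNIV"
      using cofinite_idealD(2)[OF N] by (auto simp: finite_codim_def)
    ultimately have "span (insert 0 B) = UNIV"
      using span_mono[of "N \<union> B" "insert 0 B"] by (auto simp: top.extremum_unique)
    then have "finite_dim scale" unfolding finite_dim_def using B(1) by blast
    with inf show False ..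
  qed
  have "\<Inter> {rep_kernel n \<rho> | n \<rho>. Defs.representation scale n \<rho>} = {0}"
    using fcr by (simp add: fcr_algebra_def)
  with x(2) obtain n \<rho> where rep: "Defs.representation scale n \<rho>" "x \<notin> rep_kernel n \<rho>"
    by blast
  have carr: "\<rho> r \<in> carrier_mat n n" and \<rho>add: "\<rho> (r + s) = \<rho> r + \<rho> s"
    and \<rho>mult: "\<rho> (r * s) = \<rho> r * \<rho> s" and \<rho>scl: "\<rho> (scale c r) = c \<cdot>\<^sub>m \<rho> r" for r s c
    using rep(1) by (auto simp: Defs.representation_def)
  have dims: "dim_row (\<rho> r) = n" "dim_col (\<rho> r) = n" for r using carr[of r] by auto
  \<comment> \<open>The kernel of \<open>\<rho>\<close> is cut out by finitely many linear
    functionals, the matrix entries.\<close>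
  define F where "F = (\<lambda>(i, j) r. \<rho> r $$ (i, j)) ` ({..<n} \<times> {..<n})"
  define K where "K = {x \<in> N. \<forall>f\<in>F. f x = 0}"
  have K_eq: "K = N \<inter> rep_kernel n \<rho>"
    unfolding K_def F_def rep_kernel_def by (auto simp: mat_eq_iff dims)
  have "finite_codim scale K"
    unfolding K_def
    by (rule finite_codim_kernels[OF cofinite_idealD(5,2)[OF N]])
      (auto simp: F_def \<rho>add \<rho>scl dims)
  moreover have "two_sided_ideal K"
  proof -
    have "\<rho> 0 = 0\<^sub>m n n"
    proof -
      have "\<rho> 0 = 0 \<cdot>\<^sub>m \<rho> 0" using \<rho>scl[of 0 0] by simp
      then show ?thesis by (auto simp: mat_eq_iff dims)
    qed
    then show ?thesis
      using left_idealD[OF cofinite_idealD(3)[OF N]] right_idealD[OF cofinite_idealD(4)[OF N]]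
      unfolding K_eq two_sided_ideal_def left_ideal_def right_ideal_def rep_kernel_def
      by (auto simp: \<rho>add \<rho>mult right_mult_zero_mat[OF carr] left_mult_zero_mat[OF carr])
  qed
  moreover have "K \<subset> N" using x(1) rep(2) K_eq by blast
  ultimately show ?thesis by (auto simp: cofinite_ideal_def)
qed

lemma cofinite_ideal_chain:
  assumes "cofinite_ideal I" "\<not> finite_dim scale"
  shows "\<exists>N. N 0 = I \<and> (\<forall>n. cofinite_ideal (N n) \<and> N (Suc n) \<subset> N n)"
proof -
  have "\<exists>N. \<forall>n. (cofinite_ideal (N n) \<and> (n = 0 \<longrightarrow> N n = I)) \<and> N (Suc n) \<subset> N n"
    by (rule dependent_nat_choice) (use assms smaller_cofinite_ideal in auto)
  then show ?thesis by metis
qed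

end

section \<open>Submodules, quotients and trace ideals\<close>

lemma right_submoduleD:
  assumes "right_submodule M N"
  shows "N \<subseteq> carrier M" "\<zero>\<^bsub>M\<^esub> \<in> N"
    "x \<in> N \<Longrightarrow> y \<in> N \<Longrightarrow> x \<oplus>\<^bsub>M\<^esub> y \<in> N" "x \<in> N \<Longrightarrow> r \<odot>\<^bsub>M\<^esub> x \<in> N"
  using assms by (auto simp: right_submodule_def)

context right_module
begin

lemma smult_zero_scalar: "x \<in> carrier M \<Longrightarrow> 0 \<odot> x = \<zero>"
  using smult_add_scalar[of x 0 0] smult_closed[of x 0] by (simp add: add.r_cancel_one)

lemma smult_zero_vec: "r \<odot> \<zero> = \<zero>"
  using smult_add_vec[of \<zero> \<zero> r] smult_closed[of \<zero> r] by (simp add: add.r_cancel_one)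

lemma smult_minus_one: "x \<in> carrier M \<Longrightarrow> (- 1) \<odot> x = \<ominus> x"
  using smult_add_scalar[of x "- 1" 1] smult_closed[of x "- 1"]
  by (intro minus_equality[symmetric]) (simp_all add: smult_zero_scalar smult_one)

lemma right_submodule_minus: "right_submodule M N \<Longrightarrow> x \<in> N \<Longrightarrow> \<ominus> x \<in> N"
  using right_submoduleD(4)[of M N x "- 1"] right_submoduleD(1)[of M N] smult_minus_one[of x] by auto

lemma right_submodule_carrier: "right_submodule M (carrier M)"
  by (simp add: right_submodule_def smult_closed)

lemma right_submodule_hull:
  assumes "B \<subseteq> carrier M"
  shows "right_submodule M (right_submodule M hull B)"
proof -
  have "right_submodule M hull B \<subseteq> carrier M"
    by (rule hull_minimal) (use assms right_submodule_carrier in auto)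
  then show ?thesis
    unfolding right_submodule_def[of M "right_submodule M hull B"] hull_def
    by (auto simp: right_submodule_def)
qed

lemma hull_le_carrier: "B \<subseteq> carrier M \<Longrightarrow> right_submodule M hull B \<subseteq> carrier M"
  using right_submodule_hull right_submoduleD(1) by blast

lemma times_ideal_submodule: "right_submodule M (module_times_ideal M I)"
  unfolding module_times_ideal_def by (rule right_submodule_hull) (auto intro: smult_closed)

lemma times_ideal_mem: "x \<in> carrier M \<Longrightarrow> r \<in> I \<Longrightarrow> r \<odot> x \<in> module_times_ideal M I"
  unfolding module_times_ideal_def by (rule hull_inc) blast

lemma times_ideal_minimal:
  assumes "right_submodule M N" "\<And>x r. x \<in> carrier M \<Longrightarrow> r \<in> I \<Longrightarrow> r \<odot> x \<in> N"
  shows "module_times_ideal M I \<subseteq> N"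
  unfolding module_times_ideal_def by (rule hull_minimal) (use assms in auto)

lemma abelian_subgroup_of_submodule:
  assumes "right_submodule M N"
  shows "abelian_subgroup N M"
proof (rule abelian_subgroupI3)
  show "additive_subgroup N M"
  proof (rule additive_subgroupI, rule group.subgroupI)
    show "Group.group (add_monoid M)" by (rule a_group)
  qed (use assms right_submodule_minus[OF assms] in \<open>auto simp: right_submodule_def a_inv_def\<close>)
qed (rule abelian_group_axioms)

lemma coset_zero: "right_submodule M N \<Longrightarrow> N +> \<zero> = N"
  using right_submoduleD(1)[of M N] by (force simp: a_r_coset_def')

lemma quotient_smult:
  assumes N: "right_submodule M N" and x: "x \<in> carrier M"
  shows "r \<odot>\<^bsub>quotient_module M N\<^esub> (N +> x) = N +> (r \<odot> x)"
proof -
  note Nd = right_submoduleD[OF N]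
  have "N <+>\<^bsub>M\<^esub> (\<lambda>x. r \<odot> x) ` (N +> x) = N +> (r \<odot> x)"
  proof
    show "N <+>\<^bsub>M\<^esub> (\<lambda>x. r \<odot> x) ` (N +> x) \<subseteq> N +> (r \<odot> x)"
    proof
      fix y assume "y \<in> N <+>\<^bsub>M\<^esub> (\<lambda>x. r \<odot> x) ` (N +> x)"
      then obtain h k where hk: "h \<in> N" "k \<in> N" "y = h \<oplus> r \<odot> (k \<oplus> x)"
        unfolding set_add_def' a_r_coset_def' by auto
      then have "y = (h \<oplus> r \<odot> k) \<oplus> r \<odot> x"
        using Nd(1) x by (auto simp: smult_add_vec a_assoc smult_closed subset_iff)
      then show "y \<in> N +> (r \<odot> x)"
        using Nd(3)[OF hk(1) Nd(4)[OF hk(2)]] unfolding a_r_coset_def' by blast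
    qed
    show "N +> (r \<odot> x) \<subseteq> N <+>\<^bsub>M\<^esub> (\<lambda>x. r \<odot> x) ` (N +> x)"
    proof
      fix y assume "y \<in> N +> (r \<odot> x)"
      then obtain h where h: "h \<in> N" "y = h \<oplus> r \<odot> x" unfolding a_r_coset_def' by blast
      have "x \<in> N +> x" using Nd(2) x unfolding a_r_coset_def' by force
      then show "y \<in> N <+>\<^bsub>M\<^esub> (\<lambda>x. r \<odot> x) ` (N +> x)"
        using h unfolding set_add_def' by blast
    qed
  qed
  then show ?thesis by (simp add: quotient_module_def)
qed

lemma quotient_submodule:
  assumes N: "right_submodule M N" and H: "right_submodule M H"
  shows "right_submodule (quotient_module M N) {N +> x | x. x \<in> H}"
proof -
  interpret N: abelian_subgroup N M by (rule abelian_subgroup_of_submodule[OF N])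
  note Hd = right_submoduleD[OF H]
  show ?thesis
    unfolding right_submodule_def
  proof (intro conjI ballI allI)
    show "{N +> x |x. x \<in> H} \<subseteq> carrier (quotient_module M N)"
      using Hd(1) by (auto simp: quotient_module_def A_RCOSETS_def')
    show "\<zero>\<^bsub>quotient_module M N\<^esub> \<in> {N +> x |x. x \<in> H}"
      using Hd(2) coset_zero[OF N] by (auto simp: quotient_module_def)
  next
    fix C D assume "C \<in> {N +> x |x. x \<in> H}" "D \<in> {N +> x |x. x \<in> H}"
    then obtain x y where "C = N +> x" "D = N +> y" "x \<in> H" "y \<in> H" by blast
    moreover from this have "C \<oplus>\<^bsub>quotient_module M N\<^esub> D = N +> (x \<oplus> y)"
      using Hd(1) N.a_rcos_sum[of x y] by (auto simp: quotient_module_def)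
    ultimately show "C \<oplus>\<^bsub>quotient_module M N\<^esub> D \<in> {N +> x |x. x \<in> H}"
      using Hd(3) by blast
  next
    fix r C assume "C \<in> {N +> x |x. x \<in> H}"
    then show "r \<odot>\<^bsub>quotient_module M N\<^esub> C \<in> {N +> x |x. x \<in> H}"
      using Hd(1,4) quotient_smult[OF N] by blast
  qed
qed

text \<open>Representatives of generating cosets generate together with \<open>N\<close>. This
  removes cosets from everything that follows.\<close>

lemma finitely_generated_quotient_iff:
  assumes N: "right_submodule M N"
  shows "finitely_generated (quotient_module M N) \<longleftrightarrow>
    (\<exists>G. finite G \<and> G \<subseteq> carrier M \<and> right_submodule M hull (G \<union> N) = carrier M)"
    (is "?L \<longleftrightarrow> ?R")
proof -
  interpret N: abelian_subgroup N M by (rule abelian_subgroup_of_submodule[OF N])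
  let ?Q = "quotient_module M N"
  have Nc: "N \<subseteq> carrier M" by (rule right_submoduleD(1)[OF N])
  have car: "carrier ?Q = {N +> x | x. x \<in> carrier M}"
    by (auto simp: quotient_module_def A_RCOSETS_def')
  show ?thesis
  proof
    assume ?L
    then obtain B where B: "finite B" "B \<subseteq> carrier ?Q" "right_submodule ?Q hull B = carrier ?Q"
      unfolding finitely_generated_def by blast
    obtain G where G: "G \<subseteq> carrier M" "finite G" "B = (\<lambda>x. N +> x) ` G"
    proof -
      have "B \<subseteq> (\<lambda>x. N +> x) ` carrier M" using B(2) unfolding car by blast
      from finite_subset_image[OF B(1) this] show ?thesis using that by blast
    qed
    define H where "H = right_submodule M hull (G \<union> N)"
    have H: "right_submodule M H"
      unfolding H_def by (rule right_submodule_hull) (use G Nc in blast)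
    have GNH: "G \<subseteq> H" "N \<subseteq> H" unfolding H_def by (auto intro: hull_inc)
    have "right_submodule ?Q hull B \<subseteq> {N +> x | x. x \<in> H}"
      by (rule hull_minimal) (use G(3) GNH quotient_submodule[OF N H] in auto)
    then have sub: "carrier ?Q \<subseteq> {N +> x | x. x \<in> H}" using B(3) by simp
    have "carrier M \<subseteq> H"
    proof
      fix x assume x: "x \<in> carrier M"
      then have "N +> x \<in> carrier ?Q" unfolding car by blast
      then obtain y where y: "N +> x = N +> y" "y \<in> H" using sub by blast
      have "x \<in> N +> x"
        using right_submoduleD(2)[OF N] x unfolding a_r_coset_def' by force
      then obtain h where "h \<in> N" "x = h \<oplus> y" using y(1) unfolding a_r_coset_def' by blast
      then show "x \<in> H" using right_submoduleD(3)[OF H] GNH y(2) by blast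
    qed
    then have "H = carrier M" using right_submoduleD(1)[OF H] by blast
    then show ?R using G unfolding H_def by blast
  next
    assume ?R
    then obtain G where G: "finite G" "G \<subseteq> carrier M" "right_submodule M hull (G \<union> N) = carrier M"
      by blast
    define B where "B = (\<lambda>x. N +> x) ` G"
    have BQ: "B \<subseteq> carrier ?Q" unfolding B_def car using G(2) by blast
    have Qsub: "right_submodule ?Q (carrier ?Q)"
      using quotient_submodule[OF N right_submodule_carrier] unfolding car .
    have "carrier ?Q \<subseteq> T" if T: "right_submodule ?Q T" "B \<subseteq> T" for T
    proof -
      note Td = right_submoduleD[OF T(1)]
      have "right_submodule M hull (G \<union> N) \<subseteq> {x \<in> carrier M. N +> x \<in> T}"
      proof (rule hull_minimal)
        have "N +> x = N" if "x \<in> N" for x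
          by (rule N.a_rcos_const[OF that])
        moreover have "N \<in> T" using Td(2) by (simp add: quotient_module_def)
        ultimately show "G \<union> N \<subseteq> {x \<in> carrier M. N +> x \<in> T}"
          using G(2) Nc T(2) unfolding B_def by auto
        show "right_submodule M {x \<in> carrier M. N +> x \<in> T}"
          unfolding right_submodule_def
        proof (intro conjI ballI allI)
          show "\<zero> \<in> {x \<in> carrier M. N +> x \<in> T}"
            using Td(2) coset_zero[OF N] by (simp add: quotient_module_def)
        next
          fix x y assume xy: "x \<in> {x \<in> carrier M. N +> x \<in> T}" "y \<in> {x \<in> carrier M. N +> x \<in> T}"
          then have "(N +> x) \<oplus>\<^bsub>?Q\<^esub> (N +> y) \<in> T" using Td(3) by blast
          then show "x \<oplus> y \<in> {x \<in> carrier M. N +> x \<in> T}"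
            using xy N.a_rcos_sum[of x y] by (simp add: quotient_module_def)
        next
          fix r x assume x: "x \<in> {x \<in> carrier M. N +> x \<in> T}"
          then have "r \<odot>\<^bsub>?Q\<^esub> (N +> x) \<in> T" using Td(4) by blast
          then show "r \<odot> x \<in> {x \<in> carrier M. N +> x \<in> T}"
            using x quotient_smult[OF N] by (simp add: smult_closed)
        qed auto
      qed
      then show ?thesis using G(3) unfolding car by blast
    qed
    then have "carrier ?Q \<subseteq> right_submodule ?Q hull B" unfolding hull_def by blast
    moreover have "right_submodule ?Q hull B \<subseteq> carrier ?Q" by (rule hull_minimal) (use BQ Qsub in auto)
    moreover have "finite B" using G(1) by (simp add: B_def)
    ultimately show ?L unfolding finitely_generated_def using BQ by blast
  qed
qed

section \<open>Ideals with finitely generated quotient, and the trace ideal\<close>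

lemma fg_quotient_ideals_iff:
  "I \<in> fg_quotient_ideals M \<longleftrightarrow> two_sided_ideal I \<and> (\<exists>G. finite G \<and> G \<subseteq> carrier M \<and>
     right_submodule M hull (G \<union> module_times_ideal M I) = carrier M)"
  unfolding fg_quotient_ideals_def
  using finitely_generated_quotient_iff[OF times_ideal_submodule] by blast

lemma times_ideal_mono: "I \<subseteq> J \<Longrightarrow> module_times_ideal M I \<subseteq> module_times_ideal M J"
  unfolding module_times_ideal_def by (rule hull_mono) blast

text \<open>If \<open>P = GR + PJ = FR + PI\<close>, then \<open>PI = GI + PJI\<close>, where \<open>GI\<close> is finitely generated
  since \<open>I\<close> is, and \<open>PJI\<close> lies in \<open>P(J \<inter> I)\<close>.\<close>

lemma fg_quotient_ideals_Int:
  assumes I: "I \<in> fg_quotient_ideals M" and J: "J \<in> fg_quotient_ideals M"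
    and A: "finite A" "A \<subseteq> I" "right_ideal hull A = I"
  shows "J \<inter> I \<in> fg_quotient_ideals M"
proof -
  have two: "two_sided_ideal I" "two_sided_ideal J"
    using I J by (auto simp: fg_quotient_ideals_iff)
  then have IJ: "two_sided_ideal (J \<inter> I)"
    unfolding two_sided_ideal_def using left_ideal_Int right_ideal_Int by blast
  obtain F where F: "finite F" "F \<subseteq> carrier M"
    "right_submodule M hull (F \<union> module_times_ideal M I) = carrier M"
    using I unfolding fg_quotient_ideals_iff by blast
  obtain G where G: "finite G" "G \<subseteq> carrier M"
    "right_submodule M hull (G \<union> module_times_ideal M J) = carrier M"
    using J unfolding fg_quotient_ideals_iff by blast
  define GA where "GA = (\<lambda>(g, a). a \<odot> g) ` (G \<times> A)"
  have GA: "finite GA" "GA \<subseteq> carrier M"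
    using A(1) G(1,2) by (auto simp: GA_def intro!: smult_closed)
  define H where "H = right_submodule M hull ((F \<union> GA) \<union> module_times_ideal M (J \<inter> I))"
  have H: "right_submodule M H"
    unfolding H_def using F(2) GA(2) right_submoduleD(1)[OF times_ideal_submodule]
    by (intro right_submodule_hull) blast
  note Hd = right_submoduleD[OF H]
  have inH: "F \<subseteq> H" "GA \<subseteq> H" "module_times_ideal M (J \<inter> I) \<subseteq> H"
    unfolding H_def by (auto intro: hull_inc)
  note Il = left_idealD[OF two_sided_idealD(1)[OF two(1)]]
  note Jl = right_idealD[OF two_sided_idealD(2)[OF two(2)]]
  \<comment> \<open>The elements \<open>x\<close> with \<open>x I \<subseteq> H\<close> form a
    submodule because \<open>I\<close> is a left ideal. It contains \<open>G\<close> through the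
    products in \<open>GA\<close> and contains \<open>PJ\<close>, hence is everything, so
    \<open>PI \<subseteq> H\<close>.\<close>
  have "right_submodule M hull (G \<union> module_times_ideal M J) \<subseteq> {x \<in> carrier M. \<forall>r\<in>I. r \<odot> x \<in> H}"
  proof (rule hull_minimal)
    show sub: "right_submodule M {x \<in> carrier M. \<forall>r\<in>I. r \<odot> x \<in> H}"
      unfolding right_submodule_def
    proof (intro conjI ballI allI)
      show "\<zero> \<in> {x \<in> carrier M. \<forall>r\<in>I. r \<odot> x \<in> H}"
        using Hd(2) by (simp add: smult_zero_vec)
    next
      fix x y assume "x \<in> {x \<in> carrier M. \<forall>r\<in>I. r \<odot> x \<in> H}" "y \<in> {x \<in> carrier M. \<forall>r\<in>I. r \<odot> x \<in> H}"
      then show "x \<oplus> y \<in> {x \<in> carrier M. \<forall>r\<in>I. r \<odot> x \<in> H}"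
        using Hd(3) by (simp add: smult_add_vec)
    next
      fix s x assume "x \<in> {x \<in> carrier M. \<forall>r\<in>I. r \<odot> x \<in> H}"
      then show "s \<odot> x \<in> {x \<in> carrier M. \<forall>r\<in>I. r \<odot> x \<in> H}"
        using Il(3) by (simp add: smult_closed smult_assoc)
    qed auto
    have "I \<subseteq> {r. r \<odot> g \<in> H}" if "g \<in> G" for g
    proof -
      have g: "g \<in> carrier M" using that G(2) by blast
      have "right_ideal hull A \<subseteq> {r. r \<odot> g \<in> H}"
      proof (rule hull_minimal)
        show "A \<subseteq> {r. r \<odot> g \<in> H}" using that inH(2) by (auto simp: GA_def)
        have "(r * s) \<odot> g \<in> H" if "r \<odot> g \<in> H" for r s
          unfolding smult_assoc[OF g, symmetric] by (rule Hd(4)[OF that])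
        then show "right_ideal {r. r \<odot> g \<in> H}"
          using Hd(2,3) by (simp add: right_ideal_def g smult_zero_scalar smult_add_scalar)
      qed
      then show ?thesis using A(3) by simp
    qed
    moreover have "module_times_ideal M J \<subseteq> {x \<in> carrier M. \<forall>r\<in>I. r \<odot> x \<in> H}"
    proof (rule times_ideal_minimal[OF sub])
      fix x s assume x: "x \<in> carrier M" and s: "s \<in> J"
      \<comment> \<open>In right notation this element is \<open>x s r\<close>, where
        \<open>s r\<close> lies in \<open>J\<close> as a right ideal and in \<open>I\<close> as a
        left ideal.\<close>
      have "r \<odot> (s \<odot> x) \<in> H" if "r \<in> I" for r
      proof -
        have "s * r \<in> J \<inter> I" using Jl(3)[OF s] Il(3)[OF that] by blast
        then have "(s * r) \<odot> x \<in> H" using times_ideal_mem[OF x] inH(3) by blast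
        then show ?thesis by (simp add: smult_assoc x)
      qed
      then show "s \<odot> x \<in> {x \<in> carrier M. \<forall>r\<in>I. r \<odot> x \<in> H}" using smult_closed[OF x] by blast
    qed
    ultimately show "G \<union> module_times_ideal M J \<subseteq> {x \<in> carrier M. \<forall>r\<in>I. r \<odot> x \<in> H}"
      using G(2) by blast
  qed
  then have "module_times_ideal M I \<subseteq> H"
    using G(3) by (intro times_ideal_minimal[OF H]) blast
  then have "right_submodule M hull (F \<union> module_times_ideal M I) \<subseteq> H"
    using inH(1) by (intro hull_minimal H) blast
  then have "H = carrier M" using F(3) Hd(1) by blast
  then show ?thesis
    unfolding fg_quotient_ideals_iff using IJ F(1,2) GA unfolding H_def by blast
qed

text \<open>A homomorphism \<open>f\<close> into \<open>R\<close> satisfies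
  \<open>f(P) = f(PI) = f(P) I \<subseteq> I\<close>.\<close>

lemma trace_ideal_subset:
  assumes I: "two_sided_ideal I" and MI: "module_times_ideal M I = carrier M"
  shows "trace_ideal M \<subseteq> I"
proof -
  note Il = left_idealD[OF two_sided_idealD(1)[OF I]]
  note Ir = right_idealD[OF two_sided_idealD(2)[OF I]]
  have "f x \<in> I" if f: "f \<in> module_hom M regular_module" and x: "x \<in> carrier M" for f x
  proof -
    have add: "f (x \<oplus> y) = f x + f y" and smult: "f (r \<odot> x) = f x * r"
      if "x \<in> carrier M" "y \<in> carrier M" for x y r
      using f that by (auto simp: module_hom_def regular_module_def)
    have "f \<zero> = 0" using add[of \<zero> \<zero>] by simp
    then have "right_submodule M {x \<in> carrier M. f x \<in> I}"
      unfolding right_submodule_def using Il(1) Ir(2,3)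
      by (auto simp: add smult smult_closed)
    then have "module_times_ideal M I \<subseteq> {x \<in> carrier M. f x \<in> I}"
      by (rule times_ideal_minimal) (auto simp: smult smult_closed Il(3))
    then show ?thesis using MI x by blast
  qed
  then show ?thesis
    unfolding trace_ideal_def by (auto intro!: left_ideal_sum two_sided_idealD(1)[OF I])
qed

end

text \<open>The least such \<open>g\<close> is an isomorphism invariant of \<open>P\<close>; for the
  ideals \<open>M i\<close> it recovers the sequence \<open>s\<close>. The \<open>p i\<close> may
  repeat.\<close>

definition generated_mod :: "('a::ring_1, 'm, 'z) module_scheme \<Rightarrow> 'a set \<Rightarrow> nat \<Rightarrow> bool" where
  "generated_mod P I g \<longleftrightarrow> (\<exists>p. (\<forall>i<g. p i \<in> carrier P) \<and>
     right_submodule P hull (p ` {..<g} \<union> module_times_ideal P I) = carrier P)"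

lemma generated_mod_surjective:
  assumes P: "right_module P" and Q: "right_module Q"
    and f: "f \<in> module_hom P Q" "f ` carrier P = carrier Q" and gen: "generated_mod P I g"
  shows "generated_mod Q I g"
proof -
  interpret P: right_module P by fact
  interpret Q: right_module Q by fact
  have fc: "f x \<in> carrier Q" and add: "f (x \<oplus>\<^bsub>P\<^esub> y) = f x \<oplus>\<^bsub>Q\<^esub> f y"
    and smult: "f (r \<odot>\<^bsub>P\<^esub> x) = r \<odot>\<^bsub>Q\<^esub> f x"
    if "x \<in> carrier P" "y \<in> carrier P" for x y r
    using f(1) that by (auto simp: module_hom_def)
  have f0: "f \<zero>\<^bsub>P\<^esub> = \<zero>\<^bsub>Q\<^esub>"
    using smult[of "\<zero>\<^bsub>P\<^esub>" "\<zero>\<^bsub>P\<^esub>" 0] fc[of "\<zero>\<^bsub>P\<^esub>" "\<zero>\<^bsub>P\<^esub>"]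
    by (simp add: P.smult_zero_scalar Q.smult_zero_scalar)
  have pre: "right_submodule P {x \<in> carrier P. f x \<in> H}" if "right_submodule Q H" for H
    unfolding right_submodule_def
    using right_submoduleD[OF that] by (auto simp: add smult f0 P.smult_closed)
  obtain p where p: "\<forall>i<g. p i \<in> carrier P"
    "right_submodule P hull (p ` {..<g} \<union> module_times_ideal P I) = carrier P"
    using gen unfolding generated_mod_def by blast
  define H where "H = right_submodule Q hull ((\<lambda>i. f (p i)) ` {..<g} \<union> module_times_ideal Q I)"
  have H: "right_submodule Q H"
    unfolding H_def
    using p(1) fc right_submoduleD(1)[OF Q.times_ideal_submodule[of I]]
    by (intro Q.right_submodule_hull) auto
  have HI: "module_times_ideal Q I \<subseteq> H" and Hp: "\<And>i. i < g \<Longrightarrow> f (p i) \<in> H"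
    unfolding H_def by (auto intro: hull_inc)
  have "module_times_ideal P I \<subseteq> {x \<in> carrier P. f x \<in> H}"
  proof (rule P.times_ideal_minimal[OF pre[OF H]])
    fix x r assume "x \<in> carrier P" "r \<in> I"
    moreover have "r \<odot>\<^bsub>Q\<^esub> f x \<in> H"
      using Q.times_ideal_mem[of "f x" r I] fc calculation HI by blast
    ultimately show "r \<odot>\<^bsub>P\<^esub> x \<in> {x \<in> carrier P. f x \<in> H}"
      by (simp add: smult P.smult_closed)
  qed
  then have "right_submodule P hull (p ` {..<g} \<union> module_times_ideal P I) \<subseteq> {x \<in> carrier P. f x \<in> H}"
    using p(1) Hp by (intro hull_minimal pre H) auto
  then have "carrier P \<subseteq> {x \<in> carrier P. f x \<in> H}" unfolding p(2) .
  then have "carrier Q \<subseteq> H" unfolding f(2)[symmetric] by auto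
  then have "H = carrier Q" using right_submoduleD(1)[OF H] by blast
  then show ?thesis
    unfolding generated_mod_def H_def using p(1) fc by (intro exI[of _ "\<lambda>i. f (p i)"]) auto
qed

section \<open>Projective modules as retracts of free modules\<close>

lemma free_module_simps:
  "f \<in> carrier (free_module X) \<longleftrightarrow> finite {i. f i \<noteq> 0} \<and> {i. f i \<noteq> 0} \<subseteq> X"
  "\<zero>\<^bsub>free_module X\<^esub> = (\<lambda>_. 0)"
  "f \<oplus>\<^bsub>free_module X\<^esub> g = (\<lambda>i. f i + g i)"
  "r \<odot>\<^bsub>free_module X\<^esub> f = (\<lambda>i. f i * r)"
  by (auto simp: free_module_def)

lemma free_module_add_closed:
  fixes f g :: "'i \<Rightarrow> 'a::ring_1"
  assumes "f \<in> carrier (free_module X)" "g \<in> carrier (free_module X)"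
  shows "(\<lambda>i. f i + g i) \<in> carrier (free_module X)"
proof -
  have "{i. f i + g i \<noteq> 0} \<subseteq> {i. f i \<noteq> 0} \<union> {i. g i \<noteq> 0}" by auto
  with assms show ?thesis unfolding free_module_simps by (meson Un_least finite_UnI finite_subset subset_trans)
qed

lemma free_module_smult_closed:
  fixes f :: "'i \<Rightarrow> 'a::ring_1"
  assumes "f \<in> carrier (free_module X)"
  shows "(\<lambda>i. f i * r) \<in> carrier (free_module X)"
proof -
  have "{i. f i * r \<noteq> 0} \<subseteq> {i. f i \<noteq> 0}" by auto
  with assms show ?thesis unfolding free_module_simps by (meson finite_subset subset_trans)
qed

lemma free_right_module: "right_module (free_module X :: ('a::ring_1, 'i \<Rightarrow> 'a) module)"
proof -
  have "abelian_group (free_module X :: ('a::ring_1, 'i \<Rightarrow> 'a) module)"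
  proof (rule abelian_groupI; unfold free_module_simps(2,3))
    show "(\<lambda>_. 0) \<in> carrier (free_module X)" by (simp add: free_module_simps)
    fix f :: "'i \<Rightarrow> 'a" assume f: "f \<in> carrier (free_module X)"
    have "(\<lambda>i. f i * (- 1)) \<in> carrier (free_module X)"
      by (rule free_module_smult_closed[OF f])
    then show "\<exists>y\<in>carrier (free_module X). (\<lambda>i. y i + f i) = (\<lambda>_. 0)"
      by (intro bexI[of _ "\<lambda>i. f i * (- 1)"]) (auto simp: fun_eq_iff)
  qed (auto simp: free_module_add_closed ac_simps)
  then show ?thesis
    unfolding right_module_def right_module_axioms_def
    by (auto simp: free_module_simps(3,4) free_module_smult_closed algebra_simps)
qed

lemma module_homD:
  assumes "f \<in> module_hom M N"
  shows "x \<in> carrier M \<Longrightarrow> f x \<in> carrier N"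
    "x \<in> carrier M \<Longrightarrow> y \<in> carrier M \<Longrightarrow> f (x \<oplus>\<^bsub>M\<^esub> y) = f x \<oplus>\<^bsub>N\<^esub> f y"
    "x \<in> carrier M \<Longrightarrow> f (r \<odot>\<^bsub>M\<^esub> x) = r \<odot>\<^bsub>N\<^esub> f x"
  using assms by (auto simp: module_hom_def)

lemma module_hom_zero:
  assumes "right_module M" "right_module N" and f: "f \<in> module_hom M N"
  shows "f \<zero>\<^bsub>M\<^esub> = \<zero>\<^bsub>N\<^esub>"
proof -
  interpret M: right_module M by fact
  interpret N: right_module N by fact
  have "f (0 \<odot>\<^bsub>M\<^esub> \<zero>\<^bsub>M\<^esub>) = 0 \<odot>\<^bsub>N\<^esub> f \<zero>\<^bsub>M\<^esub>" "f \<zero>\<^bsub>M\<^esub> \<in> carrier N"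
    using f by (auto simp: module_hom_def)
  then show ?thesis by (simp add: M.smult_zero_vec N.smult_zero_scalar)
qed

lemma retract_direct_summand:
  fixes P :: "('a::ring_1, 'm, 'z) module_scheme" and F :: "('a, 'n, 'y) module_scheme"
  assumes P: "right_module P" and F: "right_module F"
    and \<sigma>: "\<sigma> \<in> module_hom P F" and \<pi>: "\<pi> \<in> module_hom F P"
    and inv: "\<And>x. x \<in> carrier P \<Longrightarrow> \<pi> (\<sigma> x) = x"
  shows "direct_summand F (\<sigma> ` carrier P)"
    and "module_isomorphic P (F\<lparr>carrier := \<sigma> ` carrier P\<rparr>)"
proof -
  interpret P: right_module P by fact
  interpret F: right_module F by fact
  note \<sigma>c = module_homD(1)[OF \<sigma>] and \<sigma>a = module_homD(2)[OF \<sigma>] and \<sigma>s = module_homD(3)[OF \<sigma>]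
  note \<pi>c = module_homD(1)[OF \<pi>] and \<pi>a = module_homD(2)[OF \<pi>] and \<pi>s = module_homD(3)[OF \<pi>]
  have \<sigma>0: "\<sigma> \<zero>\<^bsub>P\<^esub> = \<zero>\<^bsub>F\<^esub>" by (rule module_hom_zero[OF P F \<sigma>])
  have \<pi>0: "\<pi> \<zero>\<^bsub>F\<^esub> = \<zero>\<^bsub>P\<^esub>" by (rule module_hom_zero[OF F P \<pi>])
  define A where "A = \<sigma> ` carrier P"
  define B where "B = {f \<in> carrier F. \<pi> f = \<zero>\<^bsub>P\<^esub>}"
  have A: "right_submodule F A"
    unfolding right_submodule_def
  proof (intro conjI ballI allI)
    show "A \<subseteq> carrier F" using \<sigma>c by (auto simp: A_def)
    show "\<zero>\<^bsub>F\<^esub> \<in> A" unfolding A_def \<sigma>0[symmetric] by simp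
    show "x \<oplus>\<^bsub>F\<^esub> y \<in> A" if "x \<in> A" "y \<in> A" for x y
      using that by (auto simp: A_def \<sigma>a[symmetric])
    show "r \<odot>\<^bsub>F\<^esub> x \<in> A" if "x \<in> A" for x r
      using that by (auto simp: A_def \<sigma>s[symmetric] P.smult_closed)
  qed
  have B: "right_submodule F B"
    unfolding right_submodule_def by (auto simp: B_def \<pi>0 \<pi>a \<pi>s F.smult_closed P.smult_zero_vec)
  have "A \<inter> B = {\<zero>\<^bsub>F\<^esub>}"
  proof
    show "A \<inter> B \<subseteq> {\<zero>\<^bsub>F\<^esub>}" using inv \<sigma>0 by (auto simp: A_def B_def)
    show "{\<zero>\<^bsub>F\<^esub>} \<subseteq> A \<inter> B" using right_submoduleD(2)[OF A] right_submoduleD(2)[OF B] by blast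
  qed
  moreover have "A <+>\<^bsub>F\<^esub> B = carrier F"
  proof
    show "A <+>\<^bsub>F\<^esub> B \<subseteq> carrier F"
      using right_submoduleD(1)[OF A] right_submoduleD(1)[OF B] by (auto simp: set_add_def')
    show "carrier F \<subseteq> A <+>\<^bsub>F\<^esub> B"
    proof
      fix f assume f: "f \<in> carrier F"
      define a where "a = \<sigma> (\<pi> f)"
      \<comment> \<open>The component of \<open>f\<close> in the kernel of \<open>\<pi>\<close>,
        namely \<open>f - \<sigma> (\<pi> f)\<close>.\<close>
      define b where "b = (- 1) \<odot>\<^bsub>F\<^esub> a \<oplus>\<^bsub>F\<^esub> f"
      have a: "a \<in> carrier F" "a \<in> A" by (simp_all add: a_def A_def \<sigma>c \<pi>c f)
      have \<pi>a': "\<pi> a = \<pi> f" by (simp add: a_def inv \<pi>c f)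
      have bc: "b \<in> carrier F" by (simp add: b_def F.smult_closed a f)
      have "\<pi> b = \<zero>\<^bsub>P\<^esub>"
        by (simp add: b_def \<pi>a \<pi>s \<pi>a' F.smult_closed a f P.smult_minus_one \<pi>c P.l_neg)
      then have "b \<in> B" using bc by (simp add: B_def)
      moreover have "f = a \<oplus>\<^bsub>F\<^esub> b"
        using a f by (simp add: b_def F.smult_minus_one F.a_assoc[symmetric] F.r_neg)
      ultimately show "f \<in> A <+>\<^bsub>F\<^esub> B" using a(2) unfolding set_add_def' by blast
    qed
  qed
  ultimately show "direct_summand F (\<sigma> ` carrier P)"
    unfolding direct_summand_def A_def[symmetric] using A B by blast
  have "\<sigma> \<in> module_hom P (F\<lparr>carrier := \<sigma> ` carrier P\<rparr>)"
    by (auto simp: module_hom_def \<sigma>a \<sigma>s)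
  moreover have "inj_on \<sigma> (carrier P)" by (rule inj_on_inverseI) (rule inv)
  ultimately show "module_isomorphic P (F\<lparr>carrier := \<sigma> ` carrier P\<rparr>)"
    unfolding module_isomorphic_def bij_betw_def by (intro bexI[of _ \<sigma>]) auto
qed

text \<open>The definition of projectivity wants a basis indexed by elements of the type of
  \<open>P\<close>, so a retraction from a free module with another index type is transported along
  the injection \<open>\<iota>\<close>.\<close>

lemma projective_moduleI:
  fixes P :: "('a::ring_1, 'm, 'z) module_scheme" and \<iota> :: "'i \<Rightarrow> 'm"
  assumes P: "right_module P" and \<iota>: "inj \<iota>"
    and \<sigma>: "\<sigma> \<in> module_hom P (free_module (UNIV :: 'i set))"
    and \<pi>: "\<pi> \<in> module_hom (free_module (UNIV :: 'i set)) P"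
    and inv: "\<And>x. x \<in> carrier P \<Longrightarrow> \<pi> (\<sigma> x) = x"
  shows "projective_module P"
proof -
  define F where "F = (free_module (range \<iota>) :: ('a, 'm \<Rightarrow> 'a) module)"
  define \<sigma>' where "\<sigma>' x = (\<lambda>m. if m \<in> range \<iota> then \<sigma> x (inv_into UNIV \<iota> m) else 0)" for x
  define \<pi>' where "\<pi>' f = \<pi> (f \<circ> \<iota>)" for f
  have F: "right_module F" unfolding F_def by (rule free_right_module)
  have \<sigma>'\<iota>: "\<sigma>' x \<circ> \<iota> = \<sigma> x" for x
    using \<iota> by (auto simp: \<sigma>'_def fun_eq_iff)
  have "\<sigma>' x \<in> carrier F" if "x \<in> carrier P" for x
  proof -
    have "finite {i. \<sigma> x i \<noteq> 0}"
      using \<sigma> that by (auto simp: module_hom_def free_module_simps)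
    moreover have "{m. \<sigma>' x m \<noteq> 0} = \<iota> ` {i. \<sigma> x i \<noteq> 0}"
      using \<iota> by (auto simp: \<sigma>'_def dest: injD)
    ultimately show ?thesis by (auto simp: F_def free_module_simps)
  qed
  then have "\<sigma>' \<in> module_hom P F"
    using \<sigma> by (auto simp: module_hom_def free_module_simps F_def \<sigma>'_def fun_eq_iff)
  moreover have "\<pi>' \<in> module_hom F P"
  proof -
    have "f \<circ> \<iota> \<in> carrier (free_module UNIV)" if "f \<in> carrier F" for f
      using that finite_vimageI[OF _ \<iota>, of "{m. f m \<noteq> 0}"]
      by (auto simp: F_def free_module_simps vimage_def)
    moreover have "(\<lambda>m. f m + g m) \<circ> \<iota> = (\<lambda>i. (f \<circ> \<iota>) i + (g \<circ> \<iota>) i)"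
      "(\<lambda>m. f m * r) \<circ> \<iota> = (\<lambda>i. (f \<circ> \<iota>) i * r)" for f g :: "'m \<Rightarrow> 'a" and r
      by auto
    ultimately show ?thesis
      using module_homD[OF \<pi>]
      by (auto simp: module_hom_def free_module_simps(2-4) F_def \<pi>'_def o_def)
  qed
  moreover have "\<pi>' (\<sigma>' x) = x" if "x \<in> carrier P" for x
    unfolding \<pi>'_def \<sigma>'\<iota> by (rule inv[OF that])
  ultimately show ?thesis
    unfolding projective_module_def using P retract_direct_summand[OF P F, of \<sigma>' \<pi>']
    unfolding F_def by blast
qed

lemma countably_generatedI:
  fixes P :: "('a::ring_1, 'm, 'z) module_scheme" and I :: "'i::countable itself"
  assumes P: "right_module P"
    and \<pi>: "\<pi> \<in> module_hom (free_module (UNIV :: 'i set)) P"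
    and surj: "\<And>x. x \<in> carrier P \<Longrightarrow> \<exists>f\<in>carrier (free_module (UNIV :: 'i set)). \<pi> f = x"
  shows "countably_generated P"
proof -
  interpret P: right_module P by fact
  let ?F = "free_module (UNIV :: 'i set) :: ('a, 'i \<Rightarrow> 'a) module"
  define u :: "'i \<Rightarrow> 'i \<Rightarrow> 'a" where "u i = (\<lambda>j. if j = i then 1 else 0)" for i
  have u: "u i \<in> carrier ?F" for i
  proof -
    have "{j. u i j \<noteq> 0} = {i}" by (auto simp: u_def)
    then show ?thesis by (simp add: free_module_simps)
  qed
  note \<pi>c = module_homD(1)[OF \<pi>]
    and \<pi>a = module_homD(2)[OF \<pi>, unfolded free_module_simps(3)]
    and \<pi>s = module_homD(3)[OF \<pi>, unfolded free_module_simps(4)]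
  define H where "H = right_submodule P hull range (\<lambda>i. \<pi> (u i))"
  have sub: "range (\<lambda>i. \<pi> (u i)) \<subseteq> carrier P" using \<pi>c u by auto
  have H: "right_submodule P H"
    unfolding H_def by (rule P.right_submodule_hull[OF sub])
  have uH: "\<pi> (u i) \<in> H" for i unfolding H_def by (rule hull_inc) simp
  have "\<pi> f \<in> H" if "finite S" "{i. f i \<noteq> 0} \<subseteq> S" for f S
    using that
  proof (induction S arbitrary: f)
    case empty
    then have "f = (\<lambda>_. 0)" by auto
    then show ?case
      using right_submoduleD(2)[OF H] module_hom_zero[OF free_right_module P \<pi>]
      by (simp add: free_module_simps)
  next
    case (insert i S)
    define g where "g = (\<lambda>j. if j = i then 0 else f j)"
    have g: "{j. g j \<noteq> 0} \<subseteq> S" using insert.prems by (auto simp: g_def)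
    then have gc: "g \<in> carrier ?F" using insert.hyps(1) finite_subset by (auto simp: free_module_simps)
    have "(\<lambda>j. u i j * f i) \<in> carrier ?F" by (rule free_module_smult_closed[OF u])
    moreover have "f = (\<lambda>j. g j + u i j * f i)" by (auto simp: g_def u_def fun_eq_iff)
    ultimately have "\<pi> f = \<pi> g \<oplus>\<^bsub>P\<^esub> f i \<odot>\<^bsub>P\<^esub> \<pi> (u i)"
      using \<pi>a[OF gc, of "\<lambda>j. u i j * f i"] \<pi>s[OF u] by metis
    then show ?case
      using right_submoduleD(3,4)[OF H] insert.IH[OF g] uH by simp
  qed
  then have "carrier P \<subseteq> H"
    using surj by (force simp: free_module_simps)
  then have "H = carrier P" using right_submoduleD(1)[OF H] by blast
  then show ?thesis
    unfolding countably_generated_def H_def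
    using sub by (intro exI[of _ "range (\<lambda>i. \<pi> (u i))"]) auto
qed

section \<open>Invariance of the rank\<close>

text \<open>Index arithmetic for block matrices: \<open>t = j * d + q\<close> is entry
  \<open>q\<close> of block \<open>j\<close>.\<close>

lemma sum_div_mod:
  fixes f :: "nat \<Rightarrow> nat \<Rightarrow> 'b::comm_monoid_add"
  assumes "0 < d"
  shows "(\<Sum>t<s * d. f (t div d) (t mod d)) = (\<Sum>j<s. \<Sum>q<d. f j q)"
proof -
  have "(\<Sum>t<s * d. f (t div d) (t mod d)) = (\<Sum>j<s. \<Sum>t = j * d..<j * d + d. f (t div d) (t mod d))"
    by (rule sum.nat_group[symmetric])
  also have "\<dots> = (\<Sum>j<s. \<Sum>q<d. f j q)"
  proof (rule sum.cong[OF refl])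
    fix j
    have "(\<Sum>t = j * d..<j * d + d. f (t div d) (t mod d)) = (\<Sum>q = 0..<d. f ((q + j * d) div d) ((q + j * d) mod d))"
      using sum.shift_bounds_nat_ivl[of "\<lambda>t. f (t div d) (t mod d)" 0 "j * d" d] by (simp add: add.commute)
    also have "\<dots> = (\<Sum>q<d. f j q)"
      unfolding lessThan_atLeast0 by (rule sum.cong) (use assms in auto)
    finally show "(\<Sum>t = j * d..<j * d + d. f (t div d) (t mod d)) = (\<Sum>q<d. f j q)" .
  qed
  finally show ?thesis .
qed

context k_algebra
begin

text \<open>Invariance of rank over the nonzero finite dimensional algebra \<open>R / K\<close>.
  Applying \<open>\<rho>\<close> to each entry turns the equation \<open>X Y = 1\<close> modulo
  \<open>K\<close> into one between block matrices over the field, where a one-sided inverse of a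
  square matrix is two-sided.\<close>

lemma rank_le_modulo_ideal:
  fixes s g :: nat
  assumes K: "two_sided_ideal K" "finite_codim scale K" "1 \<notin> K"
    and XY: "\<And>i c. i < s \<Longrightarrow> c < s \<Longrightarrow> (\<Sum>j<g. X i j * Y j c) - (if i = c then 1 else 0) \<in> K"
  shows "s \<le> g"
proof (rule ccontr)
  assume "\<not> s \<le> g"
  then have gs: "g < s" by simp
  from quotient_representation[OF K(1,2)]
  obtain d :: nat and \<phi> :: "'a \<Rightarrow> 'k vec" and \<rho> :: "'a \<Rightarrow> 'k mat" where
    *: "Defs.representation scale d \<rho> \<and> (\<forall>x. \<phi> x \<in> carrier_vec d) \<and>
    (\<forall>x y. \<phi> (x + y) = \<phi> x + \<phi> y) \<and> (\<forall>c x. \<phi> (scale c x) = c \<cdot>\<^sub>v \<phi> x) \<and>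
    (\<forall>r x. \<phi> (r * x) = \<rho> r *\<^sub>v \<phi> x) \<and> (\<forall>v\<in>carrier_vec d. \<exists>x. \<phi> x = v) \<and>
    (\<forall>x. \<phi> x = 0\<^sub>v d \<longleftrightarrow> x \<in> K)"
    by (elim exE)
  then have carr: "\<And>x. \<phi> x \<in> carrier_vec d"
    and act: "\<And>r x. \<phi> (r * x) = \<rho> r *\<^sub>v \<phi> x"
    and surj: "\<And>v. v \<in> carrier_vec d \<Longrightarrow> \<exists>x. \<phi> x = v"
    and ker: "\<And>x. \<phi> x = 0\<^sub>v d \<longleftrightarrow> x \<in> K"
    by blast+
  from * have \<rho>carr: "\<rho> r \<in> carrier_mat d d" and \<rho>add: "\<rho> (r + t) = \<rho> r + \<rho> t"
    and \<rho>mult: "\<rho> (r * t) = \<rho> r * \<rho> t" and \<rho>one: "\<rho> 1 = 1\<^sub>m d" for r t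
    by (auto simp: Defs.representation_def)
  have dims: "dim_row (\<rho> r) = d" "dim_col (\<rho> r) = d" for r using \<rho>carr[of r] by auto
  have "d \<noteq> 0"
  proof
    assume "d = 0"
    then have "\<phi> 1 = 0\<^sub>v d" using carr[of 1] by (intro eq_vecI) auto
    then show False using ker K(3) by simp
  qed
  then have d: "0 < d" by simp
  have \<rho>K: "\<rho> r = 0\<^sub>m d d" if "r \<in> K" for r
  proof (rule mat_eq_on_vecI[where n = d and m = d])
    fix v :: "'k vec" assume v: "v \<in> carrier_vec d"
    then obtain x where x: "v = \<phi> x" using surj by blast
    have "r * x \<in> K" by (rule right_idealD(3)[OF two_sided_idealD(2)[OF K(1)] that])
    then have "\<rho> r *\<^sub>v v = 0\<^sub>v d" unfolding x act[symmetric] using ker by simp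
    then show "\<rho> r *\<^sub>v v = 0\<^sub>m d d *\<^sub>v v" using v by auto
  qed (use \<rho>carr in auto)
  have \<rho>0: "\<rho> 0 = 0\<^sub>m d d" by (rule \<rho>K, rule left_idealD(1)[OF two_sided_idealD(1)[OF K(1)]])
  have \<rho>sum: "\<rho> (sum f A) $$ (p, q) = (\<Sum>j\<in>A. \<rho> (f j) $$ (p, q))"
    if "p < d" "q < d" for f :: "nat \<Rightarrow> 'a" and A p q
    by (induction A rule: infinite_finite_induct) (use that in \<open>auto simp: \<rho>0 \<rho>add dims\<close>)
  \<comment> \<open>If \<open>g < s\<close>, zero columns of \<open>X\<close> and zero rows of
    \<open>Y\<close> are added to make the block matrices square.\<close>
  define X' where "X' i j = (if j < g then X i j else 0)" for i j
  define Y' where "Y' j c = (if j < g then Y j c else 0)" for j c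
  define block where "block Z = mat (s * d) (s * d)
    (\<lambda>(a, b). \<rho> (Z (a div d) (b div d)) $$ (a mod d, b mod d))" for Z :: "nat \<Rightarrow> nat \<Rightarrow> 'a"
  have blockc: "block Z \<in> carrier_mat (s * d) (s * d)" for Z by (simp add: block_def)
  have divl: "a div d < s" if "a < s * d" for a
    using that d by (simp add: less_mult_imp_div_less)
  have "block X' * block Y' = 1\<^sub>m (s * d)"
  proof (rule eq_matI)
    fix a b assume "a < dim_row (1\<^sub>m (s * d) :: 'k mat)" "b < dim_col (1\<^sub>m (s * d) :: 'k mat)"
    then have ab: "a < s * d" "b < s * d" by auto
    define i p c q where "i = a div d" "p = a mod d" "c = b div d" "q = b mod d"
    have pq: "p < d" "q < d" using d by (auto simp: i_p_c_q_def)
    have ic: "i < s" "c < s" using divl ab by (auto simp: i_p_c_q_def)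
    define r where "r = (\<Sum>j<g. X i j * Y j c)"
    define \<delta> :: 'a where "\<delta> = (if i = c then 1 else 0)"
    have "(block X' * block Y') $$ (a, b) =
      (\<Sum>t<s * d. \<rho> (X' i (t div d)) $$ (p, t mod d) * \<rho> (Y' (t div d) c) $$ (t mod d, q))"
      using ab by (simp add: block_def scalar_prod_def i_p_c_q_def lessThan_atLeast0)
    also have "\<dots> = (\<Sum>j<s. \<Sum>t<d. \<rho> (X' i j) $$ (p, t) * \<rho> (Y' j c) $$ (t, q))"
      by (rule sum_div_mod[OF d])
    also have "\<dots> = (\<Sum>j<s. \<rho> (X' i j * Y' j c) $$ (p, q))"
      using pq by (simp add: \<rho>mult scalar_prod_def dims lessThan_atLeast0)
    also have "\<dots> = \<rho> (\<Sum>j<s. X' i j * Y' j c) $$ (p, q)"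
      by (rule \<rho>sum[OF pq, symmetric])
    also have "(\<Sum>j<s. X' i j * Y' j c) = r"
      unfolding r_def by (rule sum.mono_neutral_cong_right) (use gs in \<open>auto simp: X'_def Y'_def\<close>)
    also have "\<rho> r = \<rho> (\<delta> + (r - \<delta>))" by simp
    also have "\<dots> = \<rho> \<delta>"
      unfolding \<rho>add \<rho>K[OF XY[OF ic, folded r_def \<delta>_def]] using \<rho>carr by simp
    also have "\<rho> \<delta> $$ (p, q) = 1\<^sub>m (s * d) $$ (a, b)"
    proof -
      have "a = b \<longleftrightarrow> i = c \<and> p = q"
        unfolding i_p_c_q_def by (metis div_mult_mod_eq)
      then show ?thesis using pq ab by (auto simp: \<delta>_def \<rho>one \<rho>0)
    qed
    finally show "(block X' * block Y') $$ (a, b) = 1\<^sub>m (s * d) $$ (a, b)" .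
  qed (simp_all add: block_def)
  then have YX: "block Y' * block X' = 1\<^sub>m (s * d)"
    by (rule mat_mult_left_right_inverse[OF blockc blockc])
  \<comment> \<open>The first row of the last block row, which is zero in \<open>block Y'\<close>
    because \<open>s - 1 \<ge> g\<close>.\<close>
  define a where "a = (s - 1) * d"
  have a: "a < s * d" "a div d = s - 1" using gs d by (auto simp: a_def)
  have "(block Y' * block X') $$ (a, a) = 0"
  proof -
    have "\<not> a div d < g" using a(2) gs by linarith
    then show ?thesis using a(1) d by (simp add: block_def scalar_prod_def Y'_def \<rho>0)
  qed
  then show False using YX a(1) by simp
qed

end

section \<open>Split direct limits\<close>

text \<open>Module elements are to have type \<open>nat \<Rightarrow> 'a\<close>, so a sequence of
  vectors is stored flat through the pairing function; \<open>slot w m\<close> is its component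
  \<open>m\<close>.\<close>

definition slot :: "(nat \<Rightarrow> 'a) \<Rightarrow> nat \<Rightarrow> nat \<Rightarrow> 'a" where
  "slot w m j = w (prod_encode (m, j))"

definition unslot :: "(nat \<Rightarrow> nat \<Rightarrow> 'a) \<Rightarrow> nat \<Rightarrow> 'a" where
  "unslot y k = (case prod_decode k of (m, j) \<Rightarrow> y m j)"

lemma slot_unslot [simp]: "slot (unslot y) = y"
  by (simp add: slot_def unslot_def fun_eq_iff)

lemma unslot_slot [simp]: "unslot (slot w) = w"
proof
  fix k
  obtain m j where "prod_decode k = (m, j)" by (cases "prod_decode k")
  then show "unslot (slot w) k = w k"
    unfolding slot_def unslot_def by (metis case_prod_conv prod_decode_inverse)
qed

lemma unslot_map: "unslot (\<lambda>m j. h (y m j)) = (\<lambda>k. h (unslot y k))"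
  by (auto simp: unslot_def fun_eq_iff split: prod.split)

lemma unslot_map2: "unslot (\<lambda>m j. h (y m j) (z m j)) = (\<lambda>k. h (unslot y k) (unslot z k))"
  by (auto simp: unslot_def fun_eq_iff split: prod.split)

text \<open>The maps \<open>A m\<close> stand for a sequence \<open>F\<^sub>0 \<rightarrow> F\<^sub>1 \<rightarrow> F\<^sub>2 \<rightarrow> \<dots>\<close> of maps of free modules, with
  \<open>F\<^sub>m\<close> embedded in the module of all sequences.  The factorisation \<open>C m \<circ> A (m + 1) \<circ> A m = A m\<close>
  makes the direct limit projective.  Since the maps \<open>F\<^sub>n \<rightarrow> F\<^sub>m\<^sub>+\<^sub>1\<close> given by
  \<open>A m \<circ> \<dots> \<circ> A n\<close> for \<open>n \<le> m\<close> and by \<open>C m \<circ> \<dots> \<circ> C (n - 1) \<circ> A n\<close> for \<open>m < n\<close> are compatible,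
  they embed the limit in a product, with the image described by \<open>thread\<close>; \<open>U n\<close> is the map
  from \<open>F\<^sub>n\<close> to the limit.\<close>

locale split_telescope =
  fixes A C :: "nat \<Rightarrow> (nat \<Rightarrow> 'a::ring_1) \<Rightarrow> nat \<Rightarrow> 'a"
  assumes A_add: "A m (\<lambda>i. x i + y i) = (\<lambda>i. A m x i + A m y i)"
    and A_smult: "A m (\<lambda>i. x i * r) = (\<lambda>i. A m x i * r)"
    and C_add: "C m (\<lambda>i. x i + y i) = (\<lambda>i. C m x i + C m y i)"
    and C_smult: "C m (\<lambda>i. x i * r) = (\<lambda>i. C m x i * r)"
    and finite_A: "finite {i. A m x i \<noteq> 0}"
    and finite_C: "finite {i. C m x i \<noteq> 0}"
    and C_A_A: "C m (A (Suc m) (A m x)) = A m x"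
begin

definition thread :: "(nat \<Rightarrow> nat \<Rightarrow> 'a) \<Rightarrow> bool" where
  "thread y \<longleftrightarrow> (\<forall>m. y m = C m (y (Suc m))) \<and> (\<exists>n. \<forall>m\<ge>n. y (Suc m) = A (Suc m) (y m))"

primrec ascend :: "nat \<Rightarrow> (nat \<Rightarrow> 'a) \<Rightarrow> nat \<Rightarrow> nat \<Rightarrow> 'a" where
  "ascend n z 0 = A n z"
| "ascend n z (Suc k) = A (n + Suc k) (ascend n z k)"

primrec descend :: "nat \<Rightarrow> (nat \<Rightarrow> 'a) \<Rightarrow> nat \<Rightarrow> nat \<Rightarrow> 'a" where
  "descend n z 0 = A n z"
| "descend n z (Suc k) = C (n - Suc k) (descend n z k)"

definition U :: "nat \<Rightarrow> (nat \<Rightarrow> 'a) \<Rightarrow> nat \<Rightarrow> nat \<Rightarrow> 'a" where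
  "U n z m = (if n \<le> m then ascend n z (m - n) else descend n z (n - m))"

lemma U_self: "U n z n = A n z"
  by (simp add: U_def)

lemma U_Suc: "n \<le> m \<Longrightarrow> U n z (Suc m) = A (Suc m) (U n z m)"
  by (simp add: U_def Suc_diff_le)

text \<open>For \<open>n \<le> m\<close> the component \<open>U n z m\<close> is a value of
  \<open>A m\<close>, on which \<open>C m \<circ> A (Suc m)\<close> is the identity; below
  \<open>n\<close> the components are defined by applying \<open>C\<close>.\<close>

lemma U_C: "U n z m = C m (U n z (Suc m))"
proof (cases "n \<le> m")
  case True
  then obtain k where k: "m = n + k" using le_Suc_ex by blast
  have "\<exists>x. ascend n z k = A (n + k) x" by (cases k) auto
  then have "\<exists>x. U n z m = A m x" unfolding U_def k by simp
  then show ?thesis using True by (auto simp: U_Suc C_A_A)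
next
  case False
  then obtain k where k: "n = m + Suc k" using less_iff_Suc_add[of m n] by auto
  have "U n z m = C m (descend n z k)" by (simp add: U_def k)
  also have "descend n z k = U n z (Suc m)" by (cases k) (auto simp: U_def k)
  finally show ?thesis .
qed

lemma thread_U: "thread (U n z)"
  unfolding thread_def using U_C U_Suc by blast

text \<open>Each component is determined by the next one through \<open>C\<close>, so agreement of
  the tails propagates downwards.\<close>

lemma thread_eqI:
  assumes "\<And>m. y m = C m (y (Suc m))" "\<And>m. y' m = C m (y' (Suc m))"
    and eq: "\<And>m. n \<le> m \<Longrightarrow> y m = y' m"
  shows "y = y'"
proof -
  have "y m = y' m" if "k \<le> n" "n - k \<le> m" for k m
    using that
  proof (induction k arbitrary: m)
    case 0
    then show ?case using eq by simp
  next
    case (Suc k)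
    then have "y (Suc m) = y' (Suc m)" by simp
    then show ?case using assms(1,2)[of m] by simp
  qed
  from this[of n] show ?thesis by auto
qed

text \<open>Compatibility of the maps into the limit with the transitions. By
  \<open>thread_eqI\<close> it is enough to compare components from \<open>Suc n\<close> on, where
  both are iterated images under \<open>A\<close>.\<close>

lemma U_step: "U (Suc n) (A n z) = U n z"
proof (rule thread_eqI[OF U_C U_C])
  fix m assume "Suc n \<le> m"
  then show "U (Suc n) (A n z) m = U n z m"
    by (induction m rule: dec_induct) (simp_all add: U_self U_Suc)
qed

text \<open>Every element of the limit comes from a finite stage. The index is \<open>Suc n\<close>
  because component \<open>n\<close> of a thread lives in \<open>F (n + 1)\<close>.\<close>

lemma thread_eq_U:
  assumes y: "thread y" and n: "\<And>m. n \<le> m \<Longrightarrow> y (Suc m) = A (Suc m) (y m)"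
  shows "y = U (Suc n) (y n)"
proof (rule thread_eqI[where n = "Suc n"])
  show "y m = C m (y (Suc m))" for m using y unfolding thread_def by blast
  show "U (Suc n) (y n) m = C m (U (Suc n) (y n) (Suc m))" for m by (rule U_C)
  fix m assume "Suc n \<le> m"
  then show "y m = U (Suc n) (y n) m"
    by (induction m rule: dec_induct) (simp_all add: U_self U_Suc n)
qed

lemma U_add: "U n (\<lambda>i. x i + y i) = (\<lambda>m i. U n x m i + U n y m i)"
proof -
  have "ascend n (\<lambda>i. x i + y i) k = (\<lambda>i. ascend n x k i + ascend n y k i)" for k
    by (induction k) (simp_all add: A_add)
  moreover have "descend n (\<lambda>i. x i + y i) k = (\<lambda>i. descend n x k i + descend n y k i)" for k
    by (induction k) (simp_all add: A_add C_add)
  ultimately show ?thesis by (auto simp: U_def fun_eq_iff)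
qed

lemma U_smult: "U n (\<lambda>i. x i * r) = (\<lambda>m i. U n x m i * r)"
proof -
  have "ascend n (\<lambda>i. x i * r) k = (\<lambda>i. ascend n x k i * r)" for k
    by (induction k) (simp_all add: A_smult)
  moreover have "descend n (\<lambda>i. x i * r) k = (\<lambda>i. descend n x k i * r)" for k
    by (induction k) (simp_all add: A_smult C_smult)
  ultimately show ?thesis by (auto simp: U_def fun_eq_iff)
qed

lemma U_zero: "U n (\<lambda>_. 0) = (\<lambda>_ _. 0)"
  using U_smult[of n "\<lambda>_. 0" 0] by simp

text \<open>Only the pointwise operations of \<open>free_module\<close> are kept; the new carrier
  imposes no finite support.\<close>

definition limit_module :: "('a, nat \<Rightarrow> 'a) module" where
  "limit_module = (free_module UNIV)\<lparr>carrier := {w. thread (slot w)}\<rparr>"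

lemma limit_module_simps:
  "w \<in> carrier limit_module \<longleftrightarrow> thread (slot w)"
  "\<zero>\<^bsub>limit_module\<^esub> = (\<lambda>_. 0)"
  "w \<oplus>\<^bsub>limit_module\<^esub> v = (\<lambda>i. w i + v i)"
  "r \<odot>\<^bsub>limit_module\<^esub> w = (\<lambda>i. w i * r)"
  by (simp_all add: limit_module_def free_module_def)

lemma slot_add: "slot (\<lambda>i. w i + v i) m = (\<lambda>j. slot w m j + slot v m j)"
  by (simp add: slot_def fun_eq_iff)

lemma slot_smult: "slot (\<lambda>i. w i * r) m = (\<lambda>j. slot w m j * r)"
  by (simp add: slot_def fun_eq_iff)

lemma thread_add:
  assumes "thread (slot w)" "thread (slot v)"
  shows "thread (slot (\<lambda>i. w i + v i))"
proof -
  obtain n n' where "\<forall>m\<ge>n. slot w (Suc m) = A (Suc m) (slot w m)"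
    "\<forall>m\<ge>n'. slot v (Suc m) = A (Suc m) (slot v m)"
    using assms unfolding thread_def by blast
  then have "\<forall>m\<ge>max n n'. slot (\<lambda>i. w i + v i) (Suc m) = A (Suc m) (slot (\<lambda>i. w i + v i) m)"
    by (simp add: slot_add A_add)
  moreover have "slot (\<lambda>i. w i + v i) m = C m (slot (\<lambda>i. w i + v i) (Suc m))" for m
    unfolding slot_add C_add using assms[unfolded thread_def] by metis
  ultimately show ?thesis unfolding thread_def by blast
qed

lemma thread_smult:
  assumes "thread (slot w)"
  shows "thread (slot (\<lambda>i. w i * r))"
proof -
  obtain n where "\<forall>m\<ge>n. slot w (Suc m) = A (Suc m) (slot w m)"
    using assms unfolding thread_def by blast
  then have "\<forall>m\<ge>n. slot (\<lambda>i. w i * r) (Suc m) = A (Suc m) (slot (\<lambda>i. w i * r) m)"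
    by (simp add: slot_smult A_smult)
  moreover have "slot (\<lambda>i. w i * r) m = C m (slot (\<lambda>i. w i * r) (Suc m))" for m
    unfolding slot_smult C_smult using assms[unfolded thread_def] by metis
  ultimately show ?thesis unfolding thread_def by blast
qed

lemma limit_right_module: "right_module limit_module"
proof -
  have "thread (slot (\<lambda>_. 0))"
  proof -
    have "slot (\<lambda>_. 0) = U 0 (\<lambda>_. 0)" by (simp add: U_zero slot_def fun_eq_iff)
    then show ?thesis using thread_U[of 0 "\<lambda>_. 0"] by simp
  qed
  then have "abelian_group limit_module"
  proof (intro abelian_groupI; unfold limit_module_simps)
    fix w assume w: "thread (slot w)"
    show "\<exists>v\<in>carrier limit_module. (\<lambda>i. v i + w i) = (\<lambda>_. 0)"
      using thread_smult[OF w, of "- 1"]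
      by (intro bexI[of _ "\<lambda>i. w i * (- 1)"]) (auto simp: limit_module_simps)
  qed (auto simp: thread_add ac_simps)
  then show ?thesis
    unfolding right_module_def right_module_axioms_def
    by (auto simp: limit_module_simps thread_smult algebra_simps)
qed

definition u :: "nat \<Rightarrow> (nat \<Rightarrow> 'a) \<Rightarrow> nat \<Rightarrow> 'a" where
  "u n z = unslot (U n z)"

lemma u_closed: "u n z \<in> carrier limit_module"
  by (simp add: limit_module_simps u_def thread_U)

lemma u_add: "u n (\<lambda>i. x i + y i) = u n x \<oplus>\<^bsub>limit_module\<^esub> u n y"
  by (simp add: u_def U_add limit_module_simps unslot_map2[of "(+)"])

lemma u_smult: "u n (\<lambda>i. x i * r) = r \<odot>\<^bsub>limit_module\<^esub> u n x"
  by (simp add: u_def U_smult limit_module_simps unslot_map[of "\<lambda>a. a * r"])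

lemma u_step: "u (Suc n) (A n z) = u n z"
  by (simp add: u_def U_step)

lemma slot_u: "slot (u n z) n = A n z"
  by (simp add: u_def U_self)

lemma limit_module_elem:
  assumes "w \<in> carrier limit_module"
  shows "\<exists>n. \<forall>m\<ge>n. w = u (Suc m) (slot w m)"
proof -
  have w: "thread (slot w)" using assms by (simp add: limit_module_simps)
  then obtain n where n: "\<forall>m\<ge>n. slot w (Suc m) = A (Suc m) (slot w m)"
    unfolding thread_def by blast
  have "w = u (Suc m) (slot w m)" if "m \<ge> n" for m
  proof -
    have "slot w = U (Suc m) (slot w m)"
      by (rule thread_eq_U[OF w]) (use n that in auto)
    then have "unslot (slot w) = u (Suc m) (slot w m)" by (simp add: u_def)
    then show ?thesis by simp
  qed
  then show ?thesis by blast
qed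

text \<open>Writing \<open>y = U (n + 1) (y n)\<close> for large \<open>n\<close> as a telescoping sum of \<open>U (n + 1) (z n)\<close>,
  where \<open>z = defect y\<close>, splits the projection of the direct sum of the \<open>F\<^sub>n\<close> onto the limit.\<close>

definition defect :: "(nat \<Rightarrow> nat \<Rightarrow> 'a) \<Rightarrow> nat \<Rightarrow> nat \<Rightarrow> 'a" where
  "defect y n j = (case n of 0 \<Rightarrow> y 0 j | Suc m \<Rightarrow> y (Suc m) j - A (Suc m) (y m) j)"

text \<open>Elements of the free module have only finitely many nonzero \<open>z n\<close>, so the
  sum is finite where it matters; over an infinite index set it defaults to
  \<open>0\<close>.\<close>

definition assemble :: "(nat \<Rightarrow> nat \<Rightarrow> 'a) \<Rightarrow> nat \<Rightarrow> nat \<Rightarrow> 'a" where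
  "assemble z m j = (\<Sum>n | z n \<noteq> (\<lambda>_. 0). U (Suc n) (z n) m j)"

lemma assemble_eq:
  assumes "finite S" "{n. z n \<noteq> (\<lambda>_. 0)} \<subseteq> S"
  shows "assemble z m j = (\<Sum>n\<in>S. U (Suc n) (z n) m j)"
  unfolding assemble_def by (rule sum.mono_neutral_left) (use assms in \<open>auto simp: U_zero\<close>)

lemma U_diff: "U n (\<lambda>i. x i - y i) = (\<lambda>m i. U n x m i - U n y m i)"
  using U_add[of n "\<lambda>i. x i - y i" y] by (simp add: fun_eq_iff)

text \<open>By \<open>U_step\<close> the subtracted part of \<open>defect y (Suc N)\<close>
  contributes \<open>U (Suc N) (y N)\<close>, which is the partial sum before it.\<close>

lemma sum_defect: "(\<Sum>n\<le>N. U (Suc n) (defect y n) m j) = U (Suc N) (y N) m j"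
proof (induction N)
  case 0
  have "defect y 0 = y 0" by (simp add: defect_def fun_eq_iff)
  then show ?case by simp
next
  case (Suc N)
  have "defect y (Suc N) = (\<lambda>i. y (Suc N) i - A (Suc N) (y N) i)"
    by (simp add: defect_def fun_eq_iff)
  then show ?case using Suc by (simp add: U_diff U_step)
qed

lemma finite_support_slots:
  assumes "finite {k. w k \<noteq> 0}"
  shows "finite {n. slot w n \<noteq> (\<lambda>_. 0)}"
proof (rule finite_subset)
  show "{n. slot w n \<noteq> (\<lambda>_. 0)} \<subseteq> (\<lambda>k. fst (prod_decode k)) ` {k. w k \<noteq> 0}"
    by (force simp: slot_def fun_eq_iff)
  show "finite ((\<lambda>k. fst (prod_decode k)) ` {k. w k \<noteq> 0})" using assms by simp
qed

lemma thread_sum: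
  assumes "finite S"
  shows "thread (slot (unslot (\<lambda>m j. \<Sum>n\<in>S. U (Suc n) (z n) m j)))"
  using assms
proof induction
  case empty
  have "(\<lambda>m j. \<Sum>n\<in>{}. U (Suc n) (z n) m j) = U 0 (\<lambda>_. 0)" by (simp add: U_zero)
  then show ?case by (simp only: slot_unslot thread_U)
next
  case (insert k S)
  have "unslot (\<lambda>m j. \<Sum>n\<in>insert k S. U (Suc n) (z n) m j) =
    (\<lambda>i. unslot (U (Suc k) (z k)) i + unslot (\<lambda>m j. \<Sum>n\<in>S. U (Suc n) (z n) m j) i)"
    using insert.hyps by (simp add: unslot_map2[of "(+)"])
  then show ?case
    using thread_add[of "unslot (U (Suc k) (z k))"] insert.IH thread_U by simp
qed

lemma limit_module_retract:
  defines "\<sigma> \<equiv> \<lambda>w. unslot (defect (slot w))" and "\<pi> \<equiv> \<lambda>z. unslot (assemble (slot z))"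
  shows "\<sigma> \<in> module_hom limit_module (free_module (UNIV :: nat set))"
    and "\<pi> \<in> module_hom (free_module (UNIV :: nat set)) limit_module"
    and "w \<in> carrier limit_module \<Longrightarrow> \<pi> (\<sigma> w) = w"
proof -
  \<comment> \<open>From the index where a thread starts to follow \<open>A\<close>, all defects are
    zero. The same index describes the thread as an image under \<open>U\<close>, which is what
    inverts \<open>\<sigma>\<close> below.\<close>
  have vanish: "\<exists>n. {k. defect (slot w) k \<noteq> (\<lambda>_. 0)} \<subseteq> {..n} \<and> slot w = U (Suc n) (slot w n)"
    if w: "thread (slot w)" for w
  proof -
    obtain n where n: "\<forall>m\<ge>n. slot w (Suc m) = A (Suc m) (slot w m)"
      using w unfolding thread_def by blast
    have *: "defect (slot w) k = (\<lambda>_. 0)" if "k > n" for k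
    proof -
      obtain m where "k = Suc m" "n \<le> m" using \<open>k > n\<close> by (cases k) auto
      then show ?thesis using n[rule_format, of m] by (simp add: defect_def fun_eq_iff)
    qed
    have "{k. defect (slot w) k \<noteq> (\<lambda>_. 0)} \<subseteq> {..n}"
      using * not_le_imp_less by blast
    moreover have "slot w = U (Suc n) (slot w n)"
      by (rule thread_eq_U[OF w]) (use n in auto)
    ultimately show ?thesis by blast
  qed
  \<comment> \<open>Each component of a thread is a value of \<open>C\<close>, hence finitely
    supported.\<close>
  have fin_slot: "finite {j. slot w m j \<noteq> 0}" if "thread (slot w)" for w m
  proof -
    have eq: "slot w m = C m (slot w (Suc m))" using that unfolding thread_def by blast
    show ?thesis by (subst eq) (rule finite_C)
  qed
  have fin_defect: "finite {j. defect (slot w) m j \<noteq> 0}" if w: "thread (slot w)" for w m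
  proof (cases m)
    case 0
    then show ?thesis using fin_slot[OF w, of 0] by (simp add: defect_def)
  next
    case (Suc k)
    have "{j. defect (slot w) m j \<noteq> 0} \<subseteq> {j. slot w m j \<noteq> 0} \<union> {j. A m (slot w k) j \<noteq> 0}"
      by (auto simp: defect_def Suc)
    then show ?thesis
      by (rule finite_subset) (use fin_slot[OF w, of m] finite_A[of m "slot w k"] in simp)
  qed
  have "\<sigma> w \<in> carrier (free_module UNIV)" if w: "thread (slot w)" for w
  proof -
    obtain n where n: "{k. defect (slot w) k \<noteq> (\<lambda>_. 0)} \<subseteq> {..n}" using vanish[OF w] by blast
    have "{k. \<sigma> w k \<noteq> 0} \<subseteq> prod_encode ` (SIGMA m:{..n}. {j. defect (slot w) m j \<noteq> 0})"
    proof
      fix k assume k: "k \<in> {k. \<sigma> w k \<noteq> 0}"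
      obtain m j where mj: "prod_decode k = (m, j)" by (cases "prod_decode k")
      then have nz: "defect (slot w) m j \<noteq> 0" using k by (simp add: \<sigma>_def unslot_def)
      then have "defect (slot w) m \<noteq> (\<lambda>_. 0)" by auto
      then have "m \<in> {..n}" using n by blast
      moreover have "k = prod_encode (m, j)" unfolding mj[symmetric] by simp
      ultimately show "k \<in> prod_encode ` (SIGMA m:{..n}. {j. defect (slot w) m j \<noteq> 0})"
        using nz by blast
    qed
    moreover have "finite (prod_encode ` (SIGMA m:{..n}. {j. defect (slot w) m j \<noteq> 0}))"
      by (intro finite_imageI finite_SigmaI fin_defect[OF w]) simp
    ultimately have "finite {k. \<sigma> w k \<noteq> 0}" by (rule finite_subset)
    then show ?thesis by (simp add: free_module_simps)
  qed
  moreover have "\<sigma> (\<lambda>i. w i + v i) = (\<lambda>i. \<sigma> w i + \<sigma> v i)" for w v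
  proof -
    have "defect (slot (\<lambda>i. w i + v i)) = (\<lambda>m j. defect (slot w) m j + defect (slot v) m j)"
      by (auto simp: defect_def slot_add A_add fun_eq_iff split: nat.split)
    then show ?thesis by (simp add: \<sigma>_def unslot_map2[of "(+)"])
  qed
  moreover have "\<sigma> (\<lambda>i. w i * r) = (\<lambda>i. \<sigma> w i * r)" for w r
  proof -
    have "defect (slot (\<lambda>i. w i * r)) = (\<lambda>m j. defect (slot w) m j * r)"
      by (auto simp: defect_def slot_smult A_smult fun_eq_iff algebra_simps split: nat.split)
    then show ?thesis by (simp add: \<sigma>_def unslot_map[of "\<lambda>a. a * r"])
  qed
  ultimately show "\<sigma> \<in> module_hom limit_module (free_module UNIV)"
    by (auto simp: module_hom_def limit_module_simps free_module_simps(3,4))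
  have \<pi>_eq: "\<pi> z = unslot (\<lambda>m j. \<Sum>n\<in>S. U (Suc n) (slot z n) m j)"
    if "finite S" "{n. slot z n \<noteq> (\<lambda>_. 0)} \<subseteq> S" for z S
  proof -
    have "assemble (slot z) = (\<lambda>m j. \<Sum>n\<in>S. U (Suc n) (slot z n) m j)"
      by (intro ext assemble_eq[OF that])
    then show ?thesis by (simp add: \<pi>_def)
  qed
  have supp: "finite {n. slot z n \<noteq> (\<lambda>_. 0)}" if "z \<in> carrier (free_module UNIV)" for z :: "nat \<Rightarrow> 'a"
    using that by (intro finite_support_slots) (simp add: free_module_simps)
  have "thread (slot (\<pi> z))" if "z \<in> carrier (free_module UNIV)" for z
    unfolding \<pi>_eq[OF supp[OF that] order_refl] by (rule thread_sum[OF supp[OF that]])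
  moreover have "\<pi> (\<lambda>i. z i + x i) = (\<lambda>i. \<pi> z i + \<pi> x i)"
    if zx: "z \<in> carrier (free_module UNIV)" "x \<in> carrier (free_module UNIV)" for z x
  proof -
    \<comment> \<open>A common index set, so that the three sums can be compared termwise.\<close>
    define S where "S = {n. slot z n \<noteq> (\<lambda>_. 0)} \<union> {n. slot x n \<noteq> (\<lambda>_. 0)}"
    have S: "finite S" unfolding S_def using supp zx by blast
    have sub: "{n. slot (\<lambda>i. z i + x i) n \<noteq> (\<lambda>_. 0)} \<subseteq> S"
      "{n. slot z n \<noteq> (\<lambda>_. 0)} \<subseteq> S" "{n. slot x n \<noteq> (\<lambda>_. 0)} \<subseteq> S"
      by (auto simp: S_def slot_add)
    show ?thesis
      unfolding \<pi>_eq[OF S sub(1)] \<pi>_eq[OF S sub(2)] \<pi>_eq[OF S sub(3)]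
      by (simp add: slot_add U_add sum.distrib unslot_map2[of "(+)", symmetric])
  qed
  moreover have "\<pi> (\<lambda>i. z i * r) = (\<lambda>i. \<pi> z i * r)"
    if z: "z \<in> carrier (free_module UNIV)" for z r
  proof -
    have sub: "{n. slot (\<lambda>i. z i * r) n \<noteq> (\<lambda>_. 0)} \<subseteq> {n. slot z n \<noteq> (\<lambda>_. 0)}"
      by (auto simp: slot_smult)
    show ?thesis
      unfolding \<pi>_eq[OF supp[OF z] sub] \<pi>_eq[OF supp[OF z] order_refl]
      by (simp add: slot_smult U_smult sum_distrib_right[symmetric] unslot_map[of "\<lambda>a. a * r", symmetric])
  qed
  ultimately show "\<pi> \<in> module_hom (free_module UNIV) limit_module"
    by (auto simp: module_hom_def limit_module_simps free_module_simps(3,4))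
  show "\<pi> (\<sigma> w) = w" if "w \<in> carrier limit_module"
  proof -
    have w: "thread (slot w)" using that by (simp add: limit_module_simps)
    obtain n where n: "{k. defect (slot w) k \<noteq> (\<lambda>_. 0)} \<subseteq> {..n}" "slot w = U (Suc n) (slot w n)"
      using vanish[OF w] by blast
    have "\<pi> (\<sigma> w) = unslot (\<lambda>m j. \<Sum>k\<le>n. U (Suc k) (slot (\<sigma> w) k) m j)"
      by (rule \<pi>_eq) (use n(1) in \<open>simp_all add: \<sigma>_def\<close>)
    also have "\<dots> = unslot (U (Suc n) (slot w n))"
      by (simp add: \<sigma>_def sum_defect)
    also have "\<dots> = w" unfolding n(2)[symmetric] by simp
    finally show ?thesis .
  qed
qed

lemma limit_module_projective: "projective_module limit_module"
proof -
  \<comment> \<open>Unit vectors embed the basis index type \<open>nat\<close> into the element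
    type, as \<open>projective_moduleI\<close> demands.\<close>
  have "inj (\<lambda>n i :: nat. if i = n then 1 else (0 :: 'a))"
  proof (rule injI)
    fix m n :: nat
    assume "(\<lambda>i. if i = m then 1 else (0 :: 'a)) = (\<lambda>i. if i = n then 1 else 0)"
    from fun_cong[OF this, of m] show "m = n" by (simp split: if_split_asm)
  qed
  from projective_moduleI[OF limit_right_module this limit_module_retract(1,2)]
  show ?thesis using limit_module_retract(3) by blast
qed

lemma limit_module_countably_generated: "countably_generated limit_module"
proof (rule countably_generatedI[OF limit_right_module limit_module_retract(2)])
  fix w assume w: "w \<in> carrier limit_module"
  show "\<exists>f\<in>carrier (free_module UNIV). unslot (assemble (slot f)) = w"
    using module_homD(1)[OF limit_module_retract(1) w] limit_module_retract(3)[OF w] by blast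
qed

end

section \<open>The projective modules\<close>

lemma left_hull_coefficients:
  fixes v :: "'i \<Rightarrow> 'a::ring_1"
  assumes "finite L" "x \<in> left_ideal hull (v ` L)"
  shows "\<exists>g. x = (\<Sum>l\<in>L. g l * v l)"
proof -
  have "left_ideal hull (v ` L) \<subseteq> {x. \<exists>g. x = (\<Sum>l\<in>L. g l * v l)}"
  proof (rule hull_minimal)
    show "v ` L \<subseteq> {x. \<exists>g. x = (\<Sum>l\<in>L. g l * v l)}"
    proof
      fix x assume "x \<in> v ` L"
      then obtain k where k: "k \<in> L" "x = v k" by blast
      have "x = (\<Sum>l\<in>L. (if l = k then 1 else 0) * v l)"
        using k assms(1) by (simp add: if_distrib[of "\<lambda>z. z * _"] cong: if_cong)
      then show "x \<in> {x. \<exists>g. x = (\<Sum>l\<in>L. g l * v l)}"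
        by (intro CollectI exI[of _ "\<lambda>l. if l = k then 1 else 0"])
    qed
    show "left_ideal {x. \<exists>g. x = (\<Sum>l\<in>L. g l * v l)}"
      unfolding left_ideal_def
    proof (intro conjI ballI allI; clarsimp)
      show "\<exists>g. (\<Sum>l\<in>L. g l * v l) = 0" by (intro exI[of _ "\<lambda>_. 0"]) simp
    next
      fix g g'
      show "\<exists>ga. (\<Sum>l\<in>L. g l * v l) + (\<Sum>l\<in>L. g' l * v l) = (\<Sum>l\<in>L. ga l * v l)"
        by (intro exI[of _ "\<lambda>l. g l + g' l"]) (simp add: distrib_right sum.distrib)
    next
      fix r g
      show "\<exists>ga. r * (\<Sum>l\<in>L. g l * v l) = (\<Sum>l\<in>L. ga l * v l)"
        by (intro exI[of _ "\<lambda>l. r * g l"]) (simp add: sum_distrib_left mult.assoc)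
    qed
  qed
  then show ?thesis using assms(2) by blast
qed

text \<open>The coordinates of \<open>F\<^sub>m = R\<^bsup>s m\<^esup>\<close> are the \<open>l < s m\<close>.  A coordinate \<open>l\<close> with
  \<open>s m \<le> l < s (m + 1)\<close> is born at stage \<open>m + 1\<close>, as the image of the coordinate \<open>c l\<close> under
  multiplication by \<open>b l \<in> N (m + 1)\<close>; from then on it is preserved up to multiplication by
  \<open>e (m + 1) n\<close>, which is \<open>1\<close> modulo \<open>M i\<close> for \<open>m < i < n\<close> and \<open>0\<close> for \<open>i \<le> m\<close>.
  Hence modulo \<open>M i\<close> only the \<open>s i\<close> coordinates born up to stage \<open>i\<close> survive.\<close>

locale projective_data = noetherian_fcr scale
  for scale :: "'k::field \<Rightarrow> 'a::ring_1 \<Rightarrow> 'a" +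
  fixes N :: "nat \<Rightarrow> 'a set" and e :: "nat \<Rightarrow> nat \<Rightarrow> 'a"
    and s :: "nat \<Rightarrow> nat" and c :: "nat \<Rightarrow> nat" and b :: "nat \<Rightarrow> 'a"
  assumes N_cofinite: "cofinite_ideal (N n)" and N_Suc: "N (Suc n) \<subset> N n"
    and e_mem: "n < m \<Longrightarrow> e n m \<in> N n"
    and e_unit: "n < m \<Longrightarrow> x \<in> N n \<Longrightarrow> x * (1 - e n m) \<in> N m"
    and s_Suc: "s m < s (Suc m)"
    and c_less: "s m \<le> l \<Longrightarrow> l < s (Suc m) \<Longrightarrow> c l < s m"
    and b_mem: "s m \<le> l \<Longrightarrow> l < s (Suc m) \<Longrightarrow> b l \<in> N (Suc m)"
    and b_generate: "i < s m \<Longrightarrow>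
      N (Suc m) \<subseteq> left_ideal hull (b ` {l. s m \<le> l \<and> l < s (Suc m) \<and> c l = i})"
begin

lemma s_mono: "strict_mono s"
  using s_Suc by (simp add: strict_mono_Suc_iff)

lemma N_antimono: "m \<le> n \<Longrightarrow> N n \<subseteq> N m"
  by (rule lift_Suc_antimono_le[of N]) (use N_Suc in \<open>simp_all add: less_imp_le\<close>)

lemmas Nl = left_idealD[OF cofinite_idealD(3)[OF N_cofinite]]
lemmas Nr = right_idealD[OF cofinite_idealD(4)[OF N_cofinite]]

section \<open>The transition matrices and their factorisation\<close>

definition birth :: "nat \<Rightarrow> nat" where
  "birth l = (LEAST n. l < s n)"

lemma birth_le: "l < s m \<Longrightarrow> birth l \<le> m"
  unfolding birth_def by (rule Least_le)

lemma birth_gt: "s m \<le> l \<Longrightarrow> m < birth l"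
proof -
  assume l: "s m \<le> l"
  have "l < s (Suc l)" using strict_mono_imp_increasing[OF s_mono, of "Suc l"] by simp
  then have "l < s (birth l)" unfolding birth_def by (rule LeastI)
  then have "s m < s (birth l)" using l by simp
  then show ?thesis by (simp add: strict_mono_less[OF s_mono])
qed

text \<open>Row \<open>l\<close> of the matrix of \<open>A m\<close> has at most one nonzero entry:
  \<open>factor m l\<close> in column \<open>source m l\<close>.\<close>

definition source :: "nat \<Rightarrow> nat \<Rightarrow> nat" where
  "source m l = (if l < s m then l else c l)"

definition factor :: "nat \<Rightarrow> nat \<Rightarrow> 'a" where
  "factor m l = (if l < s m then e (birth l) (Suc m) else b l)"

lemma source_less: "l < s (Suc m) \<Longrightarrow> source m l < s m"
  using c_less by (auto simp: source_def)

lemma factor_mem: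
  assumes "l < s (Suc m)"
  shows "factor m l \<in> N (birth l)"
proof (cases "l < s m")
  case True
  then show ?thesis using e_mem birth_le[OF True] by (simp add: factor_def)
next
  case False
  then have "birth l = Suc m" using birth_le[OF assms] birth_gt[of m l] by simp
  then show ?thesis using b_mem[of m l] assms False by (simp add: factor_def)
qed

text \<open>Column \<open>j\<close> of \<open>A m\<close> contains
  \<open>e (birth j) (Suc m)\<close>, which accounts for the first term of
  \<open>x = x * e + x * (1 - e)\<close>. The second lies in \<open>N (Suc m)\<close> and is covered
  by the entries \<open>b l\<close> of the newly born rows.\<close>

lemma factor_generate:
  assumes j: "j < s m"
  shows "N (birth j) \<subseteq> left_ideal hull (factor m ` {l. l < s (Suc m) \<and> source m l = j})"
    (is "_ \<subseteq> ?H")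
proof
  fix x assume x: "x \<in> N (birth j)"
  note Hl = left_idealD[OF left_ideal_hull[of "factor m ` {l. l < s (Suc m) \<and> source m l = j}"]]
  have lt: "birth j < Suc m" using birth_le[OF j] by simp
  have "factor m j \<in> ?H"
    by (rule hull_inc, rule imageI) (use j s_Suc[of m] in \<open>auto simp: source_def\<close>)
  then have "x * e (birth j) (Suc m) \<in> ?H"
    using Hl(3) j by (simp add: factor_def)
  moreover have "x * (1 - e (birth j) (Suc m)) \<in> ?H"
  proof -
    have "b ` {l. s m \<le> l \<and> l < s (Suc m) \<and> c l = j} \<subseteq>
      factor m ` {l. l < s (Suc m) \<and> source m l = j}"
    proof
      fix y assume "y \<in> b ` {l. s m \<le> l \<and> l < s (Suc m) \<and> c l = j}"
      then obtain l where "y = b l" "s m \<le> l" "l < s (Suc m)" "c l = j" by blast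
      then have "y = factor m l" "l \<in> {l. l < s (Suc m) \<and> source m l = j}"
        by (auto simp: factor_def source_def)
      then show "y \<in> factor m ` {l. l < s (Suc m) \<and> source m l = j}" by blast
    qed
    then have "left_ideal hull (b ` {l. s m \<le> l \<and> l < s (Suc m) \<and> c l = j}) \<subseteq> ?H"
      by (rule hull_mono)
    then show ?thesis using b_generate[OF j] e_unit[OF lt x] by blast
  qed
  ultimately have "x * e (birth j) (Suc m) + x * (1 - e (birth j) (Suc m)) \<in> ?H"
    by (rule Hl(2))
  then show "x \<in> ?H" by (simp add: right_diff_distrib)
qed

text \<open>The rows of \<open>A (Suc m) \<circ> A m\<close> that read the same coordinate as row
  \<open>j\<close> of \<open>A m\<close>; only these can serve to recover that row.\<close>

definition preimages :: "nat \<Rightarrow> nat \<Rightarrow> nat set" where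
  "preimages m j = {l. l < s (Suc (Suc m)) \<and> source m (source (Suc m) l) = source m j}"

text \<open>This yields the matrix \<open>C m\<close>. By \<open>factor_generate\<close> at the next
  stage, \<open>N (birth k) * factor m k\<close> lies in the left ideal \<open>?H\<close> for every
  row \<open>k\<close> with the same source as \<open>j\<close>. Applied to new rows this puts
  \<open>N (Suc m)\<close> into \<open>?H\<close>; applied to \<open>j\<close> itself it handles an
  old row.\<close>

lemma factor_factorises:
  assumes j: "j < s (Suc m)"
  shows "factor m j \<in> left_ideal hull
    ((\<lambda>l. factor (Suc m) l * factor m (source (Suc m) l)) ` preimages m j)"
    (is "_ \<in> ?H")
proof -
  have H: "left_ideal ?H" by (rule left_ideal_hull)
  note Hl = left_idealD[OF H]
  have absorb: "x * factor m k \<in> ?H"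
    if k: "k < s (Suc m)" "source m k = source m j" and x: "x \<in> N (birth k)" for k x
  proof -
    have "left_ideal hull (factor (Suc m) ` {l. l < s (Suc (Suc m)) \<and> source (Suc m) l = k})
      \<subseteq> {x. x * factor m k \<in> ?H}"
    proof (rule hull_minimal)
      show "factor (Suc m) ` {l. l < s (Suc (Suc m)) \<and> source (Suc m) l = k}
        \<subseteq> {x. x * factor m k \<in> ?H}"
      proof clarify
        fix l assume l: "l < s (Suc (Suc m))" "k = source (Suc m) l"
        have "l \<in> preimages m j" using l k by (simp add: preimages_def)
        then show "factor (Suc m) l * factor m (source (Suc m) l) \<in> ?H"
          by (intro hull_inc) blast
      qed
      show "left_ideal {x. x * factor m k \<in> ?H}"
        by (subst left_ideal_def) (use Hl(1-3) in \<open>auto simp: distrib_right mult.assoc\<close>)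
    qed
    then show ?thesis using factor_generate[OF k(1)] x by blast
  qed
  \<comment> \<open>The entries \<open>b l\<close> of the new rows generate
    \<open>N (Suc m)\<close>, so \<open>?H\<close> contains all products of two elements of
    \<open>N (Suc m)\<close>; idempotence then gives \<open>N (Suc m)\<close> itself.\<close>
  have NH: "N (Suc m) \<subseteq> ?H"
  proof -
    have "left_ideal hull (b ` {l. s m \<le> l \<and> l < s (Suc m) \<and> c l = source m j})
      \<subseteq> {y. \<forall>x\<in>N (Suc m). x * y \<in> ?H}"
    proof (rule hull_minimal)
      show "b ` {l. s m \<le> l \<and> l < s (Suc m) \<and> c l = source m j} \<subseteq> {y. \<forall>x\<in>N (Suc m). x * y \<in> ?H}"
      proof clarify
        fix l x assume l: "s m \<le> l" "l < s (Suc m)" "c l = source m j" and x: "x \<in> N (Suc m)"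
        have "birth l = Suc m" using birth_le[OF l(2)] birth_gt[OF l(1)] by simp
        moreover have "source m l = source m j" "factor m l = b l"
          using l by (auto simp: source_def factor_def)
        ultimately show "x * b l \<in> ?H" using absorb[of l x] l(2) x by simp
      qed
      show "left_ideal {y. \<forall>x\<in>N (Suc m). x * y \<in> ?H}"
        by (subst left_ideal_def)
          (use Hl(1,2) Nr(3) in \<open>auto simp: distrib_left mult.assoc[symmetric]\<close>)
    qed
    then have prod: "x * y \<in> ?H" if "x \<in> N (Suc m)" "y \<in> N (Suc m)" for x y
      using b_generate[OF source_less[OF j]] that by blast
    have "left_ideal hull {x * y |x y. x \<in> N (Suc m) \<and> y \<in> N (Suc m)} \<subseteq> ?H"
      by (rule hull_minimal) (use prod H in blast)+
    then show ?thesis using cofinite_ideal_idempotent[OF N_cofinite[of "Suc m"]] by blast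
  qed
  show ?thesis
  proof (cases "j < s m")
    case True
    define f where "f = factor m j"
    have f: "f = e (birth j) (Suc m)" "f \<in> N (birth j)"
      using True factor_mem[OF j] by (auto simp: f_def factor_def)
    \<comment> \<open>For an old row the entry splits as \<open>f = f * f + f * (1 - f)\<close>,
      with the second term in \<open>N (Suc m)\<close>.\<close>
    have "f * f \<in> ?H" using absorb[OF j refl f(2)] by (simp add: f_def)
    moreover have "f * (1 - f) \<in> ?H"
      using e_unit[of "birth j" "Suc m" f] f birth_le[OF True] NH by auto
    ultimately have "f * f + f * (1 - f) \<in> ?H" by (rule Hl(2))
    then show ?thesis by (simp add: right_diff_distrib f_def)
  next
    case False
    then have "factor m j \<in> N (Suc m)" using b_mem[of m j] j by (simp add: factor_def)
    then show ?thesis using NH by blast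
  qed
qed

text \<open>The entries of \<open>C m\<close>, chosen row by row so that
  \<open>C m \<circ> A (Suc m) \<circ> A m = A m\<close>.\<close>

definition coef :: "nat \<Rightarrow> nat \<Rightarrow> nat \<Rightarrow> 'a" where
  "coef m j = (SOME g. factor m j =
     (\<Sum>l\<in>preimages m j. g l * (factor (Suc m) l * factor m (source (Suc m) l))))"

lemma coef:
  assumes "j < s (Suc m)"
  shows "factor m j = (\<Sum>l\<in>preimages m j. coef m j l * (factor (Suc m) l * factor m (source (Suc m) l)))"
proof -
  have "finite (preimages m j)" by (simp add: preimages_def)
  from left_hull_coefficients[OF this factor_factorises[OF assms]]
  show ?thesis unfolding coef_def by (rule someI_ex)
qed

definition A :: "nat \<Rightarrow> (nat \<Rightarrow> 'a) \<Rightarrow> nat \<Rightarrow> 'a" where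
  "A m x l = (if l < s (Suc m) then factor m l * x (source m l) else 0)"

definition C :: "nat \<Rightarrow> (nat \<Rightarrow> 'a) \<Rightarrow> nat \<Rightarrow> 'a" where
  "C m y j = (if j < s (Suc m) then \<Sum>l\<in>preimages m j. coef m j l * y l else 0)"

sublocale split_telescope A C
proof
  fix m :: nat and x y :: "nat \<Rightarrow> 'a" and r :: 'a
  show "A m (\<lambda>i. x i + y i) = (\<lambda>i. A m x i + A m y i)" "A m (\<lambda>i. x i * r) = (\<lambda>i. A m x i * r)"
    by (auto simp: A_def fun_eq_iff distrib_left mult.assoc)
  show "C m (\<lambda>i. x i + y i) = (\<lambda>i. C m x i + C m y i)" "C m (\<lambda>i. x i * r) = (\<lambda>i. C m x i * r)"
    by (auto simp: C_def fun_eq_iff distrib_left mult.assoc sum.distrib sum_distrib_right)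
  show "finite {i. A m x i \<noteq> 0}" "finite {i. C m x i \<noteq> 0}"
    by (rule finite_subset[of _ "{..<s (Suc m)}"]; auto simp: A_def C_def split: if_splits)+
  show "C m (A (Suc m) (A m x)) = A m x"
  proof
    fix j
    show "C m (A (Suc m) (A m x)) j = A m x j"
    proof (cases "j < s (Suc m)")
      case True
      have "C m (A (Suc m) (A m x)) j =
        (\<Sum>l\<in>preimages m j. coef m j l * (factor (Suc m) l * factor m (source (Suc m) l)) * x (source m j))"
        using True source_less[of _ "Suc m"]
        by (auto simp: C_def A_def preimages_def mult.assoc intro!: sum.cong)
      also have "\<dots> = factor m j * x (source m j)"
        unfolding sum_distrib_right[symmetric] coef[OF True, symmetric] ..
      finally show ?thesis using True by (simp add: A_def)
    qed (simp add: C_def A_def)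
  qed
qed

sublocale P: right_module limit_module
  by (rule limit_right_module)

section \<open>The module modulo \<open>N 0\<close> and modulo the ideals \<open>M i\<close>\<close>

definition E :: "nat \<Rightarrow> nat \<Rightarrow> 'a" where
  "E k i = (if i = k then 1 else 0)"

text \<open>Although \<open>z\<close> is an arbitrary sequence, \<open>u n\<close> factors through
  \<open>A n\<close>, which reads only the first \<open>s n\<close> coordinates. What remains is a
  finite combination of the \<open>u n (E k)\<close>.\<close>

lemma u_in_submodule:
  assumes H: "right_submodule limit_module H"
    and z: "\<And>k. k < s n \<Longrightarrow> z k \<odot>\<^bsub>limit_module\<^esub> u n (E k) \<in> H"
  shows "u n z \<in> H"
proof -
  have "u n (\<lambda>i. if i < k then z i else 0) \<in> H" if "k \<le> s n" for k
    using that
  proof (induction k)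
    case 0
    have "u n (\<lambda>_. 0) = \<zero>\<^bsub>limit_module\<^esub>"
      using u_smult[of n "\<lambda>_. 0" 0] by (simp add: P.smult_zero_scalar u_closed)
    then show ?case using right_submoduleD(2)[OF H] by simp
  next
    case (Suc k)
    have "(\<lambda>i. if i < Suc k then z i else 0) = (\<lambda>i. (if i < k then z i else 0) + E k i * z k)"
      by (auto simp: fun_eq_iff E_def less_Suc_eq)
    then show ?case
      using Suc right_submoduleD(3)[OF H] z[of k] by (simp add: u_add u_smult)
  qed
  moreover have "u n z = u n (\<lambda>i. if i < s n then z i else 0)"
  proof -
    have "A n z = A n (\<lambda>i. if i < s n then z i else 0)"
      using source_less by (auto simp: A_def fun_eq_iff)
    then show ?thesis by (metis u_step)
  qed
  ultimately show ?thesis by simp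
qed

lemma times_first_ideal: "module_times_ideal limit_module (N 0) = carrier limit_module"
proof
  show "module_times_ideal limit_module (N 0) \<subseteq> carrier limit_module"
    by (rule right_submoduleD(1)[OF P.times_ideal_submodule])
  show "carrier limit_module \<subseteq> module_times_ideal limit_module (N 0)"
  proof
    fix w assume "w \<in> carrier limit_module"
    then obtain n where "w = u (Suc n) (slot w n)" using limit_module_elem by blast
    \<comment> \<open>One further transition turns the coordinates into left multiples by factors,
      and these belong to \<open>N 0\<close>.\<close>
    then have w: "w = u (Suc (Suc n)) (A (Suc n) (slot w n))" by (simp add: u_step)
    have "A (Suc n) z k \<in> N 0" for z k
      using factor_mem[of k "Suc n"] N_antimono[of 0 "birth k"] Nr(1,3) by (auto simp: A_def)
    then show "w \<in> module_times_ideal limit_module (N 0)"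
      by (subst w) (intro u_in_submodule P.times_ideal_submodule P.times_ideal_mem u_closed)
  qed
qed

definition M :: "nat \<Rightarrow> 'a set" where
  "M i = {r. \<forall>x\<in>N i. x * r \<in> N (Suc i)}"

lemma N_subset_M: "i < n \<Longrightarrow> N n \<subseteq> M i"
  using N_antimono[of "Suc i" n] Nl(3) by (auto simp: M_def)

lemma M_cofinite: "cofinite_ideal (M i)"
proof -
  have "two_sided_ideal (M i)"
    unfolding two_sided_ideal_def left_ideal_def right_ideal_def M_def
    using Nl(1,2) Nr(3) by (auto simp: distrib_left mult.assoc[symmetric])
  moreover have "finite_codim scale (M i)"
    using finite_codim_mono[OF cofinite_idealD(2)[OF N_cofinite[of "Suc i"]]] N_subset_M by blast
  ultimately show ?thesis by (simp add: cofinite_ideal_def)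
qed

lemmas Ml = left_idealD[OF cofinite_idealD(3)[OF M_cofinite]]
lemmas Mr = right_idealD[OF cofinite_idealD(4)[OF M_cofinite]]

lemma one_notin_M: "1 \<notin> M i"
  using N_Suc[of i] by (auto simp: M_def)

text \<open>For \<open>x \<in> N i \<subseteq> N n\<close> the element
  \<open>x * (1 - e n m)\<close> lies in \<open>N m \<subseteq> N (Suc i)\<close>.\<close>

lemma e_minus_one: "n \<le> i \<Longrightarrow> i < m \<Longrightarrow> e n m - 1 \<in> M i"
proof -
  assume *: "n \<le> i" "i < m"
  have "1 - e n m \<in> M i"
    using e_unit[of n m] * N_antimono[of n i] N_antimono[of "Suc i" m] by (auto simp: M_def)
  then show ?thesis using Ml(4) by fastforce
qed

text \<open>Modulo \<open>M i\<close> the module is free with the \<open>s i\<close> generators \<open>u i (E k)\<close>.\<close>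

lemma generated_mod_M: "generated_mod limit_module (M i) (s i)"
proof -
  let ?PM = "module_times_ideal limit_module (M i)"
  define H where "H = right_submodule limit_module hull ((\<lambda>k. u i (E k)) ` {..<s i} \<union> ?PM)"
  have H: "right_submodule limit_module H"
    unfolding H_def using right_submoduleD(1)[OF P.times_ideal_submodule] u_closed
    by (intro P.right_submodule_hull) auto
  note Hd = right_submoduleD[OF H]
  have PMH: "?PM \<subseteq> H" and uH: "\<And>k. k < s i \<Longrightarrow> u i (E k) \<in> H"
    unfolding H_def by (auto intro: hull_inc)
  have PM: "u n z \<in> ?PM" if "\<And>k. k < s n \<Longrightarrow> z k \<in> M i" for n z
    using that by (intro u_in_submodule P.times_ideal_submodule P.times_ideal_mem u_closed) auto
  have factorM: "factor m l \<in> M i" if "l < s (Suc m)" "s i \<le> l" for m l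
    using factor_mem[OF that(1)] N_subset_M[OF birth_gt[OF that(2)]] by blast
  \<comment> \<open>Rows reading a coordinate \<open>k \<ge> s i\<close> have index at least
    \<open>s i\<close> themselves, so their factors lie in \<open>M i\<close>; a single transition
    moves such a generator into \<open>PM i\<close>.\<close>
  have new: "u m (E k) \<in> ?PM" if "i \<le> m" "s i \<le> k" for m k
  proof -
    have "A m (E k) l \<in> M i" if "l < s (Suc m)" for l
    proof (cases "source m l = k")
      case True
      have "s i \<le> l"
        using True \<open>s i \<le> k\<close> strict_mono_leD[OF s_mono \<open>i \<le> m\<close>]
        by (auto simp: source_def split: if_splits)
      then show ?thesis using factorM[OF that] that True by (simp add: A_def E_def)
    next
      case False
      then show ?thesis using Ml(1) by (simp add: A_def E_def)
    qed
    then have "u (Suc m) (A m (E k)) \<in> ?PM" by (intro PM) auto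
    then show ?thesis by (simp add: u_step)
  qed
  have old: "u m (E k) \<in> H" if "i \<le> m" "k < s i" for m k
    using \<open>i \<le> m\<close>
  proof (induction m rule: dec_induct)
    case base
    show ?case by (rule uH[OF that(2)])
  next
    case (step m)
    \<comment> \<open>The error made by replacing the image of \<open>E k\<close> under
      \<open>A m\<close> by \<open>E k\<close>. Its entry at \<open>k\<close> is
      \<open>e (birth k) (Suc m) - 1\<close> and the other nonzero ones are entries
      \<open>b l\<close> of new rows, all in \<open>M i\<close>. Hence \<open>u m (E k)\<close> and
      \<open>u (Suc m) (E k)\<close> agree modulo \<open>PM i\<close>.\<close>
    define z where "z = (\<lambda>l. A m (E k) l - E k l)"
    have km: "k < s m" "k < s (Suc m)"
      using that(2) strict_mono_leD[OF s_mono step(1)] s_Suc[of m] by auto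
    have "z l \<in> M i" if l: "l < s (Suc m)" for l
    proof (cases "l = k")
      case True
      then show ?thesis
        using km l e_minus_one[of "birth k" i "Suc m"] birth_le[OF \<open>k < s i\<close>] step(1)
        by (simp add: z_def A_def E_def source_def factor_def)
    next
      case False
      show ?thesis
      proof (cases "source m l = k")
        case True
        then have "s m \<le> l" using False by (auto simp: source_def split: if_splits)
        then have "s i \<le> l" using strict_mono_leD[OF s_mono step(1)] by simp
        then show ?thesis using factorM[OF l] l True False by (simp add: z_def A_def E_def)
      next
        case f: False
        then show ?thesis using False Ml(1) by (simp add: z_def A_def E_def)
      qed
    qed
    then have q: "u (Suc m) z \<in> H" using PM[of "Suc m" z] PMH by blast
    have "u m (E k) = u (Suc m) (\<lambda>l. E k l + z l)"
      unfolding u_step[of m, symmetric] by (simp add: z_def)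
    also have "\<dots> = u (Suc m) (E k) \<oplus>\<^bsub>limit_module\<^esub> u (Suc m) z"
      by (rule u_add)
    finally have "u (Suc m) (E k) = u m (E k) \<oplus>\<^bsub>limit_module\<^esub> \<ominus>\<^bsub>limit_module\<^esub> u (Suc m) z"
      by (simp add: u_closed P.a_assoc P.r_neg)
    then show ?case using Hd(3)[OF step.IH P.right_submodule_minus[OF H q]] by simp
  qed
  have "carrier limit_module \<subseteq> H"
  proof
    fix w assume "w \<in> carrier limit_module"
    then obtain n where n: "\<forall>m\<ge>n. w = u (Suc m) (slot w m)" using limit_module_elem by blast
    define m where "m = max n i"
    have w: "w = u (Suc m) (slot w m)" by (rule n[rule_format]) (simp add: m_def)
    have *: "u (Suc m) (E k) \<in> H" for k
      using new[of "Suc m" k] old[of "Suc m" k] PMH by (cases "k < s i") (auto simp: m_def)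
    then show "w \<in> H"
      by (subst w) (rule u_in_submodule[OF H], rule Hd(4)[OF *])
  qed
  then have "H = carrier limit_module" using Hd(1) by blast
  then show ?thesis
    unfolding generated_mod_def H_def by (intro exI[of _ "\<lambda>k. u i (E k)"]) (simp add: u_closed)
qed

text \<open>Reading the first \<open>s i\<close> coordinates of component \<open>i\<close> modulo
  \<open>M i\<close> maps \<open>P\<close> homomorphically to \<open>s i\<close> copies of
  \<open>R / M i\<close> and sends \<open>u i (E l)\<close>, \<open>l < s i\<close>, to unit
  vectors. Generators \<open>q j\<close> thus give an \<open>s i \<times> g\<close> matrix with a
  right inverse modulo \<open>M i\<close>.\<close>

lemma generated_mod_M_ge:
  assumes "generated_mod limit_module (M i) g"
  shows "s i \<le> g"
proof -
  obtain q where q: "\<forall>j<g. q j \<in> carrier limit_module"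
    "right_submodule limit_module hull (q ` {..<g} \<union> module_times_ideal limit_module (M i)) =
      carrier limit_module"
    using assms unfolding generated_mod_def by blast
  \<comment> \<open>Component \<open>i\<close> has \<open>s (Suc i)\<close> coordinates, but only
    those below \<open>s i\<close> are compared: there the transition \<open>A i\<close> is
    diagonal.\<close>
  define comb where "comb y k = (\<Sum>j<g. slot (q j) i k * y j)" for y k
  define T where "T = {w \<in> carrier limit_module. \<exists>y. \<forall>k<s i. comb y k - slot w i k \<in> M i}"
  have comb_add: "comb (\<lambda>j. y j + y' j) k = comb y k + comb y' k"
    and comb_smult: "comb (\<lambda>j. y j * r) k = comb y k * r" for y y' k r
    by (simp_all add: comb_def distrib_left sum.distrib sum_distrib_right mult.assoc)
  have comb_0: "comb (\<lambda>_. 0) k = 0" for k by (simp add: comb_def)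
  have T: "right_submodule limit_module T"
    unfolding right_submodule_def
  proof (intro conjI ballI allI)
    show "T \<subseteq> carrier limit_module" by (auto simp: T_def)
    show "\<zero>\<^bsub>limit_module\<^esub> \<in> T"
      unfolding T_def using Ml(1)
      by (intro CollectI conjI P.zero_closed exI[of _ "\<lambda>_. 0"])
        (simp add: comb_0 limit_module_simps slot_def)
  next
    fix w v assume "w \<in> T" "v \<in> T"
    then obtain y y' where wv: "w \<in> carrier limit_module" "v \<in> carrier limit_module"
      and y: "\<forall>k<s i. comb y k - slot w i k \<in> M i" and y': "\<forall>k<s i. comb y' k - slot v i k \<in> M i"
      unfolding T_def by blast
    have "comb (\<lambda>j. y j + y' j) k - slot (w \<oplus>\<^bsub>limit_module\<^esub> v) i k \<in> M i" if "k < s i" for k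
    proof -
      have "comb (\<lambda>j. y j + y' j) k - slot (w \<oplus>\<^bsub>limit_module\<^esub> v) i k =
        (comb y k - slot w i k) + (comb y' k - slot v i k)"
        by (simp add: comb_add limit_module_simps slot_add)
      then show ?thesis using y y' that Ml(2) by simp
    qed
    then show "w \<oplus>\<^bsub>limit_module\<^esub> v \<in> T"
      unfolding T_def using wv by (intro CollectI conjI P.a_closed) blast+
  next
    fix r w assume "w \<in> T"
    then obtain y where w: "w \<in> carrier limit_module" and y: "\<forall>k<s i. comb y k - slot w i k \<in> M i"
      unfolding T_def by blast
    have "comb (\<lambda>j. y j * r) k - slot (r \<odot>\<^bsub>limit_module\<^esub> w) i k \<in> M i" if "k < s i" for k
    proof -
      have "comb (\<lambda>j. y j * r) k - slot (r \<odot>\<^bsub>limit_module\<^esub> w) i k = (comb y k - slot w i k) * r"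
        by (simp add: comb_smult limit_module_simps slot_smult left_diff_distrib)
      then show ?thesis using y that Mr(3) by simp
    qed
    then show "r \<odot>\<^bsub>limit_module\<^esub> w \<in> T"
      unfolding T_def using w by (intro CollectI conjI P.smult_closed) blast+
  qed
  have "module_times_ideal limit_module (M i) \<subseteq> T"
  proof (rule P.times_ideal_minimal[OF T])
    fix w r assume w: "w \<in> carrier limit_module" and r: "r \<in> M i"
    have "comb (\<lambda>_. 0) k - slot (r \<odot>\<^bsub>limit_module\<^esub> w) i k \<in> M i" for k
      using Ml(4)[OF Ml(3)[OF r]] by (simp add: comb_0 limit_module_simps slot_smult)
    then show "r \<odot>\<^bsub>limit_module\<^esub> w \<in> T"
      unfolding T_def using w by (intro CollectI conjI P.smult_closed) blast+
  qed
  moreover have "q ` {..<g} \<subseteq> T"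
  proof clarify
    fix j assume "j < g"
    then have "comb (\<lambda>l. if l = j then 1 else 0) k = slot (q j) i k" for k
      by (simp add: comb_def if_distrib[of "\<lambda>z. _ * z"] cong: if_cong)
    then show "q j \<in> T"
      unfolding T_def using q(1) \<open>j < g\<close> Ml(1)
      by (intro CollectI conjI exI[of _ "\<lambda>l. if l = j then 1 else 0"]) auto
  qed
  ultimately have "right_submodule limit_module hull
      (q ` {..<g} \<union> module_times_ideal limit_module (M i)) \<subseteq> T"
    by (intro hull_minimal T) blast
  then have "u i (E l) \<in> T" for l using q(2) u_closed by blast
  then have "\<forall>l. \<exists>y. \<forall>k<s i. comb y k - A i (E l) k \<in> M i"
    unfolding T_def by (simp add: slot_u)
  from choice[OF this] obtain Y where Y: "\<And>l k. k < s i \<Longrightarrow> comb (Y l) k - A i (E l) k \<in> M i"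
    by blast
  show ?thesis
  proof (rule rank_le_modulo_ideal[OF cofinite_idealD(1,2)[OF M_cofinite] one_notin_M])
    fix k l assume k: "k < s i"
    \<comment> \<open>The diagonal entry is \<open>e (birth k) (Suc i)\<close> with
      \<open>birth k \<le> i\<close>, which is \<open>1\<close> modulo \<open>M i\<close>.\<close>
    have "A i (E l) k - (if k = l then 1 else 0) \<in> M i"
      using k s_Suc[of i] e_minus_one[of "birth k" i "Suc i"] birth_le[OF k] Ml(1)
      by (auto simp: A_def E_def source_def factor_def)
    from Ml(2)[OF Y[OF k, of l] this]
    show "(\<Sum>j<g. slot (q j) i k * Y l j) - (if k = l then 1 else 0) \<in> M i"
      by (simp add: comb_def)
  qed
qed

lemma limit_module_not_fair_sized: "\<not> fair_sized limit_module"
proof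
  assume "fair_sized limit_module"
  then obtain I where I: "I \<in> fg_quotient_ideals limit_module"
    and min: "\<And>J. J \<in> fg_quotient_ideals limit_module \<Longrightarrow> J \<subseteq> I \<Longrightarrow> J = I"
    unfolding fair_sized_def by blast
  have "right_ideal I"
    using I two_sided_idealD(2) by (auto simp: P.fg_quotient_ideals_iff)
  then obtain B where B: "finite B" "B \<subseteq> I" "right_ideal hull B = I"
    using noetherian_finitely_generated(2)[OF noetherian] by blast
  have "I \<subseteq> M i" for i
  proof -
    obtain p where "\<forall>k<s i. p k \<in> carrier limit_module"
      "right_submodule limit_module hull (p ` {..<s i} \<union> module_times_ideal limit_module (M i)) =
        carrier limit_module"
      using generated_mod_M[of i] unfolding generated_mod_def by blast
    then have "M i \<in> fg_quotient_ideals limit_module"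
      unfolding P.fg_quotient_ideals_iff
      using cofinite_idealD(1)[OF M_cofinite[of i]]
      by (intro conjI exI[of _ "p ` {..<s i}"]) auto
    then have "M i \<inter> I \<in> fg_quotient_ideals limit_module"
      by (rule P.fg_quotient_ideals_Int[OF I _ B])
    then show ?thesis using min[of "M i \<inter> I"] by blast
  qed
  obtain G where G: "finite G" "G \<subseteq> carrier limit_module"
    "right_submodule limit_module hull (G \<union> module_times_ideal limit_module I) = carrier limit_module"
    using I unfolding P.fg_quotient_ideals_iff by blast
  obtain q where "bij_betw q {0..<card G} G" using ex_bij_betw_nat_finite[OF G(1)] by blast
  then have q: "q ` {..<card G} = G" by (simp add: bij_betw_imp_surj_on lessThan_atLeast0)
  have "generated_mod limit_module (M i) (card G)" for i
    unfolding generated_mod_def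
  proof (intro exI conjI allI impI)
    show "q j \<in> carrier limit_module" if "j < card G" for j
    proof -
      have "q j \<in> q ` {..<card G}" using that by simp
      then show ?thesis using G(2) unfolding q by blast
    qed
    have "carrier limit_module \<subseteq>
      right_submodule limit_module hull (G \<union> module_times_ideal limit_module (M i))"
      unfolding G(3)[symmetric]
      by (rule hull_mono) (use P.times_ideal_mono[OF \<open>I \<subseteq> M i\<close>] in blast)
    moreover have "right_submodule limit_module hull (G \<union> module_times_ideal limit_module (M i))
      \<subseteq> carrier limit_module"
      using G(2) right_submoduleD(1)[OF P.times_ideal_submodule] by (intro P.hull_le_carrier) blast
    ultimately show "right_submodule limit_module hull
      (q ` {..<card G} \<union> module_times_ideal limit_module (M i)) = carrier limit_module"
      unfolding q by blast
  qed
  \<comment> \<open>A strictly increasing \<open>s\<close> satisfies \<open>n \<le> s n\<close>, so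
    this index exceeds the bound \<open>card G\<close>.\<close>
  then have "s (Suc (card G)) \<le> card G" using generated_mod_M_ge by blast
  moreover have "Suc (card G) \<le> s (Suc (card G))" by (rule strict_mono_imp_increasing[OF s_mono])
  ultimately show False by simp
qed

lemma trace_ideal_limit_module: "trace_ideal limit_module \<subseteq> N 0"
  by (rule P.trace_ideal_subset[OF cofinite_idealD(1)[OF N_cofinite] times_first_ideal])

end

section \<open>Uncountably many isomorphism classes\<close>

text \<open>The ideals \<open>M i\<close> are spelled out in terms of \<open>N\<close>, so that
  modules built from different sequences \<open>s\<close> over the same chain can be
  compared.\<close>

lemma (in projective_data) projective_not_fair_sized:
  "\<exists>P :: ('a, nat \<Rightarrow> 'a) module. right_module P \<and> countably_generated P \<and> projective_module P \<and>
     \<not> fair_sized P \<and> trace_ideal P \<subseteq> N 0 \<and>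
     (\<forall>i. generated_mod P {r. \<forall>x\<in>N i. x * r \<in> N (Suc i)} (s i) \<and>
       (\<forall>g. generated_mod P {r. \<forall>x\<in>N i. x * r \<in> N (Suc i)} g \<longrightarrow> s i \<le> g))"
  using limit_right_module limit_module_countably_generated limit_module_projective
    limit_module_not_fair_sized trace_ideal_limit_module generated_mod_M generated_mod_M_ge
  unfolding M_def by (intro exI[of _ limit_module]) simp

context noetherian_fcr
begin

text \<open>Each of the \<open>s m\<close> old coordinates needs one new coordinate for each of the
  \<open>t (Suc m)\<close> generators of \<open>N (Suc m)\<close>, whence the bound
  \<open>s m * Suc (t (Suc m))\<close>. Strictness makes \<open>s\<close> increase even when there
  are no generators.\<close>

lemma projective_data_exists:
  assumes N: "\<And>n. cofinite_ideal (N n)" "\<And>n. N (Suc n) \<subset> N n"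
    and e: "\<And>n m. n < m \<Longrightarrow> e n m \<in> N n"
      "\<And>n m x. n < m \<Longrightarrow> x \<in> N n \<Longrightarrow> x * (1 - e n m) \<in> N m"
    and gen: "\<And>n. left_ideal hull (gen n ` {..<t n}) = N n"
    and s: "\<And>m. s m * Suc (t (Suc m)) < s (Suc m)" and s_pos: "0 < s 0"
  shows "\<exists>c b. projective_data scale N e s c b"
proof -
  have s_Suc: "s m < s (Suc m)" for m
  proof -
    have "s m \<le> s m * Suc (t (Suc m))" by simp
    then show ?thesis using s[of m] by linarith
  qed
  then have mono: "strict_mono s" by (simp add: strict_mono_Suc_iff)
  define stage where "stage l = (LEAST n. l < s n) - 1" for l
  have stage: "stage l = m" if "s m \<le> l" "l < s (Suc m)" for l m
  proof -
    have "(LEAST n. l < s n) = Suc m"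
    proof (rule Least_equality)
      show "l < s (Suc m)" by (rule that(2))
      fix n assume "l < s n"
      then have "s m < s n" using that(1) by simp
      then show "Suc m \<le> n" by (simp add: strict_mono_less[OF mono])
    qed
    then show ?thesis by (simp add: stage_def)
  qed
  \<comment> \<open>New coordinates are numbered \<open>l = s m + k * s m + i\<close>: such an
    \<open>l\<close> descends from \<open>i = c l\<close> and carries generator number
    \<open>k = q l\<close>.\<close>
  define q where "q l = (l - s (stage l)) div s (stage l)" for l
  define c where "c l = (l - s (stage l)) mod s (stage l)" for l
  \<comment> \<open>Surplus coordinates carry \<open>0\<close>, which lies in every ideal; this
    leaves \<open>s\<close> free to grow faster.\<close>
  define b where "b l = (if q l < t (Suc (stage l)) then gen (Suc (stage l)) (q l) else 0)" for l
  have genN: "gen n k \<in> N n" if "k < t n" for n k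
    unfolding gen[of n, symmetric] by (rule hull_inc) (use that in simp)
  have "projective_data scale N e s c b"
  proof
    fix m l assume l: "s m \<le> l" "l < s (Suc m)"
    show "b l \<in> N (Suc m)"
      using genN left_idealD(1)[OF cofinite_idealD(3)[OF N(1)]] by (auto simp: b_def stage[OF l])
    have "0 < s m" using s_pos strict_mono_less_eq[OF mono, of 0 m] by simp
    then show "c l < s m" by (simp add: c_def stage[OF l])
  next
    fix i m assume i: "i < s m"
    have "gen (Suc m) ` {..<t (Suc m)} \<subseteq> b ` {l. s m \<le> l \<and> l < s (Suc m) \<and> c l = i}"
    proof clarify
      fix k assume k: "k < t (Suc m)"
      define l where "l = s m + (k * s m + i)"
      have "k * s m + i < Suc k * s m" using i by simp
      also have "\<dots> \<le> t (Suc m) * s m" using k by (intro mult_le_mono1) simp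
      finally have "l < s m * Suc (t (Suc m))" by (simp add: l_def mult.commute)
      then have l: "s m \<le> l" "l < s (Suc m)" using s[of m] by (auto simp: l_def)
      have "q l = k" "c l = i" using i by (simp_all add: q_def c_def stage[OF l]) (simp_all add: l_def)
      then show "gen (Suc m) k \<in> b ` {l. s m \<le> l \<and> l < s (Suc m) \<and> c l = i}"
        using l k by (intro image_eqI[of _ _ l]) (simp_all add: b_def stage[OF l])
    qed
    then have "left_ideal hull (gen (Suc m) ` {..<t (Suc m)}) \<subseteq>
      left_ideal hull (b ` {l. s m \<le> l \<and> l < s (Suc m) \<and> c l = i})"
      by (rule hull_mono)
    then show "N (Suc m) \<subseteq> left_ideal hull (b ` {l. s m \<le> l \<and> l < s (Suc m) \<and> c l = i})"
      unfolding gen .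
  qed (use N e s_Suc in auto)
  then show ?thesis by blast
qed

end

lemma module_isomorphic_sym:
  assumes P: "right_module P" and iso: "module_isomorphic P Q"
  shows "module_isomorphic Q P"
proof -
  interpret P: right_module P by fact
  obtain f where f: "f \<in> module_hom P Q" "bij_betw f (carrier P) (carrier Q)"
    using iso unfolding module_isomorphic_def by blast
  define g where "g = inv_into (carrier P) f"
  have g: "bij_betw g (carrier Q) (carrier P)"
    unfolding g_def by (rule bij_betw_inv_into[OF f(2)])
  have gc: "g x \<in> carrier P" and fg: "f (g x) = x" if "x \<in> carrier Q" for x
    using that bij_betwE[OF g] bij_betw_inv_into_right[OF f(2)] by (auto simp: g_def)
  have gf: "g (f x) = x" if "x \<in> carrier P" for x
    using that bij_betw_inv_into_left[OF f(2)] by (simp add: g_def)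
  have "g \<in> module_hom Q P"
    unfolding module_hom_def
  proof (intro CollectI conjI ballI allI)
    show "g \<in> carrier Q \<rightarrow> carrier P" using gc by blast
    fix x assume x: "x \<in> carrier Q"
    show "g (x \<oplus>\<^bsub>Q\<^esub> y) = g x \<oplus>\<^bsub>P\<^esub> g y" if y: "y \<in> carrier Q" for y
      using gf[of "g x \<oplus>\<^bsub>P\<^esub> g y"] module_homD(2)[OF f(1) gc[OF x] gc[OF y]] fg[OF x] fg[OF y]
        P.a_closed[OF gc[OF x] gc[OF y]] by simp
    show "g (r \<odot>\<^bsub>Q\<^esub> x) = r \<odot>\<^bsub>P\<^esub> g x" for r
      using gf[of "r \<odot>\<^bsub>P\<^esub> g x"] module_homD(3)[OF f(1) gc[OF x]] fg[OF x]
        P.smult_closed[OF gc[OF x]] by simp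
  qed
  with g show ?thesis unfolding module_isomorphic_def by blast
qed

lemma generated_mod_isomorphic:
  fixes P Q :: "('a::ring_1, 'm) module"
  assumes "right_module P" "right_module Q" "module_isomorphic P Q"
  shows "generated_mod P I g \<longleftrightarrow> generated_mod Q I g"
proof -
  have *: "generated_mod Q I g"
    if P: "right_module P" and Q: "right_module Q" and iso: "module_isomorphic P Q"
      and gen: "generated_mod P I g"
    for P Q :: "('a, 'm) module"
  proof -
    obtain f where "f \<in> module_hom P Q" "bij_betw f (carrier P) (carrier Q)"
      using iso unfolding module_isomorphic_def by blast
    then show ?thesis
      using generated_mod_surjective[OF P Q] gen by (simp add: bij_betw_imp_surj_on)
  qed
  show ?thesis
    using *[of P Q] *[of Q P] module_isomorphic_sym[of P Q] assms by blast
qed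

lemma uncountable_nat_bool: "uncountable (UNIV :: (nat \<Rightarrow> bool) set)"
proof
  assume "countable (UNIV :: (nat \<Rightarrow> bool) set)"
  then obtain h :: "nat \<Rightarrow> nat \<Rightarrow> bool" where "range h = UNIV"
    by (metis UNIV_not_empty uncountable_def)
  then obtain n where "h n = (\<lambda>k. \<not> h k k)" by (metis rangeE UNIV_I)
  then show False by (metis (full_types))
qed

theorem theorem7p3:
  fixes scale :: "'k::field \<Rightarrow> 'a::ring_1 \<Rightarrow> 'a"
    and I0 :: "'a set"
  assumes "fcr_algebra scale"
    and "indecomposable_ring_type TYPE('a)"
    and "\<not> finite_dim scale"
    and "noetherian_ring_type TYPE('a)"
    and "two_sided_ideal I0"
    and "finite_codim scale I0"
  shows "\<exists>S :: ('a, nat \<Rightarrow> 'a) module set.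
           uncountable S \<and>
           (\<forall>P\<in>S. right_module P \<and> countably_generated P \<and> projective_module P \<and>
                  \<not> fair_sized P \<and> trace_ideal P \<subseteq> I0) \<and>
           (\<forall>P\<in>S. \<forall>Q\<in>S. P \<noteq> Q \<longrightarrow> \<not> module_isomorphic P Q)"
proof -
  have "k_algebra scale" using assms(1) by (simp add: fcr_algebra_def)
  then interpret noetherian_fcr scale
    using assms(1,4) by (simp add: noetherian_fcr_def noetherian_fcr_axioms_def)
  have "cofinite_ideal I0" using assms(5,6) by (simp add: cofinite_ideal_def)
  from cofinite_ideal_chain[OF this assms(3)]
  obtain N where N0: "N 0 = I0" and N': "\<forall>n. cofinite_ideal (N n) \<and> N (Suc n) \<subset> N n" by blast
  then have N: "\<And>n. cofinite_ideal (N n)" "\<And>n. N (Suc n) \<subset> N n" by auto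
  have N_antimono: "N m \<subseteq> N n" if "n \<le> m" for n m
    by (rule lift_Suc_antimono_le[of N]) (use N(2) that in \<open>simp_all add: less_imp_le\<close>)
  have "\<forall>n m. \<exists>x. n < m \<longrightarrow> x \<in> N n \<and> (\<forall>y\<in>N n. y * (1 - x) \<in> N m)"
  proof (intro allI)
    fix n m
    show "\<exists>x. n < m \<longrightarrow> x \<in> N n \<and> (\<forall>y\<in>N n. y * (1 - x) \<in> N m)"
    proof (cases "n < m")
      case True
      then show ?thesis
        using cofinite_ideal_unit[OF N(1)[of n] N(1)[of m] N_antimono[of n m]] by auto
    qed simp
  qed
  then obtain e where e: "\<forall>n m. n < m \<longrightarrow> e n m \<in> N n \<and> (\<forall>y\<in>N n. y * (1 - e n m) \<in> N m)"
    by metis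
  \<comment> \<open>A pair, so that a single choice gives the generators together with their
    number.\<close>
  have "\<exists>gt :: (nat \<Rightarrow> 'a) \<times> nat. left_ideal hull (fst gt ` {..<snd gt}) = N n" for n
  proof -
    obtain B where B: "finite B" "left_ideal hull B = N n"
      using noetherian_finitely_generated(1)[OF noetherian cofinite_idealD(3)[OF N(1)]] by blast
    obtain h where "bij_betw h {0..<card B} B" using ex_bij_betw_nat_finite[OF B(1)] by blast
    then have "h ` {..<card B} = B" by (simp add: bij_betw_imp_surj_on lessThan_atLeast0)
    then show ?thesis using B(2) by (intro exI[of _ "(h, card B)"]) simp
  qed
  then obtain gt :: "nat \<Rightarrow> (nat \<Rightarrow> 'a) \<times> nat"
    where gt: "\<And>n. left_ideal hull (fst (gt n) ` {..<snd (gt n)}) = N n" by metis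
  define gen t where "gen n = fst (gt n)" and "t n = snd (gt n)" for n
  \<comment> \<open>An increment of \<open>1\<close> or \<open>2\<close> beyond the required size
    encodes the bit \<open>\<alpha> m\<close>, so distinct binary sequences give distinct sequences
    of ranks.\<close>
  define s where "s \<alpha> = rec_nat 1 (\<lambda>m k. k * Suc (t (Suc m)) + (if \<alpha> m then 1 else 2))" for \<alpha>
  have s_Suc: "s \<alpha> (Suc m) = s \<alpha> m * Suc (t (Suc m)) + (if \<alpha> m then 1 else 2)" for \<alpha> m
    by (simp add: s_def)
  have s_inj: "\<alpha> = \<beta>" if "s \<alpha> = s \<beta>" for \<alpha> \<beta>
  proof
    fix m
    show "\<alpha> m = \<beta> m"
      using s_Suc[of \<alpha> m] s_Suc[of \<beta> m] that by (simp split: if_splits)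
  qed
  \<comment> \<open>These ideals do not depend on \<open>\<alpha>\<close>, so the ranks modulo them
    distinguish the modules.\<close>
  let ?M = "\<lambda>i. {r. \<forall>x\<in>N i. x * r \<in> N (Suc i)}"
  have "\<exists>P :: ('a, nat \<Rightarrow> 'a) module. right_module P \<and> countably_generated P \<and> projective_module P \<and>
     \<not> fair_sized P \<and> trace_ideal P \<subseteq> I0 \<and>
     (\<forall>i. generated_mod P (?M i) (s \<alpha> i) \<and> (\<forall>g. generated_mod P (?M i) g \<longrightarrow> s \<alpha> i \<le> g))" for \<alpha>
  proof -
    have "\<exists>c b. projective_data scale N e (s \<alpha>) c b"
      by (rule projective_data_exists[where gen = gen and t = t and N = N and e = e and s = "s \<alpha>"])
        (use N e gt in \<open>simp_all add: gen_def t_def s_Suc, simp_all add: s_def\<close>)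
    then obtain c b where "projective_data scale N e (s \<alpha>) c b" by blast
    from projective_data.projective_not_fair_sized[OF this] show ?thesis unfolding N0 .
  qed
  then have "\<forall>\<alpha>. \<exists>P :: ('a, nat \<Rightarrow> 'a) module. right_module P \<and> countably_generated P \<and>
     projective_module P \<and> \<not> fair_sized P \<and> trace_ideal P \<subseteq> I0 \<and>
     (\<forall>i. generated_mod P (?M i) (s \<alpha> i) \<and> (\<forall>g. generated_mod P (?M i) g \<longrightarrow> s \<alpha> i \<le> g))"
    by blast
  from choice[OF this] obtain P :: "(nat \<Rightarrow> bool) \<Rightarrow> ('a, nat \<Rightarrow> 'a) module"
    where P: "\<forall>\<alpha>. right_module (P \<alpha>) \<and> countably_generated (P \<alpha>) \<and> projective_module (P \<alpha>) \<and>
     \<not> fair_sized (P \<alpha>) \<and> trace_ideal (P \<alpha>) \<subseteq> I0 \<and>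
     (\<forall>i. generated_mod (P \<alpha>) (?M i) (s \<alpha> i) \<and>
       (\<forall>g. generated_mod (P \<alpha>) (?M i) g \<longrightarrow> s \<alpha> i \<le> g))" ..
  have iso: "\<alpha> = \<beta>" if "module_isomorphic (P \<alpha>) (P \<beta>)" for \<alpha> \<beta>
  proof (rule s_inj, rule ext)
    fix i
    have eq: "generated_mod (P \<alpha>) (?M i) g \<longleftrightarrow> generated_mod (P \<beta>) (?M i) g" for g
      by (rule generated_mod_isomorphic[OF _ _ that]) (use P in blast)+
    show "s \<alpha> i = s \<beta> i"
    proof (rule antisym)
      show "s \<alpha> i \<le> s \<beta> i" using P[rule_format, of \<alpha>] P[rule_format, of \<beta>] eq[of "s \<beta> i"] by simp
      show "s \<beta> i \<le> s \<alpha> i" using P[rule_format, of \<alpha>] P[rule_format, of \<beta>] eq[of "s \<alpha> i"] by simp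
    qed
  qed
  \<comment> \<open>Equal modules are isomorphic through the identity, so \<open>range P\<close>
    inherits the uncountability of the set of binary sequences.\<close>
  have "inj P"
  proof (rule injI, rule iso)
    fix \<alpha> \<beta> assume "P \<alpha> = P \<beta>"
    then show "module_isomorphic (P \<alpha>) (P \<beta>)"
      unfolding module_isomorphic_def module_hom_def by (intro bexI[of _ id]) auto
  qed
  then have "uncountable (range P)"
    using uncountable_nat_bool countable_image_inj_on by blast
  moreover have "\<not> module_isomorphic (P \<alpha>) (P \<beta>)" if "P \<alpha> \<noteq> P \<beta>" for \<alpha> \<beta>
    using iso[of \<alpha> \<beta>] that by auto
  ultimately show ?thesis using P by (intro exI[of _ "range P"]) simp
qed

end
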